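(* Let $\mathfrak g=\mathfrak{sl}_3$, with positive roots $\alpha_1,\alpha_2,\alpha_3=\alpha_1+\alpha_2$ and Weyl group $W$. Let $\mathcal{QM}=\mathbb C[E_2,E_4,E_6]$. (a) For all positive integers $k_{\alpha_1},k_{\alpha_2},k_{\alpha_3}$, with the convention $k_{-\alpha_i}=k_{\alpha_i}$, $$\sum_{\sigma\in W}\zeta_{\mathfrak{sl}_3,q}(2k_{\sigma\alpha_1},2k_{\sigma\alpha_2},2k_{\sigma\alpha_3})\in\mathcal{QM}.$$ (b) In particular, for every integer $k\ge1$, $\zeta_{\mathfrak{sl}_3,q}(2k):=\zeta_{\mathfrak{sl}_3,q}(2k,2k,2k)\in\mathcal{QM}$. (c) For every even integer $k>3$, $$\eta(\tau)^{m_{\mathfrak{sl}_3,k}}\,\mathrm{ch}[\mathbf V_{\mathfrak{sl}_3,k}](\tau)\in\mathcal{QM},\qquad m_{\mathfrak{sl}_3,k}=8k-2(k-2)=6k+4.$$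
   Context: Let $\tau$ be in the upper half-plane, $q=e^{2\pi i\tau}$, $\eta(\tau)=q^{1/24}\prod_{i\ge1}(1-q^i)$, and $E_{2j}(\tau)=1-\frac{4j}{B_{2j}}\sum_{n\ge1}\frac{n^{2j-1}q^n}{1-q^n}$ with $B_{2j}$ the Bernoulli numbers. $\mathcal{QM}=\mathbb C[E_2,E_4,E_6]$ is the ring of quasi-modular forms on $\mathrm{SL}(2,\mathbb Z)$ (elements need not be homogeneous in weight). For a simply-laced simple Lie algebra $\mathfrak g$ with positive roots $\Delta_+$ (normalized by $\langle\alpha,\alpha\rangle=2$), dominant integral weights $P_+$, $\rho=\frac12\sum_{\alpha\in\Delta_+}\alpha$ and positive integers $k_\alpha$, set $$\zeta_{\mathfrak g,q}(k_\alpha;\alpha\in\Delta_+)=\sum_{\lambda\in P_+}\frac{q^{\frac12\sum_{\alpha\in\Delta_+}k_\alpha\langle\lambda+\rho,\alpha\rangle}}{\prod_{\alpha\in\Delta_+}(1-q^{\langle\lambda+\rho,\alpha\rangle})^{k_\alpha}}.$$ For $\mathfrak g=\mathfrak{sl}_3$ this is $$\zeta_{\mathfrak{sl}_3,q}(k_1,k_2,k_3)=\sum_{m_1,m_2\ge1}\frac{q^{\frac12(k_1m_1+k_2m_2+k_3(m_1+m_2))}}{(1-q^{m_1})^{k_1}(1-q^{m_2})^{k_2}(1-q^{m_1+m_2})^{k_3}},$$ where $k_i=k_{\alpha_i}$. For $k\ge3$, $\mathbf V_{\mathfrak g,k}$ is Arakawa's genus-zero class-$\mathcal S$ vertex operator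 algebra attached to $\mathfrak g$ and $k$. By a theorem of Arakawa (taken as known), its character is $$\mathrm{ch}[\mathbf V_{\mathfrak g,k}](\tau)=\frac{1}{\eta(\tau)^{m_{\mathfrak g,k}}}\sum_{\lambda\in P_+}(\dim V(\lambda))^k\frac{q^{(k-2)\langle\lambda+\rho,\rho\rangle}}{\prod_{\alpha\in\Delta_+}(1-q^{\langle\lambda+\rho,\alpha\rangle})^{k-2}},\qquad m_{\mathfrak g,k}=k\dim\mathfrak g-(k-2)\,\mathrm{rank}\,\mathfrak g,$$ where $V(\lambda)$ is the irreducible $\mathfrak g$-module of highest weight $\lambda$. For $\mathfrak{sl}_3$, writing $\lambda+\rho=m_1\omega_1+m_2\omega_2$ with $\omega_1,\omega_2$ the fundamental weights and $m_1,m_2\ge1$, one has $\dim V(\lambda)=\frac12m_1m_2(m_1+m_2)$, $\langle\lambda+\rho,\rho\rangle=m_1+m_2$, and $\langle\lambda+\rho,\alpha\rangle\in\{m_1,m_2,m_1+m_2\}$ for $\alpha\in\Delta_+$. *)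

theory Defs
  imports "HOL-Analysis.Analysis" "HOL-Computational_Algebra.Formal_Power_Series"
begin

section \<open>Quasi-modular forms on the full modular group\<close>

text \<open>
  For \<^term>\<open>q = exp (2 * of_real pi * \<i> * \<tau>)\<close>, the value \<open>qpow \<tau> s\<close> is the branch
  of \<open>q\<^sup>s\<close> determined by \<open>\<tau>\<close>. All functions of \<open>\<tau>\<close> below are total on the complex numbers, but
  only their values on the upper half-plane matter.
\<close>

definition qpow :: "complex \<Rightarrow> real \<Rightarrow> complex" where
  "qpow \<tau> s = exp (2 * of_real pi * \<i> * \<tau> * of_real s)"

definition bernoulli :: "nat \<Rightarrow> real" where
  "bernoulli n = fact n * fps_nth (fps_X / (fps_exp 1 - 1)) n"

lemma bernoulli_gf: "(fps_exp 1 - 1) * Abs_fps (\<lambda>n. bernoulli n / fact n) = (fps_X :: real fps)"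
proof -
  have nz: "fps_exp 1 - 1 \<noteq> (0 :: real fps)"
  proof
    assume "fps_exp 1 - 1 = (0 :: real fps)"
    hence "fps_nth (fps_exp 1 - 1 :: real fps) 1 = fps_nth 0 1" by (rule arg_cong)
    thus False by simp
  qed
  have sd: "subdegree (fps_exp 1 - 1 :: real fps) = 1"
    by (rule subdegreeI) auto
  have "Abs_fps (\<lambda>n. bernoulli n / fact n) = (fps_X / (fps_exp 1 - 1) :: real fps)"
    by (simp add: fps_eq_iff bernoulli_def)
  moreover have "(fps_exp 1 - 1) dvd (fps_X :: real fps)"
    using nz sd by (subst fps_dvd_iff) auto
  ultimately show ?thesis by (simp add: dvd_mult_div_cancel)
qed

definition dedekind_eta :: "complex \<Rightarrow> complex" where
  "dedekind_eta \<tau> = qpow \<tau> (1 / 24) * (\<Prod>i. 1 - qpow \<tau> (real (Suc i)))"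

text \<open>\<open>Eis j\<close> is the normalised Eisenstein series of weight \<open>2 * j\<close>, i.e. \<open>E\<^bsub>2j\<^esub>\<close>.\<close>

definition Eis :: "nat \<Rightarrow> complex \<Rightarrow> complex" where
  "Eis j \<tau> = 1 - of_real (4 * real j / bernoulli (2 * j)) *
     (\<Sum>n. of_nat (Suc n) ^ (2 * j - 1) * qpow \<tau> (real (Suc n)) / (1 - qpow \<tau> (real (Suc n))))"

text \<open>
  The ring \<open>\<complex>[E\<^sub>2, E\<^sub>4, E\<^sub>6]\<close>, as the \<open>\<complex>\<close>-algebra of functions generated by the three series.
  The last rule identifies functions that agree on the upper half-plane.
\<close>

inductive_set QM :: "(complex \<Rightarrow> complex) set" where
  const: "(\<lambda>_. c) \<in> QM"
| E2: "Eis 1 \<in> QM"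
| E4: "Eis 2 \<in> QM"
| E6: "Eis 3 \<in> QM"
| add: "f \<in> QM \<Longrightarrow> g \<in> QM \<Longrightarrow> (\<lambda>\<tau>. f \<tau> + g \<tau>) \<in> QM"
| mult: "f \<in> QM \<Longrightarrow> g \<in> QM \<Longrightarrow> (\<lambda>\<tau>. f \<tau> * g \<tau>) \<in> QM"
| cong: "f \<in> QM \<Longrightarrow> (\<And>\<tau>. Im \<tau> > 0 \<Longrightarrow> g \<tau> = f \<tau>) \<Longrightarrow> g \<in> QM"


section \<open>Simply-laced root systems\<close>

text \<open>
  A simply-laced simple Lie algebra enters through its set \<open>R\<close> of positive roots in a Euclidean
  space, normalised by \<open>\<alpha> \<bullet> \<alpha> = 2\<close>; hence every root equals its coroot. The ambient space may be
  larger than the span of \<open>R\<close>, so weights are explicitly required to lie in the span.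
\<close>

definition rho :: "'a::euclidean_space set \<Rightarrow> 'a" where
  "rho R = (1 / 2) *\<^sub>R (\<Sum>\<alpha>\<in>R. \<alpha>)"

definition dominant_weights :: "'a::euclidean_space set \<Rightarrow> 'a set" where
  "dominant_weights R = {\<mu> \<in> span R. \<forall>\<alpha>\<in>R. \<mu> \<bullet> \<alpha> \<in> \<nat>}"

definition reflection :: "'a::euclidean_space \<Rightarrow> 'a \<Rightarrow> 'a" where
  "reflection \<alpha> x = x - (2 * (x \<bullet> \<alpha>) / (\<alpha> \<bullet> \<alpha>)) *\<^sub>R \<alpha>"

inductive_set weyl_group :: "'a::euclidean_space set \<Rightarrow> ('a \<Rightarrow> 'a) set" for R where
  one: "id \<in> weyl_group R"
| refl: "\<alpha> \<in> R \<Longrightarrow> w \<in> weyl_group R \<Longrightarrow> reflection \<alpha> \<circ> w \<in> weyl_group R"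

definition zeta_q :: "'a::euclidean_space set \<Rightarrow> ('a \<Rightarrow> nat) \<Rightarrow> complex \<Rightarrow> complex" where
  "zeta_q R k \<tau> = (\<Sum>\<^sub>\<infinity>\<mu>\<in>dominant_weights R.
     qpow \<tau> ((1 / 2) * (\<Sum>\<alpha>\<in>R. real (k \<alpha>) * ((\<mu> + rho R) \<bullet> \<alpha>))) /
     (\<Prod>\<alpha>\<in>R. (1 - qpow \<tau> ((\<mu> + rho R) \<bullet> \<alpha>)) ^ k \<alpha>))"

text \<open>Weyl's formula for the dimension of the irreducible module \<open>V(\<mu>)\<close>.\<close>

definition dim_V :: "'a::euclidean_space set \<Rightarrow> 'a \<Rightarrow> real" where
  "dim_V R \<mu> = (\<Prod>\<alpha>\<in>R. ((\<mu> + rho R) \<bullet> \<alpha>) / (rho R \<bullet> \<alpha>))"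

definition rank_g :: "'a::euclidean_space set \<Rightarrow> nat" where
  "rank_g R = dim (span R)"

definition dim_g :: "'a::euclidean_space set \<Rightarrow> nat" where
  "dim_g R = 2 * card R + rank_g R"

definition m_exponent :: "'a::euclidean_space set \<Rightarrow> nat \<Rightarrow> nat" where
  "m_exponent R k = k * dim_g R - (k - 2) * rank_g R"

text \<open>
  The character of the genus-zero class \<open>\<S>\<close> vertex operator algebra \<open>V\<^bsub>g,k\<^esub>\<close> for \<open>k \<ge> 3\<close>, given by
  Arakawa's character formula.
\<close>

definition ch_V :: "'a::euclidean_space set \<Rightarrow> nat \<Rightarrow> complex \<Rightarrow> complex" where
  "ch_V R k \<tau> = 1 / dedekind_eta \<tau> ^ m_exponent R k *
     (\<Sum>\<^sub>\<infinity>\<mu>\<in>dominant_weights R. of_real (dim_V R \<mu>) ^ k *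
        qpow \<tau> (real (k - 2) * ((\<mu> + rho R) \<bullet> rho R)) /
        (\<Prod>\<alpha>\<in>R. (1 - qpow \<tau> ((\<mu> + rho R) \<bullet> \<alpha>)) ^ (k - 2)))"


section \<open>The Lie algebra \<open>sl\<^sub>3\<close>\<close>

text \<open>The roots are the differences of distinct standard basis vectors of \<open>\<real>\<^sup>3\<close>.\<close>

definition \<alpha>\<^sub>1 :: "real ^ 3" where "\<alpha>\<^sub>1 = axis 1 1 - axis 2 1"
definition \<alpha>\<^sub>2 :: "real ^ 3" where "\<alpha>\<^sub>2 = axis 2 1 - axis 3 1"
definition \<alpha>\<^sub>3 :: "real ^ 3" where "\<alpha>\<^sub>3 = \<alpha>\<^sub>1 + \<alpha>\<^sub>2"

definition sl3 :: "(real ^ 3) set" where "sl3 = {\<alpha>\<^sub>1, \<alpha>\<^sub>2, \<alpha>\<^sub>3}"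

definition zeta_sl3 :: "nat \<Rightarrow> nat \<Rightarrow> nat \<Rightarrow> complex \<Rightarrow> complex" where
  "zeta_sl3 k1 k2 k3 =
     zeta_q sl3 (\<lambda>\<alpha>. if \<alpha> = \<alpha>\<^sub>1 then k1 else if \<alpha> = \<alpha>\<^sub>2 then k2 else k3)"

lemma inner_roots [simp]:
  "\<alpha>\<^sub>1 \<bullet> \<alpha>\<^sub>1 = 2" "\<alpha>\<^sub>2 \<bullet> \<alpha>\<^sub>2 = 2" "\<alpha>\<^sub>1 \<bullet> \<alpha>\<^sub>2 = - 1" "\<alpha>\<^sub>2 \<bullet> \<alpha>\<^sub>1 = - 1"
  by (simp_all add: \<alpha>\<^sub>1_def \<alpha>\<^sub>2_def inner_diff_left inner_diff_right inner_axis_axis)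

lemma roots_distinct [simp]:
  "\<alpha>\<^sub>1 \<noteq> \<alpha>\<^sub>2" "\<alpha>\<^sub>1 \<noteq> \<alpha>\<^sub>3" "\<alpha>\<^sub>2 \<noteq> \<alpha>\<^sub>3" "\<alpha>\<^sub>2 \<noteq> \<alpha>\<^sub>1" "\<alpha>\<^sub>3 \<noteq> \<alpha>\<^sub>1" "\<alpha>\<^sub>3 \<noteq> \<alpha>\<^sub>2"
proof -
  have nz: "\<alpha>\<^sub>1 \<noteq> 0" "\<alpha>\<^sub>2 \<noteq> 0"
    by (metis inner_roots(1) inner_zero_left zero_neq_numeral)
       (metis inner_roots(2) inner_zero_left zero_neq_numeral)
  have "\<alpha>\<^sub>1 \<bullet> \<alpha>\<^sub>1 \<noteq> \<alpha>\<^sub>1 \<bullet> \<alpha>\<^sub>2" by simp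
  hence a: "\<alpha>\<^sub>1 \<noteq> \<alpha>\<^sub>2" by metis
  have b: "\<alpha>\<^sub>1 \<noteq> \<alpha>\<^sub>3" "\<alpha>\<^sub>2 \<noteq> \<alpha>\<^sub>3" using nz by (simp_all add: \<alpha>\<^sub>3_def)
  show "\<alpha>\<^sub>1 \<noteq> \<alpha>\<^sub>2" "\<alpha>\<^sub>1 \<noteq> \<alpha>\<^sub>3" "\<alpha>\<^sub>2 \<noteq> \<alpha>\<^sub>3"
       "\<alpha>\<^sub>2 \<noteq> \<alpha>\<^sub>1" "\<alpha>\<^sub>3 \<noteq> \<alpha>\<^sub>1" "\<alpha>\<^sub>3 \<noteq> \<alpha>\<^sub>2"
    by (fact a b a[symmetric] b[symmetric])+
qed

lemma rho_sl3: "rho sl3 = \<alpha>\<^sub>3"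
proof -
  have "(\<Sum>\<alpha>\<in>sl3. \<alpha>) = \<alpha>\<^sub>1 + (\<alpha>\<^sub>2 + \<alpha>\<^sub>3)" by (simp add: sl3_def)
  also have "\<dots> = 2 *\<^sub>R \<alpha>\<^sub>3" by (simp add: \<alpha>\<^sub>3_def scaleR_2)
  finally show ?thesis by (simp add: rho_def)
qed

definition \<omega>\<^sub>1 :: "real ^ 3" where "\<omega>\<^sub>1 = (2 / 3) *\<^sub>R \<alpha>\<^sub>1 + (1 / 3) *\<^sub>R \<alpha>\<^sub>2"
definition \<omega>\<^sub>2 :: "real ^ 3" where "\<omega>\<^sub>2 = (1 / 3) *\<^sub>R \<alpha>\<^sub>1 + (2 / 3) *\<^sub>R \<alpha>\<^sub>2"

lemma inner_fundamental_weights [simp]: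
  "\<omega>\<^sub>1 \<bullet> \<alpha>\<^sub>1 = 1" "\<omega>\<^sub>1 \<bullet> \<alpha>\<^sub>2 = 0" "\<omega>\<^sub>2 \<bullet> \<alpha>\<^sub>1 = 0" "\<omega>\<^sub>2 \<bullet> \<alpha>\<^sub>2 = 1"
  by (simp_all add: \<omega>\<^sub>1_def \<omega>\<^sub>2_def inner_add_left)

text \<open>\<open>sl3_weight (m\<^sub>1, m\<^sub>2)\<close> is the weight \<open>\<mu>\<close> with \<open>\<mu> + \<rho> = m\<^sub>1 \<omega>\<^sub>1 + m\<^sub>2 \<omega>\<^sub>2\<close>.\<close>

definition sl3_weight :: "nat \<times> nat \<Rightarrow> real ^ 3" where
  "sl3_weight = (\<lambda>(m1, m2). real m1 *\<^sub>R \<omega>\<^sub>1 + real m2 *\<^sub>R \<omega>\<^sub>2 - rho sl3)"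

lemma inner_sl3_weight:
  "(sl3_weight (m1, m2) + rho sl3) \<bullet> \<alpha>\<^sub>1 = real m1"
  "(sl3_weight (m1, m2) + rho sl3) \<bullet> \<alpha>\<^sub>2 = real m2"
  "(sl3_weight (m1, m2) + rho sl3) \<bullet> \<alpha>\<^sub>3 = real m1 + real m2"
  by (simp_all add: sl3_weight_def inner_add_left \<alpha>\<^sub>3_def inner_add_right)

lemma dominant_weights_sl3: "bij_betw sl3_weight ({1..} \<times> {1..}) (dominant_weights sl3)"
proof (rule bij_betw_imageI)
  show "inj_on sl3_weight ({1..} \<times> {1..})"
    by (rule inj_onI) (metis inner_sl3_weight(1,2) of_nat_eq_iff surj_pair)
  have w: "\<omega>\<^sub>1 = (2 / 3) *\<^sub>R \<alpha>\<^sub>1 + (1 / 3) *\<^sub>R \<alpha>\<^sub>2" "\<omega>\<^sub>2 = (1 / 3) *\<^sub>R \<alpha>\<^sub>1 + (2 / 3) *\<^sub>R \<alpha>\<^sub>2"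
    by (simp_all add: \<omega>\<^sub>1_def \<omega>\<^sub>2_def)
  have rho: "\<alpha>\<^sub>3 = \<omega>\<^sub>1 + \<omega>\<^sub>2"
    by (simp add: vec_eq_iff w \<alpha>\<^sub>3_def field_simps)
  have ip: "(a *\<^sub>R \<omega>\<^sub>1 + b *\<^sub>R \<omega>\<^sub>2) \<bullet> \<alpha>\<^sub>1 = a" "(a *\<^sub>R \<omega>\<^sub>1 + b *\<^sub>R \<omega>\<^sub>2) \<bullet> \<alpha>\<^sub>2 = b" 
     "(a *\<^sub>R \<omega>\<^sub>1 + b *\<^sub>R \<omega>\<^sub>2) \<bullet> \<alpha>\<^sub>3 = a + b" for a b
    by (simp_all add: \<alpha>\<^sub>3_def inner_add_left inner_add_right)
  have in_span: "a *\<^sub>R \<omega>\<^sub>1 + b *\<^sub>R \<omega>\<^sub>2 \<in> span sl3" for a b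
    unfolding w by (intro span_add span_scale span_base) (auto simp: sl3_def)
  have dec: "\<exists>a b. x = a *\<^sub>R \<omega>\<^sub>1 + b *\<^sub>R \<omega>\<^sub>2" if "x \<in> span sl3" for x
    using that
  proof (induction rule: span_induct_alt)
    case base
    show ?case by (rule exI[of _ 0], rule exI[of _ 0]) simp
  next
    case (step c x y)
    have "\<alpha>\<^sub>1 = 2 *\<^sub>R \<omega>\<^sub>1 + (- 1) *\<^sub>R \<omega>\<^sub>2" "\<alpha>\<^sub>2 = (- 1) *\<^sub>R \<omega>\<^sub>1 + 2 *\<^sub>R \<omega>\<^sub>2"
         "\<alpha>\<^sub>3 = 1 *\<^sub>R \<omega>\<^sub>1 + 1 *\<^sub>R \<omega>\<^sub>2"
      by (simp_all add: vec_eq_iff w \<alpha>\<^sub>3_def field_simps)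
    moreover have "x = \<alpha>\<^sub>1 \<or> x = \<alpha>\<^sub>2 \<or> x = \<alpha>\<^sub>3" using step(1) by (simp add: sl3_def)
    ultimately obtain d e where "x = d *\<^sub>R \<omega>\<^sub>1 + e *\<^sub>R \<omega>\<^sub>2" by blast
    moreover from step obtain a b where "y = a *\<^sub>R \<omega>\<^sub>1 + b *\<^sub>R \<omega>\<^sub>2" by blast
    ultimately have "c *\<^sub>R x + y = (c * d + a) *\<^sub>R \<omega>\<^sub>1 + (c * e + b) *\<^sub>R \<omega>\<^sub>2"
      by (simp add: algebra_simps)
    thus ?case by blast
  qed
  show "sl3_weight ` ({1..} \<times> {1..}) = dominant_weights sl3"
  proof (intro equalityI subsetI)
    fix x assume "x \<in> sl3_weight ` ({1..} \<times> {1..})"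
    then obtain m n where mn: "m \<ge> 1" "n \<ge> 1" "x = sl3_weight (m, n)" by auto
    have "x = real (m - 1) *\<^sub>R \<omega>\<^sub>1 + real (n - 1) *\<^sub>R \<omega>\<^sub>2"
      using mn by (simp add: sl3_weight_def rho_sl3 rho of_nat_diff algebra_simps)
    thus "x \<in> dominant_weights sl3"
      using in_span ip by (auto simp: dominant_weights_def sl3_def simp del: of_nat_diff)
  next
    fix x assume x: "x \<in> dominant_weights sl3"
    hence "x \<in> span sl3" by (simp add: dominant_weights_def)
    from dec[OF this] obtain a b where ab: "x = a *\<^sub>R \<omega>\<^sub>1 + b *\<^sub>R \<omega>\<^sub>2" by blast
    from x have "a \<in> \<nat>" "b \<in> \<nat>" using ip by (auto simp: dominant_weights_def sl3_def ab)
    then obtain m n where "a = real m" "b = real n" by (auto elim!: Nats_cases)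
    hence "x = sl3_weight (Suc m, Suc n)"
      by (simp add: ab sl3_weight_def rho_sl3 rho algebra_simps)
    thus "x \<in> sl3_weight ` ({1..} \<times> {1..})" by auto
  qed
qed

lemma zeta_sl3_eq:
  "zeta_sl3 k1 k2 k3 \<tau> = (\<Sum>\<^sub>\<infinity>(m1, m2)\<in>{1..} \<times> {1..}.
     qpow \<tau> (1 / 2 * (real k1 * real m1 + real k2 * real m2 + real k3 * (real m1 + real m2))) /
     ((1 - qpow \<tau> (real m1)) ^ k1 * (1 - qpow \<tau> (real m2)) ^ k2 *
      (1 - qpow \<tau> (real m1 + real m2)) ^ k3))"
  unfolding zeta_sl3_def zeta_q_def infsum_reindex_bij_betw[OF dominant_weights_sl3, symmetric]
proof (intro infsum_cong, clarify, goal_cases)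
  case (1 m1 m2)
  have s: "(\<Sum>\<alpha>\<in>sl3. f \<alpha>) = f \<alpha>\<^sub>1 + (f \<alpha>\<^sub>2 + f \<alpha>\<^sub>3)" for f :: "real ^ 3 \<Rightarrow> real"
    by (simp add: sl3_def)
  have p: "(\<Prod>\<alpha>\<in>sl3. f \<alpha>) = f \<alpha>\<^sub>1 * (f \<alpha>\<^sub>2 * f \<alpha>\<^sub>3)" for f :: "real ^ 3 \<Rightarrow> complex"
    by (simp add: sl3_def)
  show ?case by (simp add: s p inner_sl3_weight add.assoc mult.assoc)
qed

lemma dim_V_sl3:
  "dim_V sl3 (sl3_weight (m1, m2)) = 1 / 2 * real m1 * real m2 * (real m1 + real m2)"
proof -
  have "rho sl3 \<bullet> \<alpha>\<^sub>1 = 1" "rho sl3 \<bullet> \<alpha>\<^sub>2 = 1" "rho sl3 \<bullet> \<alpha>\<^sub>3 = 2"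
    by (simp_all add: rho_sl3 \<alpha>\<^sub>3_def inner_add_left inner_add_right)
  moreover have "(\<Prod>\<alpha>\<in>sl3. f \<alpha>) = f \<alpha>\<^sub>1 * (f \<alpha>\<^sub>2 * f \<alpha>\<^sub>3)" for f :: "real ^ 3 \<Rightarrow> real"
    by (simp add: sl3_def)
  ultimately show ?thesis by (simp add: dim_V_def inner_sl3_weight)
qed

lemma weyl_group_sl3:
  "weyl_group sl3 =
     {\<lambda>x. vector [x $ 1, x $ 2, x $ 3], \<lambda>x. vector [x $ 2, x $ 1, x $ 3],
      \<lambda>x. vector [x $ 1, x $ 3, x $ 2], \<lambda>x. vector [x $ 3, x $ 2, x $ 1],
      \<lambda>x. vector [x $ 2, x $ 3, x $ 1], \<lambda>x. vector [x $ 3, x $ 1, x $ 2]}" (is "_ = ?S")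
proof -
  have n: "\<alpha>\<^sub>3 \<bullet> \<alpha>\<^sub>3 = 2" by (simp add: \<alpha>\<^sub>3_def inner_add_left inner_add_right)
  have r: "reflection \<alpha>\<^sub>1 = (\<lambda>x. vector [x $ 2, x $ 1, x $ 3])"
          "reflection \<alpha>\<^sub>2 = (\<lambda>x. vector [x $ 1, x $ 3, x $ 2])"
          "reflection \<alpha>\<^sub>3 = (\<lambda>x. vector [x $ 3, x $ 2, x $ 1])"
    by (simp_all add: fun_eq_iff reflection_def n vec_eq_iff forall_3)
       (simp_all add: \<alpha>\<^sub>1_def \<alpha>\<^sub>2_def \<alpha>\<^sub>3_def axis_def inner_vec_def sum_3)
  have i: "id = (\<lambda>x :: real ^ 3. vector [x $ 1, x $ 2, x $ 3])"
    by (simp add: fun_eq_iff vec_eq_iff forall_3)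
  show ?thesis
  proof (intro equalityI subsetI)
    fix w assume "w \<in> weyl_group sl3"
    thus "w \<in> ?S"
    proof induction
      case one
      show ?case by (simp add: i)
    next
      case (refl \<alpha> w)
      from refl.hyps(1) have "\<alpha> = \<alpha>\<^sub>1 \<or> \<alpha> = \<alpha>\<^sub>2 \<or> \<alpha> = \<alpha>\<^sub>3" by (simp add: sl3_def)
      moreover have "reflection \<alpha>\<^sub>1 \<circ> w \<in> ?S"
        using refl.IH by (elim insertE emptyE) (simp_all only: r comp_def vector_3 insert_iff simp_thms)
      moreover have "reflection \<alpha>\<^sub>2 \<circ> w \<in> ?S"
        using refl.IH by (elim insertE emptyE) (simp_all only: r comp_def vector_3 insert_iff simp_thms)
      moreover have "reflection \<alpha>\<^sub>3 \<circ> w \<in> ?S"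
        using refl.IH by (elim insertE emptyE) (simp_all only: r comp_def vector_3 insert_iff simp_thms)
      ultimately show ?case by (elim disjE) (simp_all only:)
    qed
  next
    fix w assume w: "w \<in> ?S"
    have g: "reflection \<alpha> \<circ> v \<in> weyl_group sl3" if "\<alpha> \<in> {\<alpha>\<^sub>1, \<alpha>\<^sub>2, \<alpha>\<^sub>3}" "v \<in> weyl_group sl3" for \<alpha> v
      using weyl_group.refl[of \<alpha> sl3 v] that by (simp add: sl3_def)
    have 1: "reflection \<alpha> \<in> weyl_group sl3" if "\<alpha> \<in> {\<alpha>\<^sub>1, \<alpha>\<^sub>2, \<alpha>\<^sub>3}" for \<alpha>
      using g[OF that weyl_group.one] by simp
    have "id \<in> weyl_group sl3" "reflection \<alpha>\<^sub>1 \<in> weyl_group sl3" "reflection \<alpha>\<^sub>2 \<in> weyl_group sl3"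
      "reflection \<alpha>\<^sub>3 \<in> weyl_group sl3" "reflection \<alpha>\<^sub>1 \<circ> reflection \<alpha>\<^sub>2 \<in> weyl_group sl3"
      "reflection \<alpha>\<^sub>2 \<circ> reflection \<alpha>\<^sub>1 \<in> weyl_group sl3"
      using g 1 weyl_group.one by auto
    thus "w \<in> weyl_group sl3" using w by (auto simp: i r comp_def)
  qed
qed

lemma card_weyl_group_sl3: "card (weyl_group sl3) = 6"
proof -
  define f :: "(real ^ 3 \<Rightarrow> real ^ 3) \<Rightarrow> real"
    where "f = (\<lambda>w. let v = w (vector [1, 2, 3]) in 10 * v $ 1 + v $ 2)"
  have f: "f (\<lambda>x. vector [x $ 1, x $ 2, x $ 3]) = 12" "f (\<lambda>x. vector [x $ 2, x $ 1, x $ 3]) = 21"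
    "f (\<lambda>x. vector [x $ 1, x $ 3, x $ 2]) = 13" "f (\<lambda>x. vector [x $ 3, x $ 2, x $ 1]) = 32"
    "f (\<lambda>x. vector [x $ 2, x $ 3, x $ 1]) = 23" "f (\<lambda>x. vector [x $ 3, x $ 1, x $ 2]) = 31"
    by (simp_all add: f_def)
  have "f ` weyl_group sl3 = {12, 21, 13, 32, 23, 31}"
    by (simp only: weyl_group_sl3 image_insert image_empty f)
  hence "card (f ` weyl_group sl3) = 6" by simp
  moreover have "finite (weyl_group sl3)" unfolding weyl_group_sl3 by (intro finite.intros)
  moreover have "card {a, b, c, d, e, g} \<le> 6" for a b c d e g :: "real ^ 3 \<Rightarrow> real ^ 3"
    using card_length[of "[a, b, c, d, e, g]"] by simp
  hence "card (weyl_group sl3) \<le> 6" unfolding weyl_group_sl3 .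
  ultimately show ?thesis using card_image_le[of "weyl_group sl3" f] by linarith
qed

end

(*
  Let psi(x) = (1 + x) / (2 (1 - x)) and psi_d = (x d/dx)^d psi, a polynomial in psi. Up to symmetry
  under the Weyl group, the series in question are sums over all integers k, l with
  k, l, k + l nonzero of products of powers of k, l, k + l and of psi_1(q^k), psi_1(q^l),
  psi_1(q^(k+l)): the six Weyl chambers of sl_3 fill this region.

  The addition formula psi(x) psi(y) = psi(xy) (psi(x) + psi(y)) - 1/4 and its derivatives evaluate
  the inner sum over k + l = m: it is a combination of terms m^s psi_e(q^m) whose coefficients are
  moments, i.e. sums over k of k^c psi_d(q^k). So everything reduces to showing that the moments lie
  in C[E2, E4, E6]. Applying the same evaluation to the product of two moments expresses it through
  single moments. For c = 0 this gives two relations which determine the moment of order w + 1 from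
  those of lower order as soon as w >= 6, the symmetry of moments in (c, d) and E2, E4, E6 being the
  start; for c > 0 it expresses the moments of weight exponent c + 1 through those of exponent
  at most c. No modular transformation is used.
*)
theory Submission
  imports Defs
begin

section \<open>The kernels and their addition formula\<close>

text \<open>Within one Weyl chamber a diagonal k + l = m is cut off, for instance to 0 < k < m.
  Gluing all six lets k run over all integers, and only then does the addition formula turn the
  inner sum into complete moments. The kernel psi itself tends to 1/2 and - 1/2 at the two ends, so
  these moments converge only after the signs are subtracted. Summed back along a diagonal, the
  signs leave the power sum m^(c+1) / (c+1) + ..., and this one term of higher exponent is what
  makes the induction on c advance.

  For c = 0 there are two unknowns of the same weight: the moment of order w + 1, which is an
  Eisenstein series of weight w + 2 without its constant term, and the moment with exponents (1, w),
  which is the derivative q d/dq of the series of weight w. Each splitting of w into two odd parts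
  gives a linear relation with coefficient 1 at the second unknown, so two splittings eliminate it.
  The first even number with two such splittings is 6 = 1 + 5 = 3 + 3; the orders 1, 3, 5 left over
  as input are exactly E2, E4, E6.\<close>

definition cayley :: "complex \<Rightarrow> complex" where
  "cayley x = (1 + x) / (2 * (1 - x))"

text \<open>
  \<open>cayley\<close> satisfies \<open>x * deriv f x = f x ^ 2 - 1 / 4\<close>, so its images under the powers
  of \<open>x * d / dx\<close> are the following polynomials in it.
\<close>

fun kernel_poly :: "nat \<Rightarrow> complex poly" where
  "kernel_poly 0 = [:0, 1:]"
| "kernel_poly (Suc d) = [:- 1 / 4, 0, 1:] * pderiv (kernel_poly d)"

declare kernel_poly.simps(2) [simp del]

definition kern :: "nat \<Rightarrow> complex \<Rightarrow> complex" where
  "kern d x = poly (kernel_poly d) (cayley x)"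

lemma kern_0: "kern 0 x = cayley x"
  by (simp add: kern_def)

lemma cayley_square: "x \<noteq> 1 \<Longrightarrow> cayley x ^ 2 - 1 / 4 = x / (1 - x) ^ 2"
proof -
  assume "x \<noteq> 1"
  hence "1 - x \<noteq> 0" by simp
  thus ?thesis unfolding cayley_def
    by (simp add: power_divide divide_simps power_mult_distrib)
       (simp add: power2_eq_square algebra_simps)
qed

text \<open>The link with the series in question:
  \<open>q ^ (n * m) / (1 - q ^ m) ^ (2 * n)\<close>, the factor of a root with even exponent, is
  the n-th power of \<open>kern 1 (q ^ m)\<close>.\<close>

lemma kern_1: "x \<noteq> 1 \<Longrightarrow> kern 1 x = x / (1 - x) ^ 2"
  using cayley_square[of x]
  by (simp add: kern_def kernel_poly.simps(2) power2_eq_square pderiv_pCons algebra_simps)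

lemma has_field_derivative_cayley:
  assumes "x \<noteq> 1"
  shows "(cayley has_field_derivative 1 / (1 - x) ^ 2) (at x)"
proof -
  have "1 - x \<noteq> 0" using assms by simp
  thus ?thesis unfolding cayley_def [abs_def]
    by (auto intro!: derivative_eq_intros simp: divide_simps) (simp add: power2_eq_square algebra_simps)
qed

lemma has_field_derivative_kern:
  assumes "x \<noteq> 0" "x \<noteq> 1"
  shows "(kern d has_field_derivative kern (Suc d) x / x) (at x)"
proof -
  have "(kern d has_field_derivative poly (pderiv (kernel_poly d)) (cayley x) * (1 / (1 - x) ^ 2)) (at x)"
    unfolding kern_def [abs_def]
    by (rule DERIV_chain2[OF poly_DERIV has_field_derivative_cayley[OF assms(2)]])
  moreover have "kern (Suc d) x = (cayley x ^ 2 - 1 / 4) * poly (pderiv (kernel_poly d)) (cayley x)"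
    unfolding kern_def kernel_poly.simps poly_mult by (simp add: power2_eq_square algebra_simps)
  hence "kern (Suc d) x / x = poly (pderiv (kernel_poly d)) (cayley x) * (1 / (1 - x) ^ 2)"
    using assms by (simp add: cayley_square)
  ultimately show ?thesis by simp
qed

text \<open>The operator x d/dx commutes with the dilation x -> x y, so differentiating in one
  variable also just raises the order of the kernel at x y.\<close>

lemma has_field_derivative_kern_mult:
  assumes "x \<noteq> 0" "y \<noteq> 0" "x * y \<noteq> 1"
  shows "((\<lambda>x. kern d (x * y)) has_field_derivative kern (Suc d) (x * y) / x) (at x)"
proof -
  have "((\<lambda>x. kern d (x * y)) has_field_derivative kern (Suc d) (x * y) / (x * y) * y) (at x)"
    by (rule DERIV_chain2[OF has_field_derivative_kern])
       (use assms in \<open>auto intro!: derivative_eq_intros\<close>)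
  thus ?thesis using assms by simp
qed

text \<open>The polynomial of order 0 is odd, differentiation flips parity, and the factor psi^2 -
  1/4 is even.\<close>

lemma kernel_poly_parity:
  "pcompose (kernel_poly d) [:0, - 1:] = smult ((- 1) ^ Suc d) (kernel_poly d)"
proof (induction d)
  case 0
  show ?case by (simp add: pcompose_pCons)
next
  case (Suc d)
  have "pderiv (pcompose (kernel_poly d) [:0, - 1:]) = smult ((- 1) ^ Suc d) (pderiv (kernel_poly d))"
    by (simp only: Suc pderiv_smult)
  hence *: "pcompose (pderiv (kernel_poly d)) [:0, - 1:] = smult ((- 1) ^ d) (pderiv (kernel_poly d))"
    by (simp add: pderiv_pcompose pderiv_pCons)
  have "pcompose [:- 1 / 4, 0, 1 :: complex:] [:0, - 1:] = [:- 1 / 4, 0, 1:]"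
    by (simp add: pcompose_pCons)
  hence "pcompose (kernel_poly (Suc d)) [:0, - 1:] = smult ((- 1) ^ d) (kernel_poly (Suc d))"
    unfolding kernel_poly.simps pcompose_mult * mult_smult_right by (rule arg_cong)
  thus ?case by simp
qed

lemma cayley_inverse: "x \<noteq> 0 \<Longrightarrow> cayley (inverse x) = - cayley x"
proof (cases "x = 1")
  case True
  \<comment> \<open>Division by zero makes \<open>cayley 1\<close> equal to 0, so the identity also
    holds at the pole.\<close>
  thus ?thesis by (simp add: cayley_def)
next
  case False
  assume "x \<noteq> 0"
  moreover have "1 - x \<noteq> 0" "x - 1 \<noteq> 0" using False by auto
  ultimately show ?thesis unfolding cayley_def
    by (simp add: divide_simps) (simp add: algebra_simps)
qed

lemma kern_inverse:
  assumes "x \<noteq> 0"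
  shows "kern d (inverse x) = (- 1) ^ Suc d * kern d x"
proof -
  have "kern d (inverse x) = poly (pcompose (kernel_poly d) [:0, - 1:]) (cayley x)"
    using assms by (simp add: kern_def cayley_inverse poly_pcompose)
  thus ?thesis by (simp add: kernel_poly_parity kern_def)
qed

text \<open>With x = exp t one has psi(x) = - coth (t / 2) / 2, and this is the addition theorem of
  coth cleared of its denominator.\<close>

lemma cayley_addition:
  assumes "x \<noteq> 1" "y \<noteq> 1" "x * y \<noteq> 1"
  shows "cayley x * cayley y = cayley (x * y) * cayley x + cayley (x * y) * cayley y - 1 / 4"
proof -
  have "1 - x \<noteq> 0" "1 - y \<noteq> 0" "1 - x * y \<noteq> 0" using assms by auto
  thus ?thesis unfolding cayley_def
    by (simp add: divide_simps) (simp add: algebra_simps)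
qed

text \<open>Pascal's rule as it occurs in the Leibniz rule: \<open>f i j\<close> stands for a
  product whose factors have been differentiated i and j times, and one more derivative raises
  either index.\<close>

lemma sum_binomial_Suc:
  fixes f :: "nat \<Rightarrow> nat \<Rightarrow> complex"
  shows "(\<Sum>i\<le>Suc d. of_nat (Suc d choose i) * f i (Suc d - i)) =
         (\<Sum>i\<le>d. of_nat (d choose i) * (f (Suc i) (d - i) + f i (Suc (d - i))))"
proof -
  have "(\<Sum>i\<le>Suc d. of_nat (Suc d choose i) * f i (Suc d - i)) =
        f 0 (Suc d) + (\<Sum>i\<le>d. of_nat ((d choose i) + (d choose Suc i)) * f (Suc i) (d - i))"
    by (subst sum.atMost_Suc_shift) (simp add: of_nat_add [symmetric] del: of_nat_add)
  also have "\<dots> = (\<Sum>i\<le>d. of_nat (d choose i) * f (Suc i) (d - i)) +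
      (f 0 (Suc d) + (\<Sum>i\<le>d. of_nat (d choose Suc i) * f (Suc i) (d - i)))"
    by (simp add: sum.distrib algebra_simps)
  also have "f 0 (Suc d) + (\<Sum>i\<le>d. of_nat (d choose Suc i) * f (Suc i) (d - i)) =
      (\<Sum>i\<le>Suc d. of_nat (d choose i) * f i (Suc d - i))"
    by (subst sum.atMost_Suc_shift) simp
  also have "\<dots> = (\<Sum>i\<le>d. of_nat (d choose i) * f i (Suc (d - i)))"
    by (simp add: Suc_diff_le)
  finally show ?thesis by (simp add: sum.distrib algebra_simps)
qed

lemma derivatives_eq_if_eq_on_open:
  fixes f g :: "complex \<Rightarrow> complex"
  assumes "open S" "x \<in> S" "\<And>z. z \<in> S \<Longrightarrow> f z = g z"
    and "(f has_field_derivative f') (at x)" "(g has_field_derivative g') (at x)"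
  shows "f' = g'"
proof -
  have "(g has_field_derivative f') (at x)"
    using assms(4) by (rule has_field_derivative_transform_within_open) (use assms in auto)
  thus ?thesis using assms(5) DERIV_unique by blast
qed

text \<open>Obtained from the case \<open>d1 = d2 = 0\<close> by differentiating repeatedly in \<open>x\<close> and in \<open>y\<close>.\<close>

lemma kern_addition:
  assumes "x \<noteq> 0" "y \<noteq> 0" "x \<noteq> 1" "y \<noteq> 1" "x * y \<noteq> 1"
  shows "kern d1 x * kern d2 y =
    (\<Sum>i\<le>d1. of_nat (d1 choose i) * (kern (d2 + i) (x * y) * kern (d1 - i) x)) +
    (\<Sum>j\<le>d2. of_nat (d2 choose j) * (kern (d1 + j) (x * y) * kern (d2 - j) y)) -
    (if d1 = 0 \<and> d2 = 0 then 1 / 4 else 0)"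
proof -
  define rhs where "rhs = (\<lambda>d1 d2 x y.
    (\<Sum>i\<le>d1. of_nat (d1 choose i) * (kern (d2 + i) (x * y) * kern (d1 - i) x)) +
    (\<Sum>j\<le>d2. of_nat (d2 choose j) * (kern (d1 + j) (x * y) * kern (d2 - j) y)) -
    (if d1 = 0 \<and> d2 = 0 then 1 / 4 else 0))"
  \<comment> \<open>By this symmetry only derivatives in the first variable are needed: raising
    \<open>d2\<close> is raising \<open>d1\<close> after exchanging the two variables.\<close>
  have swap: "rhs d1 d2 x y = rhs d2 d1 y x" for d1 d2 x y
    by (simp add: rhs_def mult.commute[of x y] add.commute conj_commute)
  have step: "kern (Suc d1) x * kern d2 y = rhs (Suc d1) d2 x y"
    if IH: "\<And>x y. x \<noteq> 0 \<Longrightarrow> y \<noteq> 0 \<Longrightarrow> x \<noteq> 1 \<Longrightarrow> y \<noteq> 1 \<Longrightarrow> x * y \<noteq> 1 \<Longrightarrow> kern d1 x * kern d2 y = rhs d1 d2 x y"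
      and xy: "x \<noteq> 0" "y \<noteq> 0" "x \<noteq> 1" "y \<noteq> 1" "x * y \<noteq> 1" for d1 d2 x y
  proof -
    \<comment> \<open>The excluded points are the origin and the poles of the kernels at z and at z
      y; on the rest the identity may be differentiated.\<close>
    define S where "S = - {0, 1, inverse y}"
    have "open S" unfolding S_def by (intro open_Compl finite_imp_closed) auto
    have "x \<in> S" using xy by (auto simp: S_def field_simps)
    have eq: "kern d1 z * kern d2 y = rhs d1 d2 z y" if "z \<in> S" for z
      by (rule IH) (use that xy in \<open>auto simp: S_def field_simps\<close>)
    have d1: "((\<lambda>z. kern d1 z * kern d2 y) has_field_derivative kern (Suc d1) x / x * kern d2 y) (at x)"
      by (auto intro!: derivative_eq_intros has_field_derivative_kern xy)
    \<comment> \<open>The constant 1/4 has derivative 0, which is why it survives only for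
      \<open>d1 = d2 = 0\<close>.\<close>
    have d2: "((\<lambda>z. rhs d1 d2 z y) has_field_derivative
        ((\<Sum>i\<le>d1. of_nat (d1 choose i) *
            (kern (Suc (d2 + i)) (x * y) / x * kern (d1 - i) x +
             kern (Suc (d1 - i)) x / x * kern (d2 + i) (x * y))) +
         (\<Sum>j\<le>d2. of_nat (d2 choose j) * (kern (Suc (d1 + j)) (x * y) / x * kern (d2 - j) y)) - 0)) (at x)"
      unfolding rhs_def
      by (intro DERIV_add DERIV_diff DERIV_sum DERIV_cmult DERIV_mult DERIV_cmult_right
            has_field_derivative_kern_mult has_field_derivative_kern DERIV_const xy)
    have "kern (Suc d1) x / x * kern d2 y = 
        ((\<Sum>i\<le>d1. of_nat (d1 choose i) *
            (kern (Suc (d2 + i)) (x * y) / x * kern (d1 - i) x +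
             kern (Suc (d1 - i)) x / x * kern (d2 + i) (x * y))) +
         (\<Sum>j\<le>d2. of_nat (d2 choose j) * (kern (Suc (d1 + j)) (x * y) / x * kern (d2 - j) y)) - 0)"
      by (rule derivatives_eq_if_eq_on_open[OF \<open>open S\<close> \<open>x \<in> S\<close> eq d1 d2])
    also have "\<dots> = ((\<Sum>i\<le>d1. of_nat (d1 choose i) *
            (kern (d2 + Suc i) (x * y) * kern (d1 - i) x +
             kern (d2 + i) (x * y) * kern (Suc (d1 - i)) x)) +
         (\<Sum>j\<le>d2. of_nat (d2 choose j) * (kern (Suc d1 + j) (x * y) * kern (d2 - j) y))) / x"
      by (simp add: add_divide_distrib sum_divide_distrib sum.distrib algebra_simps)
    also have "\<dots> = rhs (Suc d1) d2 x y / x"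
      by (subst sum_binomial_Suc[where f = "\<lambda>i j. kern (d2 + i) (x * y) * kern j x", symmetric])
         (simp add: rhs_def)
    finally show ?thesis using xy by (simp add: field_simps)
  qed
  have base: "kern d1 x * kern 0 y = rhs d1 0 x y"
    if "x \<noteq> 0" "y \<noteq> 0" "x \<noteq> 1" "y \<noteq> 1" "x * y \<noteq> 1" for d1 x y
    using that
  proof (induction d1 arbitrary: x y)
    case 0
    thus ?case using cayley_addition[of x y] by (simp add: rhs_def kern_0)
  next
    case (Suc d1)
    show ?case by (rule step) (use Suc in auto)
  qed
  have "kern d1 x * kern d2 y = rhs d1 d2 x y"
    if "x \<noteq> 0" "y \<noteq> 0" "x \<noteq> 1" "y \<noteq> 1" "x * y \<noteq> 1" for x y
    using that
  proof (induction d2 arbitrary: x y)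
    case 0
    thus ?case by (intro base)
  next
    case (Suc d2)
    have "kern (Suc d2) y * kern d1 x = rhs (Suc d2) d1 y x"
    proof (rule step)
      fix x y :: complex
      assume "x \<noteq> 0" "y \<noteq> 0" "x \<noteq> 1" "y \<noteq> 1" "x * y \<noteq> 1"
      thus "kern d2 x * kern d1 y = rhs d2 d1 x y"
        using Suc.IH[of y x] by (simp add: swap[of d2 d1 x y] mult.commute)
    qed (use Suc.prems in \<open>auto simp: mult.commute\<close>)
    thus ?case by (simp add: swap[of d1 "Suc d2"] mult.commute)
  qed
  thus ?thesis using assms by (simp add: rhs_def)
qed

section \<open>Kernels of positive order as a basis of the multiples of psi^2 - 1/4\<close>

lemma degree_kernel_poly: "degree (kernel_poly d) = Suc d"
  and lead_coeff_kernel_poly: "lead_coeff (kernel_poly d) = fact d"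
proof -
  have "degree (kernel_poly d) = Suc d \<and> lead_coeff (kernel_poly d) = fact d"
  proof (induction d)
    case (Suc d)
    have deg: "degree (pderiv (kernel_poly d)) = d"
      using Suc by (simp add: degree_pderiv)
    have lc: "lead_coeff (pderiv (kernel_poly d)) = of_nat (Suc d) * fact d"
      unfolding deg coeff_pderiv using conjunct2[OF Suc.IH] unfolding conjunct1[OF Suc.IH] by simp
    have "of_nat (Suc d) * fact d \<noteq> (0 :: complex)"
      by (simp only: mult_eq_0_iff of_nat_eq_0_iff fact_nonzero) simp
    hence "lead_coeff (pderiv (kernel_poly d)) \<noteq> 0" unfolding lc .
    hence "pderiv (kernel_poly d) \<noteq> 0" unfolding leading_coeff_0_iff .
    moreover have "[:- 1 / 4, 0, 1 :: complex:] \<noteq> 0" by simp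
    ultimately have "degree (kernel_poly (Suc d)) =
        degree [:- 1 / 4, 0, 1 :: complex:] + degree (pderiv (kernel_poly d))"
      unfolding kernel_poly.simps by (intro degree_mult_eq)
    hence "degree (kernel_poly (Suc d)) = Suc (Suc d)" unfolding deg by simp
    moreover have "lead_coeff (kernel_poly (Suc d)) = fact (Suc d)"
      unfolding kernel_poly.simps lead_coeff_mult lc by simp
    ultimately show ?case by blast
  qed simp
  thus "degree (kernel_poly d) = Suc d" "lead_coeff (kernel_poly d) = fact d" by auto
qed

lemma kernel_poly_dvd: "d \<ge> 1 \<Longrightarrow> [:- 1 / 4, 0, 1:] dvd kernel_poly d"
  by (cases d) (simp_all only: kernel_poly.simps dvd_triv_left)

text \<open>There is one kernel polynomial of positive order in each degree from 2 on, so leading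
  terms can be peeled off while divisibility persists. Divisibility is what keeps constants and the
  non-decaying kernel of order 0 out of the expansion.\<close>

lemma kernel_poly_span:
  assumes "[:- 1 / 4, 0, 1:] dvd p" "degree p \<le> Suc n"
  shows "\<exists>a. p = (\<Sum>e=1..n. smult (a e) (kernel_poly e))"
  using assms
proof (induction n arbitrary: p)
  case 0
  have "p = 0"
  proof (rule ccontr)
    assume "p \<noteq> 0"
    hence "degree [:- 1 / 4, 0, 1 :: complex:] \<le> degree p" by (rule dvd_imp_degree_le[OF 0(1)])
    thus False using 0(2) by simp
  qed
  thus ?case by simp
next
  case (Suc n)
  define b where "b = coeff p (Suc (Suc n)) / fact (Suc n)"
  define r where "r = p - smult b (kernel_poly (Suc n))"
  have "[:- 1 / 4, 0, 1:] dvd r"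
    unfolding r_def by (intro dvd_diff dvd_smult Suc.prems(1) kernel_poly_dvd) simp
  moreover have "degree r \<le> Suc n"
  proof (rule degree_le, intro allI impI)
    fix i assume i: "i > Suc n"
    show "coeff r i = 0"
    proof (cases "i = Suc (Suc n)")
      case True
      have "coeff (kernel_poly (Suc n)) (Suc (Suc n)) = fact (Suc n)"
        using lead_coeff_kernel_poly[of "Suc n"] degree_kernel_poly[of "Suc n"]
        by (simp del: kernel_poly.simps fact_Suc)
      thus ?thesis unfolding True r_def b_def coeff_diff coeff_smult by (simp del: kernel_poly.simps fact_Suc)
    next
      case False
      hence "i > degree p" "i > degree (kernel_poly (Suc n))"
        using i Suc.prems(2) degree_kernel_poly[of "Suc n"] by simp_all
      hence "coeff p i = 0" "coeff (kernel_poly (Suc n)) i = 0" by (simp_all only: coeff_eq_0)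
      thus ?thesis unfolding r_def coeff_diff coeff_smult by simp
    qed
  qed
  ultimately obtain a where a: "r = (\<Sum>e=1..n. smult (a e) (kernel_poly e))"
    using Suc.IH[of r] by auto
  have "p = r + smult b (kernel_poly (Suc n))" by (simp add: r_def)
  also have "\<dots> = (\<Sum>e=1..Suc n. smult ((a(Suc n := b)) e) (kernel_poly e))"
    unfolding a by (simp del: kernel_poly.simps)
  finally show ?case by blast
qed

text \<open>The explicit coefficient compares leading coefficients. It is kept apart because the
  elimination of the highest moment depends on its exact value; the lower coefficients never
  matter.\<close>

lemma kern_mult:
  assumes "d \<ge> 1"
  shows "\<exists>a. \<forall>x. kern d x * kern e x =
    fact d * fact e / fact (d + e + 1) * kern (d + e + 1) x + (\<Sum>i=1..d + e. a i * kern i x)"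
proof -
  define b :: complex where "b = fact d * fact e / fact (d + e + 1)"
  define p where "p = kernel_poly d * kernel_poly e - smult b (kernel_poly (d + e + 1))"
  have "[:- 1 / 4, 0, 1:] dvd p"
    unfolding p_def by (intro dvd_diff dvd_smult dvd_mult2 kernel_poly_dvd assms) simp
  moreover have "degree p \<le> Suc (d + e)"
  proof (rule degree_le, intro allI impI)
    fix i assume i: "i > Suc (d + e)"
    have nz: "kernel_poly k \<noteq> 0" for k using degree_kernel_poly[of k] by force
    have deg: "degree (kernel_poly d * kernel_poly e) = Suc d + Suc e"
      using nz by (simp add: degree_mult_eq degree_kernel_poly)
    show "coeff p i = 0"
    proof (cases "i = Suc d + Suc e")
      case True
      have "coeff (kernel_poly d * kernel_poly e) (Suc d + Suc e) = fact d * fact e"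
        using lead_coeff_mult[of "kernel_poly d" "kernel_poly e"] deg
        by (simp add: degree_kernel_poly[symmetric] lead_coeff_kernel_poly)
      moreover have "coeff (kernel_poly (d + e + 1)) (Suc d + Suc e) = fact (d + e + 1)"
        using lead_coeff_kernel_poly[of "d + e + 1"] degree_kernel_poly[of "d + e + 1"]
        by (simp del: kernel_poly.simps fact_Suc)
      ultimately show ?thesis unfolding True p_def b_def coeff_diff coeff_smult
        by (simp del: kernel_poly.simps fact_Suc)
    next
      case False
      hence "i > degree (kernel_poly d * kernel_poly e)" "i > degree (kernel_poly (d + e + 1))"
        using i deg degree_kernel_poly[of "d + e + 1"] by simp_all
      hence "coeff (kernel_poly d * kernel_poly e) i = 0" "coeff (kernel_poly (d + e + 1)) i = 0"
        by (simp_all only: coeff_eq_0)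
      thus ?thesis unfolding p_def coeff_diff coeff_smult by simp
    qed
  qed
  ultimately obtain a where a: "p = (\<Sum>i=1..d + e. smult (a i) (kernel_poly i))"
    using kernel_poly_span by blast
  have "kern d x * kern e x = b * kern (d + e + 1) x + (\<Sum>i=1..d + e. a i * kern i x)" for x
  proof -
    have "kernel_poly d * kernel_poly e = smult b (kernel_poly (d + e + 1)) + p" by (simp add: p_def)
    from arg_cong[OF this, of "\<lambda>p. poly p (cayley x)"] show ?thesis
      unfolding a kern_def by (simp add: poly_sum del: kernel_poly.simps)
  qed
  thus ?thesis unfolding b_def by blast
qed

text \<open>The power has degree 2 n in psi and is a multiple of psi^2 - 1/4, so every root factor
  becomes a combination of decaying kernels.\<close>

lemma kern_1_power:
  assumes "n \<ge> 1"
  shows "\<exists>a. \<forall>x. kern 1 x ^ n = (\<Sum>i=1..2 * n - 1. a i * kern i x)"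
proof -
  have "[:- 1 / 4, 0, 1:] dvd kernel_poly 1 ^ n"
    using kernel_poly_dvd[of 1] assms by (meson dvd_power dvd_trans le_refl zero_less_one less_le_trans)
  moreover have "degree (kernel_poly 1 ^ n) \<le> Suc (2 * n - 1)"
    using degree_power_le[of "kernel_poly 1" n] degree_kernel_poly[of 1] assms by (simp add: mult.commute)
  ultimately obtain a where a: "kernel_poly 1 ^ n = (\<Sum>i=1..2 * n - 1. smult (a i) (kernel_poly i))"
    using kernel_poly_span by blast
  have "kern 1 x ^ n = (\<Sum>i=1..2 * n - 1. a i * kern i x)" for x
    using arg_cong[OF a, of "\<lambda>p. poly p (cayley x)"]
    unfolding kern_def by (simp add: poly_sum poly_power del: kernel_poly.simps)
  thus ?thesis by blast
qed

text \<open>The case \<open>d = 0\<close> differs by the constant term \<open>1 / 2\<close> of \<open>cayley\<close>.\<close>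

lemma kern_power_series:
  assumes "norm x < 1"
  shows "(\<lambda>n. of_nat n ^ d * x ^ n) sums (kern d x + (if d = 0 then 1 / 2 else 0))"
  using assms
proof (induction d arbitrary: x)
  case 0
  hence "x \<noteq> 1" by auto
  hence "1 - x \<noteq> 0" by simp
  hence "1 / (1 - x) = kern 0 x + 1 / 2"
    by (simp add: kern_0 cayley_def divide_simps)
  thus ?case using geometric_sums[of x] 0 by simp
next
  case (Suc d)
  define c where "c = (\<lambda>n::nat. (of_nat n ^ d :: complex))"
  have sm: "summable (\<lambda>n. c n * z ^ n)" if "norm z < 1" for z
    using Suc.IH[OF that] unfolding c_def by (rule sums_summable)
  have dsm: "summable (\<lambda>n. diffs c n * x ^ n)"
    by (rule termdiff_converges[OF Suc.prems sm])
  have *: "(\<lambda>n. of_nat n * c n * x ^ (n - Suc 0)) sums (\<Sum>n. diffs c n * x ^ n)"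
    using diffs_equiv[OF dsm] .
  show ?case
  proof (cases "x = 0")
    case True
    \<comment> \<open>\<open>cayley 0 = 1 / 2\<close> is a root of psi^2 - 1/4. The point 0 is
      separate because the derivative formula divides by x.\<close>
    have "kern (Suc d) 0 = 0" unfolding kern_def kernel_poly.simps poly_mult by (simp add: cayley_def)
    moreover have "(\<lambda>n. of_nat n ^ Suc d * (0::complex) ^ n) = (\<lambda>n. 0)"
      by (auto simp: fun_eq_iff power_0_left)
    ultimately show ?thesis using True by simp
  next
    case False
    have "x \<noteq> 1" using Suc.prems by auto
    have D1: "((\<lambda>z. \<Sum>n. c n * z ^ n) has_field_derivative (\<Sum>n. diffs c n * x ^ n)) (at x)"
      by (rule termdiffs_strong'[OF sm Suc.prems])
    have D2: "((\<lambda>z. kern d z + (if d = 0 then 1 / 2 else 0)) has_field_derivative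
        (kern (Suc d) x / x + 0)) (at x)"
      by (intro DERIV_add has_field_derivative_kern DERIV_const False \<open>x \<noteq> 1\<close>)
    have eq: "(\<Sum>n. c n * z ^ n) = kern d z + (if d = 0 then 1 / 2 else 0)" if "z \<in> ball 0 1" for z
      unfolding c_def by (rule sums_unique[symmetric], rule Suc.IH) (use that in simp)
    have "x \<in> ball 0 1" using Suc.prems by simp
    from derivatives_eq_if_eq_on_open[OF open_ball this eq D1 D2]
    have "(\<Sum>n. diffs c n * x ^ n) = kern (Suc d) x / x" by simp
    with * have "(\<lambda>n. x * (of_nat n * c n * x ^ (n - Suc 0))) sums (x * (kern (Suc d) x / x))"
      by (intro sums_mult) simp
    moreover have "(\<lambda>n. x * (of_nat n * c n * x ^ (n - Suc 0))) = (\<lambda>n. of_nat n ^ Suc d * x ^ n)"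
    proof
      fix n show "x * (of_nat n * c n * x ^ (n - Suc 0)) = of_nat n ^ Suc d * x ^ n"
        by (cases n) (auto simp: c_def)
    qed
    ultimately show ?thesis using False by simp
  qed
qed

section \<open>Moments of the kernels along powers of the nome\<close>

text \<open>
  All sums below run over \<^typ>\<open>int\<close>. The argument \<open>k = 0\<close>, where the kernels have their pole, is
  given the value 0.
\<close>

definition nome_kern :: "complex \<Rightarrow> nat \<Rightarrow> int \<Rightarrow> complex" where
  "nome_kern q d k = (if k = 0 then 0 else kern d (q powi k))"

text \<open>The kernel of order 0 tends to \<open>\<plusminus> 1 / 2\<close> at \<open>\<plusminus> \<infinity>\<close>; the others decay.\<close>

definition reg_kern :: "complex \<Rightarrow> nat \<Rightarrow> int \<Rightarrow> complex" where
  "reg_kern q d k = nome_kern q d k - (if d = 0 then of_int (sgn k) / 2 else 0)"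

text \<open>For c + d odd this is twice the double series of k^c n^d q^(k n) over k, n \<ge> 1. For
  c = 0 it is thus an Eisenstein series of weight d + 1 up to constant term and scaling, and for 0 <
  c < d an iterated derivative of one.\<close>

definition moment :: "complex \<Rightarrow> nat \<Rightarrow> nat \<Rightarrow> complex" where
  "moment q c d = (\<Sum>\<^sub>\<infinity>k. of_int k ^ c * reg_kern q d k)"

lemma reg_kern_pos_order [simp]: "d \<ge> 1 \<Longrightarrow> reg_kern q d k = nome_kern q d k"
  by (simp add: reg_kern_def)

lemma nome_kern_0 [simp]: "nome_kern q d 0 = 0"
  by (simp add: nome_kern_def)

lemma reg_kern_0 [simp]: "reg_kern q d 0 = 0"
  by (simp add: reg_kern_def)

section \<open>Absolute convergence, parity and symmetry of the moments\<close>

lemma summable_on_int_of_nat_abs: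
  fixes g :: "nat \<Rightarrow> real"
  assumes "summable g" "\<And>n. g n \<ge> 0"
  shows "(\<lambda>k::int. g (nat \<bar>k\<bar>)) summable_on UNIV"
proof -
  have g: "g summable_on A" for A
    by (rule summable_on_subset_banach[of _ UNIV])
       (use assms in \<open>auto intro!: norm_summable_imp_summable_on\<close>)
  have "(\<lambda>k::int. g (nat \<bar>k\<bar>)) summable_on int ` UNIV"
    by (subst summable_on_reindex) (auto simp: o_def g inj_on_def)
  moreover have "(\<lambda>k::int. g (nat \<bar>k\<bar>)) summable_on (\<lambda>n. - int n) ` {1..}"
    by (subst summable_on_reindex) (auto simp: o_def g inj_on_def)
  moreover have "UNIV = int ` UNIV \<union> (\<lambda>n. - int n) ` {1..}"
  proof (intro equalityI subsetI)
    fix k :: int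
    have "k = int (nat k) \<or> (k = - int (nat (- k)) \<and> nat (- k) \<in> {1..})" by simp linarith
    thus "k \<in> int ` UNIV \<union> (\<lambda>n. - int n) ` {1..}" by blast
  qed auto
  moreover have "int ` UNIV \<inter> (\<lambda>n. - int n) ` {1..} = {}" by auto
  ultimately show ?thesis by (metis summable_on_Un_disjoint)
qed

lemma summable_power_times_geometric:
  assumes "0 < r" "r < (1::real)"
  shows "summable (\<lambda>n. of_nat n ^ d * r ^ n)"
proof -
  \<comment> \<open>Convergence of the power series at s gives absolute convergence at the smaller
    radius r.\<close>
  obtain s where s: "r < s" "s < 1" using dense assms by blast
  have "summable (\<lambda>n. of_nat n ^ d * complex_of_real s ^ n)"
    by (rule sums_summable[OF kern_power_series]) (use assms s in auto)
  hence "summable (\<lambda>n. norm (of_nat n ^ d * complex_of_real r ^ n))"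
    by (rule powser_insidea) (use assms s in auto)
  thus ?thesis using assms by (simp add: norm_mult norm_power)
qed

lemma summable_on_product:
  fixes f :: "'a \<Rightarrow> real" and g :: "'b \<Rightarrow> real"
  assumes "f summable_on A" "g summable_on B"
    and "\<And>x. x \<in> A \<Longrightarrow> f x \<ge> 0" "\<And>y. y \<in> B \<Longrightarrow> g y \<ge> 0"
  shows "(\<lambda>(x, y). f x * g y) summable_on A \<times> B"
proof (rule summable_on_SigmaI)
  fix x
  show "((\<lambda>y. case (x, y) of (x, y) \<Rightarrow> f x * g y) has_sum f x * infsum g B) B"
    using has_sum_cmult_right[OF has_sum_infsum[OF assms(2)]] by simp
qed (use assms summable_on_cmult_left in auto)

locale nome =
  fixes q :: complex
  assumes q_nonzero: "q \<noteq> 0" and norm_q_less: "norm q < 1"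
begin

lemma norm_q_pos: "0 < norm q"
  using q_nonzero by simp

lemma powi_neq_1:
  assumes "k \<noteq> 0"
  shows "q powi k \<noteq> 1"
proof
  assume "q powi k = 1"
  have "q ^ nat \<bar>k\<bar> = 1"
  proof (cases "k > 0")
    case True
    thus ?thesis using \<open>q powi k = 1\<close> by (simp add: power_int_def)
  next
    case False
    thus ?thesis using \<open>q powi k = 1\<close> assms by (auto simp: power_int_def power_inverse split: if_splits)
  qed
  hence "norm q ^ nat \<bar>k\<bar> = 1" by (metis norm_one norm_power)
  moreover have "norm q ^ nat \<bar>k\<bar> < 1"
    using norm_q_less assms by (intro power_Suc_less_one power_less_one_iff[THEN iffD2]) auto
  ultimately show False by simp
qed

lemma powi_neq_0: "q powi k \<noteq> 0"
  using q_nonzero by simp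

lemma nome_kern_minus: "nome_kern q d (- k) = (- 1) ^ Suc d * nome_kern q d k"
  using kern_inverse[OF powi_neq_0, of d k] by (simp add: nome_kern_def power_int_minus)

lemma reg_kern_minus: "reg_kern q d (- k) = (- 1) ^ Suc d * reg_kern q d k"
  by (cases "d = 0") (simp_all add: reg_kern_def nome_kern_minus)

lemma reg_kern_sums:
  assumes "k > 0"
  shows "(\<lambda>n. of_nat (Suc n) ^ d * q ^ (nat k * Suc n)) sums reg_kern q d k"
proof -
  have "norm (q ^ nat k) < 1"
    using norm_q_less assms by (simp add: norm_power power_less_one_iff)
  hence "(\<lambda>n. of_nat n ^ d * (q ^ nat k) ^ n) sums (kern d (q ^ nat k) + (if d = 0 then 1 / 2 else 0))"
    by (rule kern_power_series)
  hence "(\<lambda>n. of_nat (Suc n) ^ d * (q ^ nat k) ^ Suc n) sums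
      (kern d (q ^ nat k) + (if d = 0 then 1 / 2 else 0) - of_nat 0 ^ d * (q ^ nat k) ^ 0)"
    by (subst sums_Suc_iff) simp
  \<comment> \<open>Dropping the term n = 0 subtracts 1 if d = 0 and nothing otherwise, and 1/2 - 1
    = - 1/2 is exactly the regularising term for k > 0.\<close>
  also have "kern d (q ^ nat k) + (if d = 0 then 1 / 2 else 0) - of_nat 0 ^ d * (q ^ nat k) ^ 0 =
      reg_kern q d k"
    using assms by (simp add: reg_kern_def nome_kern_def power_int_def power_0_left)
  finally show ?thesis by (simp only: power_mult)
qed

lemma reg_kern_bound: "\<exists>C. \<forall>k. norm (reg_kern q d k) \<le> C * norm q ^ nat \<bar>k\<bar>"
proof -
  let ?r = "norm q"
  have sm: "summable (\<lambda>n. real (Suc n) ^ d * ?r ^ Suc n)"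
    using summable_power_times_geometric[OF norm_q_pos norm_q_less, of d]
    by (subst summable_Suc_iff)
  hence sm': "summable (\<lambda>n. real (Suc n) ^ d * ?r ^ n)"
    using summable_mult[OF sm, of "inverse ?r"] q_nonzero by (simp add: field_simps)
  define C where "C = (\<Sum>n. real (Suc n) ^ d * ?r ^ n)"
  have C: "C \<ge> 0" unfolding C_def by (rule suminf_nonneg[OF sm']) simp
  have pos: "norm (reg_kern q d k) \<le> C * ?r ^ nat k" if "k > 0" for k
  proof -
    have sums: "(\<lambda>n. of_nat (Suc n) ^ d * q ^ (nat k * Suc n)) sums reg_kern q d k"
      by (rule reg_kern_sums[OF that])
    \<comment> \<open>The bound k (n + 1) \<ge> n + k separates the decay in k from the summation
      over n.\<close>
    have le: "norm (of_nat (Suc n) ^ d * q ^ (nat k * Suc n)) \<le> real (Suc n) ^ d * ?r ^ n * ?r ^ nat k" for n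
    proof -
      have "n \<le> nat k * n" using that by (cases "nat k") auto
      hence "nat k * Suc n \<ge> n + nat k" by simp
      hence "?r ^ (nat k * Suc n) \<le> ?r ^ (n + nat k)"
        using norm_q_less by (intro power_decreasing) auto
      hence "real (Suc n) ^ d * ?r ^ (nat k * Suc n) \<le> real (Suc n) ^ d * ?r ^ (n + nat k)"
        by (rule mult_left_mono) simp
      thus ?thesis by (simp only: norm_mult norm_power norm_of_nat power_add mult.assoc)
    qed
    have "norm (\<Sum>n. of_nat (Suc n) ^ d * q ^ (nat k * Suc n)) \<le>
        (\<Sum>n. real (Suc n) ^ d * ?r ^ n * ?r ^ nat k)"
      by (rule norm_suminf_le[OF le summable_mult2[OF sm']])
    also have "\<dots> = C * ?r ^ nat k"
      unfolding C_def by (rule suminf_mult2[OF sm', symmetric])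
    finally show ?thesis using sums_unique[OF sums] by simp
  qed
  have "norm (reg_kern q d k) \<le> C * ?r ^ nat \<bar>k\<bar>" for k
  proof -
    consider "k > 0" | "k = 0" | "k < 0" by linarith
    thus ?thesis
    proof cases
      case 3
      have "norm (reg_kern q d k) = norm (reg_kern q d (- k))"
        by (simp add: reg_kern_minus norm_mult norm_power)
      thus ?thesis using pos[of "- k"] 3 by simp
    qed (use pos[of k] C in auto)
  qed
  thus ?thesis by blast
qed

lemma summable_weight:
  "(\<lambda>k::int. real (nat \<bar>k\<bar>) ^ c * norm q ^ nat \<bar>k\<bar>) summable_on UNIV"
  by (rule summable_on_int_of_nat_abs[OF summable_power_times_geometric[OF norm_q_pos norm_q_less]]) simp

lemma norm_power_times_reg_kern_bound:
  "\<exists>C. \<forall>k. norm (of_int k ^ c * reg_kern q d k) \<le> C * (real (nat \<bar>k\<bar>) ^ c * norm q ^ nat \<bar>k\<bar>)"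
proof -
  obtain C where C: "norm (reg_kern q d k) \<le> C * norm q ^ nat \<bar>k\<bar>" for k
    using reg_kern_bound by blast
  have "norm (of_int k ^ c * reg_kern q d k) \<le> C * (real (nat \<bar>k\<bar>) ^ c * norm q ^ nat \<bar>k\<bar>)" for k
  proof -
    have "norm (of_int k ^ c * reg_kern q d k) = real (nat \<bar>k\<bar>) ^ c * norm (reg_kern q d k)"
      by (simp add: norm_mult norm_power)
    also have "\<dots> \<le> real (nat \<bar>k\<bar>) ^ c * (C * norm q ^ nat \<bar>k\<bar>)"
      by (rule mult_left_mono[OF C]) simp
    finally show ?thesis by (simp add: mult_ac)
  qed
  thus ?thesis by blast
qed

lemma abs_summable_moment: "(\<lambda>k. norm (of_int k ^ c * reg_kern q d k)) summable_on UNIV"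
proof -
  obtain C where C: "\<And>k. norm (of_int k ^ c * reg_kern q d k) \<le>
      C * (real (nat \<bar>k\<bar>) ^ c * norm q ^ nat \<bar>k\<bar>)"
    using norm_power_times_reg_kern_bound by blast
  show ?thesis
    by (rule Infinite_Sum.abs_summable_on_comparison_test'[OF summable_on_cmult_right[OF summable_weight] C])
qed

lemma has_sum_moment: "((\<lambda>k. of_int k ^ c * reg_kern q d k) has_sum moment q c d) UNIV"
  unfolding moment_def by (rule has_sum_infsum[OF abs_summable_summable[OF abs_summable_moment]])

lemma bounded_moment_terms: "\<exists>B. \<forall>k. norm (of_int k ^ c * reg_kern q d k) \<le> B"
proof -
  obtain C where C: "\<And>k. norm (of_int k ^ c * reg_kern q d k) \<le>
      C * (real (nat \<bar>k\<bar>) ^ c * norm q ^ nat \<bar>k\<bar>)"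
    using norm_power_times_reg_kern_bound by blast
  have "Bseq (\<lambda>n. of_nat n ^ c * norm q ^ n)"
    using summable_LIMSEQ_zero[OF summable_power_times_geometric[OF norm_q_pos norm_q_less]]
    by (intro convergent_imp_Bseq convergentI)
  then obtain B where B: "\<And>n. norm (of_nat n ^ c * norm q ^ n) \<le> B" "B > 0"
    by (auto simp: Bseq_def)
  have "norm (of_int k ^ c * reg_kern q d k) \<le> \<bar>C\<bar> * B" for k
  proof -
    have "norm (of_int k ^ c * reg_kern q d k) \<le> C * (real (nat \<bar>k\<bar>) ^ c * norm q ^ nat \<bar>k\<bar>)"
      by (rule C)
    also have "\<dots> \<le> \<bar>C\<bar> * (real (nat \<bar>k\<bar>) ^ c * norm q ^ nat \<bar>k\<bar>)"
      by (rule mult_right_mono) auto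
    also have "\<dots> \<le> \<bar>C\<bar> * B"
    proof (rule mult_left_mono)
      show "real (nat \<bar>k\<bar>) ^ c * norm q ^ nat \<bar>k\<bar> \<le> B"
        using B(1)[of "nat \<bar>k\<bar>"] by (simp add: abs_le_iff)
    qed simp
    finally show ?thesis .
  qed
  thus ?thesis by blast
qed

text \<open>The substitution k -> - k multiplies each term by (- 1)^(c + d + 1).\<close>

lemma moment_even:
  assumes "even (c + d)"
  shows "moment q c d = 0"
proof -
  have "((\<lambda>k. of_int (- k) ^ c * reg_kern q d (- k)) has_sum moment q c d) UNIV"
    using has_sum_reindex_bij_betw[of uminus UNIV UNIV "\<lambda>k. of_int k ^ c * reg_kern q d k" "moment q c d"]
      has_sum_moment[of c d] by (simp add: bij_uminus)
  moreover have "(\<lambda>k. of_int (- k) ^ c * reg_kern q d (- k)) =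
      (\<lambda>k::int. - (of_int k ^ c * reg_kern q d k))"
  proof
    fix k :: int
    have "of_int (- k) ^ c * reg_kern q d (- k) =
        ((- 1) ^ c * (- 1) ^ Suc d) * (of_int k ^ c * reg_kern q d k)"
      by (simp add: reg_kern_minus power_minus[of "of_int k :: complex"])
    also have "(- 1) ^ c * (- 1) ^ Suc d = (- 1 :: complex)"
      using assms by (simp add: power_add[symmetric])
    finally show "of_int (- k) ^ c * reg_kern q d (- k) = - (of_int k ^ c * reg_kern q d k)" by simp
  qed
  moreover have "((\<lambda>k. - (of_int k ^ c * reg_kern q d k)) has_sum - moment q c d) UNIV"
    using has_sum_moment[of c d] by (simp add: has_sum_uminus)
  ultimately have "moment q c d = - moment q c d" by (metis has_sum_unique)
  thus ?thesis by simp
qed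

definition half_moment :: "nat \<Rightarrow> nat \<Rightarrow> complex" where
  "half_moment c d = (\<Sum>\<^sub>\<infinity>n::nat. of_nat (Suc n) ^ c * reg_kern q d (int (Suc n)))"

lemma abs_summable_half_moment:
  "(\<lambda>n::nat. norm (of_nat (Suc n) ^ c * reg_kern q d (int (Suc n)))) summable_on UNIV"
proof -
  have "(\<lambda>k. norm (of_int k ^ c * reg_kern q d k)) summable_on (\<lambda>n. int (Suc n)) ` UNIV"
    by (rule summable_on_subset_banach[OF abs_summable_moment]) simp
  hence "(\<lambda>n. norm (of_int (int (Suc n)) ^ c * reg_kern q d (int (Suc n)))) summable_on UNIV"
    by (subst (asm) summable_on_reindex) (auto simp: o_def inj_on_def)
  thus ?thesis by simp
qed

lemma moment_eq_half_moment:
  assumes "odd (c + d)"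
  shows "moment q c d = 2 * half_moment c d"
proof -
  let ?f = "\<lambda>k. of_int k ^ c * reg_kern q d k"
  let ?S = "half_moment c d"
  have hs: "((\<lambda>n::nat. of_nat (Suc n) ^ c * reg_kern q d (int (Suc n))) has_sum ?S) UNIV"
    unfolding half_moment_def
    by (rule has_sum_infsum[OF abs_summable_summable[OF abs_summable_half_moment]])
  have 1: "(?f has_sum ?S) ((\<lambda>n. int (Suc n)) ` UNIV)"
    by (subst has_sum_reindex) (use hs in \<open>auto simp: o_def inj_on_def\<close>)
  have "?f (- int (Suc n)) = of_nat (Suc n) ^ c * reg_kern q d (int (Suc n))" for n
  proof -
    have pow: "of_int (- int (Suc n)) ^ c = ((- 1) ^ c * of_nat (Suc n) ^ c :: complex)"
      unfolding of_int_minus of_int_of_nat_eq by (rule power_minus)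
    have "?f (- int (Suc n)) = ((- 1) ^ c * (- 1) ^ Suc d) *
        (of_nat (Suc n) ^ c * reg_kern q d (int (Suc n)))"
      unfolding pow reg_kern_minus by (simp only: mult_ac)
    also have "(- 1) ^ c * (- 1) ^ Suc d = (1 :: complex)"
      using assms by (simp add: power_add[symmetric])
    finally show ?thesis by simp
  qed
  hence 2: "(?f has_sum ?S) ((\<lambda>n. - int (Suc n)) ` UNIV)"
    by (subst has_sum_reindex) (use hs in \<open>auto simp: o_def inj_on_def\<close>)
  have "(?f has_sum (?S + ?S + 0)) (((\<lambda>n. int (Suc n)) ` UNIV \<union> (\<lambda>n. - int (Suc n)) ` UNIV) \<union> {0})"
    by (intro has_sum_Un_disjoint 1 2) (auto intro!: has_sum_finiteI)
  moreover have "((\<lambda>n. int (Suc n)) ` UNIV \<union> (\<lambda>n. - int (Suc n)) ` UNIV) \<union> {0} = UNIV"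
  proof (intro equalityI subsetI)
    fix k :: int
    have "k = int (Suc (nat (k - 1))) \<or> k = - int (Suc (nat (- k - 1))) \<or> k = 0" by linarith
    thus "k \<in> ((\<lambda>n. int (Suc n)) ` UNIV \<union> (\<lambda>n. - int (Suc n)) ` UNIV) \<union> {0}" by blast
  qed auto
  ultimately have "(?f has_sum (?S + ?S + 0)) UNIV" by metis
  thus ?thesis using has_sum_unique[OF has_sum_moment] by simp
qed

text \<open>Expanding the kernel gives the double series of i^c j^d q^(i j) over positive i and j,
  which is symmetric under exchanging (i, c) and (j, d).\<close>

lemma half_moment_swap: "half_moment c d = half_moment d c"
proof -
  define F :: "nat \<Rightarrow> nat \<Rightarrow> nat \<Rightarrow> nat \<Rightarrow> complex" where
    "F = (\<lambda>c d i j. of_nat (Suc i) ^ c * (of_nat (Suc j) ^ d * q ^ (Suc i * Suc j)))"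
  let ?r = "norm q"
  have weight: "(\<lambda>n. real (Suc n) ^ c * ?r ^ n) summable_on UNIV" for c
  proof -
    have "summable (\<lambda>n. real (Suc n) ^ c * ?r ^ Suc n)"
      using summable_power_times_geometric[OF norm_q_pos norm_q_less, of c] by (subst summable_Suc_iff)
    from summable_mult[OF this, of "inverse ?r"]
    have "summable (\<lambda>n. norm (real (Suc n) ^ c * ?r ^ n))"
      using q_nonzero by (simp add: field_simps)
    thus ?thesis by (rule norm_summable_imp_summable_on)
  qed
  have sm: "(\<lambda>(i, j). F c d i j) summable_on UNIV \<times> UNIV" for c d
  proof (rule abs_summable_summable, rule Infinite_Sum.abs_summable_on_comparison_test')
    show "(\<lambda>(i, j). (real (Suc i) ^ c * ?r ^ i) * (real (Suc j) ^ d * ?r ^ j)) summable_on UNIV \<times> UNIV"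
      by (rule summable_on_product) (use weight in auto)
    fix x :: "nat \<times> nat"
    obtain i j where x: "x = (i, j)" by (cases x)
    \<comment> \<open>Since (i + 1) (j + 1) \<ge> i + j, a product of two single series
      dominates.\<close>
    have "?r ^ (Suc i * Suc j) \<le> ?r ^ (i + j)"
      using norm_q_less by (intro power_decreasing) auto
    hence "real (Suc i) ^ c * (real (Suc j) ^ d * ?r ^ (Suc i * Suc j)) \<le>
        real (Suc i) ^ c * (real (Suc j) ^ d * ?r ^ (i + j))"
      by (intro mult_left_mono) auto
    thus "norm (case x of (i, j) \<Rightarrow> F c d i j) \<le>
        (case x of (i, j) \<Rightarrow> (real (Suc i) ^ c * ?r ^ i) * (real (Suc j) ^ d * ?r ^ j))"
      unfolding x F_def prod.case norm_mult norm_power norm_of_nat power_add by (simp add: mult_ac)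
  qed
  have half: "half_moment c d = (\<Sum>\<^sub>\<infinity>i. \<Sum>\<^sub>\<infinity>j. F c d i j)" for c d
    unfolding half_moment_def
  proof (rule infsum_cong)
    fix i :: nat
    have "(\<lambda>j. F c d i j) summable_on UNIV"
      using summable_on_SigmaD1[OF sm[of c d]] by simp
    hence "(\<lambda>j. F c d i j) sums (\<Sum>\<^sub>\<infinity>j. F c d i j)"
      by (intro has_sum_imp_sums has_sum_infsum)
    moreover have "(\<lambda>j. F c d i j) sums (of_nat (Suc i) ^ c * reg_kern q d (int (Suc i)))"
      unfolding F_def using reg_kern_sums[of "int (Suc i)" d] unfolding nat_int by (intro sums_mult) simp
    ultimately show "of_nat (Suc i) ^ c * reg_kern q d (int (Suc i)) = (\<Sum>\<^sub>\<infinity>j. F c d i j)"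
      by (metis sums_unique2)
  qed
  have "half_moment c d = (\<Sum>\<^sub>\<infinity>j. \<Sum>\<^sub>\<infinity>i. F c d i j)"
    unfolding half by (rule infsum_swap_banach[OF sm])
  also have "\<dots> = half_moment d c"
  proof -
    have "F c d i j = F d c j i" for i j
      by (simp only: F_def mult.commute[of "Suc i"] mult.left_commute)
    thus ?thesis by (simp only: half)
  qed
  finally show ?thesis .
qed

lemma moment_swap: "moment q c d = moment q d c"
proof (cases "even (c + d)")
  case True
  thus ?thesis by (simp add: moment_even add.commute)
next
  case False
  thus ?thesis
    using half_moment_swap[of c d] by (simp add: moment_eq_half_moment add.commute)
qed

end

section \<open>Sums over the diagonals \<open>k + l = m\<close>\<close>

lemma has_sum_finite_sum:
  fixes f :: "'a \<Rightarrow> 'b \<Rightarrow> 'c::topological_comm_monoid_add"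
  assumes "finite I" "\<And>i. i \<in> I \<Longrightarrow> (f i has_sum S i) A"
  shows "((\<lambda>x. \<Sum>i\<in>I. f i x) has_sum (\<Sum>i\<in>I. S i)) A"
  using assms by (induction I rule: finite_induct) (auto intro!: has_sum_add)

text \<open>Faulhaber's formula in difference form. The leading term stays explicit because its
  coefficient 1 / (c + 1) will be divided out; of the rest only the degree bound is used.\<close>

lemma power_sum_polynomial:
  "\<exists>p :: complex poly. degree p \<le> c \<and>
     (\<forall>x. ((x + 1) ^ Suc c - x ^ Suc c) / of_nat (Suc c) + (poly p (x + 1) - poly p x) = x ^ c)"
proof (induction c rule: less_induct)
  case (less c)
  have "\<forall>s\<in>{..<c}. \<exists>p :: complex poly. degree p \<le> Suc s \<and>
      (\<forall>x. poly p (x + 1) - poly p x = x ^ s)"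
  proof
    fix s assume "s \<in> {..<c}"
    then obtain p :: "complex poly" where p: "degree p \<le> s"
      "\<And>x. ((x + 1) ^ Suc s - x ^ Suc s) / of_nat (Suc s) + (poly p (x + 1) - poly p x) = x ^ s"
      using less.IH by blast
    let ?r = "monom (1 / of_nat (Suc s)) (Suc s) + p"
    have "degree ?r \<le> Suc s"
      using p(1) by (intro degree_add_le degree_monom_le) simp
    moreover have "poly ?r (x + 1) - poly ?r x = x ^ s" for x
      using p(2)[of x] by (simp add: poly_monom diff_divide_distrib algebra_simps del: power_Suc of_nat_Suc)
    ultimately show "\<exists>p :: complex poly. degree p \<le> Suc s \<and> (\<forall>x. poly p (x + 1) - poly p x = x ^ s)"
      by blast
  qed
  then obtain r :: "nat \<Rightarrow> complex poly" where r: "\<And>s. s < c \<Longrightarrow> degree (r s) \<le> Suc s"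
    "\<And>s x. s < c \<Longrightarrow> poly (r s) (x + 1) - poly (r s) x = x ^ s"
    unfolding bchoice_iff by (metis lessThan_iff)
  \<comment> \<open>The lower terms of ((x + 1)^(c+1) - x^(c+1)) / (c + 1) are monomials of degree s
    < c; each is cancelled by a polynomial with that difference.\<close>
  define p where "p = - (\<Sum>s<c. smult (of_nat (Suc c choose s) / of_nat (Suc c)) (r s))"
  have "degree p \<le> c"
    unfolding p_def degree_minus
    by (rule degree_sum_le) (auto intro!: order.trans[OF degree_smult_le] order.trans[OF r(1)])
  moreover have "((x + 1) ^ Suc c - x ^ Suc c) / of_nat (Suc c) + (poly p (x + 1) - poly p x) = x ^ c" for x
  proof -
    have "poly p (x + 1) - poly p x =
        - (\<Sum>s<c. of_nat (Suc c choose s) / of_nat (Suc c) * (poly (r s) (x + 1) - poly (r s) x))"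
      by (simp add: p_def poly_sum sum_subtractf right_diff_distrib)
    also have "\<dots> = - (\<Sum>s<c. of_nat (Suc c choose s) * x ^ s) / of_nat (Suc c)"
      by (simp add: r(2) sum_divide_distrib)
    finally have 1: "poly p (x + 1) - poly p x = - (\<Sum>s<c. of_nat (Suc c choose s) * x ^ s) / of_nat (Suc c)" .
    have "(x + 1) ^ Suc c = (\<Sum>s\<le>Suc c. of_nat (Suc c choose s) * x ^ s)"
      by (subst binomial_ring) simp
    also have "\<dots> = (\<Sum>s<c. of_nat (Suc c choose s) * x ^ s) + of_nat (Suc c) * x ^ c + x ^ Suc c"
      by (simp add: lessThan_Suc_atMost[symmetric] del: binomial_Suc_Suc power_Suc of_nat_Suc)
    finally have 2: "(x + 1) ^ Suc c - x ^ Suc c =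
        (\<Sum>s<c. of_nat (Suc c choose s) * x ^ s) + of_nat (Suc c) * x ^ c" by simp
    have "of_nat (Suc c) \<noteq> (0 :: complex)" by (simp only: of_nat_eq_0_iff)
    thus ?thesis unfolding 1 2 by (simp add: field_simps del: of_nat_Suc binomial_Suc_Suc)
  qed
  ultimately show ?case by blast
qed

text \<open>For \<open>m > 0\<close> the sum below runs over \<open>0 \<le> k \<le> m\<close>, with both end points counted by one half.\<close>

lemma has_sum_signed_powers:
  "\<exists>p :: complex poly. degree p \<le> c \<and> (c = 0 \<longrightarrow> p = 0) \<and>
     (\<forall>m::int. ((\<lambda>k::int. of_int k ^ c * (of_int (sgn k + sgn (m - k)) / 2)) has_sum
        (of_int m ^ Suc c / of_nat (Suc c) + poly p (of_int m))) UNIV)"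
proof -
  obtain p0 :: "complex poly" where p0: "degree p0 \<le> c"
    "\<And>x. ((x + 1) ^ Suc c - x ^ Suc c) / of_nat (Suc c) + (poly p0 (x + 1) - poly p0 x) = x ^ c"
    using power_sum_polynomial by blast
  \<comment> \<open>The monomial shifts half of the weight from one end point to the other, so that
    the difference becomes the mean of m^c and (m + 1)^c; the constant normalises the value at 0 to
    0.\<close>
  define p where "p = p0 + monom (1 / 2) c - [:poly (p0 + monom (1 / 2) c) 0:]"
  define G where "G = (\<lambda>m::int. of_int m ^ Suc c / of_nat (Suc c) + poly p (of_int m))"
  define f where "f = (\<lambda>m k::int. (of_int k ^ c * (of_int (sgn k + sgn (m - k)) / 2)) :: complex)"
  have G0: "G 0 = 0" by (simp add: G_def p_def)
  have G_Suc: "G (m + 1) = G m + (of_int m ^ c + of_int (m + 1) ^ c) / 2" for m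
    using p0(2)[of "of_int m"]
    by (simp add: G_def p_def poly_monom add_divide_distrib diff_divide_distrib algebra_simps
        del: power_Suc of_nat_Suc)
  \<comment> \<open>Passing from m to m + 1 changes sgn (m - k) only at k = m and k = m + 1, by 1
    each.\<close>
  have f_Suc: "((\<lambda>k. f (m + 1) k - f m k) has_sum (of_int m ^ c + of_int (m + 1) ^ c) / 2) UNIV" for m
  proof (rule has_sum_finite_neutralI[of "{m, m + 1}"])
    fix k assume "k \<in> UNIV - {m, m + 1}"
    hence "sgn (m + 1 - k) = sgn (m - k)" by (auto simp: sgn_if)
    thus "f (m + 1) k - f m k = 0" by (simp add: f_def)
  qed (auto simp: f_def field_simps sgn_if)
  have "(f m has_sum G m) UNIV" for m
  proof (induction m rule: int_induct[where k = 0])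
    case base
    have "f 0 = (\<lambda>_. 0)" by (simp add: f_def fun_eq_iff sgn_minus)
    thus ?case using G0 by simp
  next
    case (step1 m)
    thus ?case using has_sum_add[OF step1(2) f_Suc[of m]] by (simp add: G_Suc)
  next
    case (step2 m)
    have "((\<lambda>k. f m k + - (f (m - 1 + 1) k - f (m - 1) k)) has_sum
        (G m + - ((of_int (m - 1) ^ c + of_int (m - 1 + 1) ^ c) / 2))) UNIV"
      by (rule has_sum_add[OF step2(2) has_sum_uminusI[OF f_Suc]])
    thus ?case using G_Suc[of "m - 1"] by simp
  qed
  moreover have deg: "degree p \<le> c"
    unfolding p_def by (intro degree_diff_le degree_add_le p0(1) degree_monom_le) auto
  moreover have "p = 0" if "c = 0"
  proof -
    from deg that obtain a where "p = [:a:]" by (metis degree_eq_zeroE le_zero_eq)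
    thus ?thesis using G0 that by (simp add: G_def)
  qed
  ultimately show ?thesis unfolding f_def G_def by blast
qed

definition power_sum_poly :: "nat \<Rightarrow> complex poly" where
  "power_sum_poly c = (SOME p. degree p \<le> c \<and> (c = 0 \<longrightarrow> p = 0) \<and>
     (\<forall>m::int. ((\<lambda>k::int. of_int k ^ c * (of_int (sgn k + sgn (m - k)) / 2)) has_sum
        (of_int m ^ Suc c / of_nat (Suc c) + poly p (of_int m))) UNIV))"

lemma power_sum_poly:
  "degree (power_sum_poly c) \<le> c" "power_sum_poly 0 = 0"
  "((\<lambda>k::int. of_int k ^ c * (of_int (sgn k + sgn (m - k)) / 2)) has_sum
     (of_int m ^ Suc c / of_nat (Suc c) + poly (power_sum_poly c) (of_int m))) UNIV"
  using someI_ex[OF has_sum_signed_powers[of c]] someI_ex[OF has_sum_signed_powers[of 0]]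
  unfolding power_sum_poly_def[symmetric] by blast+

section \<open>Evaluation of the sum along one diagonal\<close>

definition conv_sum :: "complex \<Rightarrow> nat \<Rightarrow> nat \<Rightarrow> nat \<Rightarrow> int \<Rightarrow> complex" where
  "conv_sum q c d1 d2 m = (\<Sum>\<^sub>\<infinity>k. of_int k ^ c * nome_kern q d1 k * nome_kern q d2 (m - k))"

text \<open>Fubini in the coordinates (k + l, k). The bounded factor h is 1 for a product of two
  moments and the kernel of the third root for the triple sums.\<close>

lemma infsum_diagonals:
  fixes f g h :: "int \<Rightarrow> complex"
  assumes f: "(\<lambda>k. norm (f k)) summable_on UNIV" and g: "(\<lambda>k. norm (g k)) summable_on UNIV"
    and h: "\<And>m. norm (h m) \<le> B"
  shows "(\<lambda>(k, l). norm (f k * g l * h (k + l))) summable_on UNIV"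
    and "((\<lambda>m. h m * (\<Sum>\<^sub>\<infinity>k. f k * g (m - k))) has_sum (\<Sum>\<^sub>\<infinity>(k, l). f k * g l * h (k + l))) UNIV"
proof -
  have B: "B \<ge> 0" using norm_ge_zero h[of 0] by (rule order.trans)
  have "(\<lambda>(k, l). norm (f k) * norm (g l)) summable_on UNIV \<times> UNIV"
    by (rule summable_on_product[OF f g]) auto
  hence "(\<lambda>x. (case x of (k, l) \<Rightarrow> norm (f k) * norm (g l)) * B) summable_on UNIV \<times> UNIV"
    by (rule summable_on_cmult_left)
  hence "(\<lambda>x. norm (case x of (k, l) \<Rightarrow> f k * g l * h (k + l))) summable_on UNIV \<times> UNIV"
    by (rule Infinite_Sum.abs_summable_on_comparison_test')
       (use h in \<open>auto simp: norm_mult intro!: mult_left_mono\<close>)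
  hence abs: "(\<lambda>x. norm (case x of (k, l) \<Rightarrow> f k * g l * h (k + l))) summable_on UNIV" by simp
  have eq: "(\<lambda>(k, l). norm (f k * g l * h (k + l))) =
      (\<lambda>x. norm (case x of (k, l) \<Rightarrow> f k * g l * h (k + l)))" by auto
  show "(\<lambda>(k, l). norm (f k * g l * h (k + l))) summable_on UNIV"
    unfolding eq by (rule abs)
  let ?S = "\<Sum>\<^sub>\<infinity>(k, l). f k * g l * h (k + l)"
  have hs: "((\<lambda>(k, l). f k * g l * h (k + l)) has_sum ?S) UNIV"
    by (rule has_sum_infsum[OF abs_summable_summable[OF abs]])
  have bij: "bij_betw (\<lambda>(m, k). (k, m - k)) (UNIV :: (int \<times> int) set) UNIV"
    by (rule bij_betwI[where g = "\<lambda>(k, l). (k + l, k)"]) auto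
  have hs': "((\<lambda>(m, k). f k * g (m - k) * h m) has_sum ?S) (UNIV \<times> UNIV)"
    using iffD2[OF has_sum_reindex_bij_betw[OF bij] hs] by (simp add: case_prod_unfold)
  hence "(\<lambda>(m, k). f k * g (m - k) * h m) summable_on UNIV \<times> UNIV"
    by (rule has_sum_imp_summable)
  hence row: "(\<lambda>k. f k * g (m - k) * h m) summable_on UNIV" for m
    using summable_on_SigmaD1[of "\<lambda>m k. f k * g (m - k) * h m" UNIV "\<lambda>_. UNIV" m] by simp
  have "((\<lambda>m. \<Sum>\<^sub>\<infinity>k. f k * g (m - k) * h m) has_sum ?S) UNIV"
    by (rule has_sum_Sigma'[OF hs']) (use has_sum_infsum[OF row] in simp)
  moreover have "(\<Sum>\<^sub>\<infinity>k. f k * g (m - k) * h m) = h m * (\<Sum>\<^sub>\<infinity>k. f k * g (m - k))" for m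
    by (simp add: infsum_cmult_left' mult.commute[of "h m"])
  ultimately show "((\<lambda>m. h m * (\<Sum>\<^sub>\<infinity>k. f k * g (m - k))) has_sum ?S) UNIV" by simp
qed

context nome
begin

text \<open>Positive orders remove the constant 1/4. Each of the two sums contains one kernel of
  order 0; its limiting sign is split off, and both signs carry the same coefficient, the kernel of
  order \<open>d1 + d2\<close> at m.\<close>

lemma nome_kern_addition:
  assumes "k \<noteq> 0" "k \<noteq> m" "m \<noteq> 0" "d1 \<ge> 1" "d2 \<ge> 1"
  shows "nome_kern q d1 k * nome_kern q d2 (m - k) =
    (\<Sum>i\<le>d1. of_nat (d1 choose i) * nome_kern q (d2 + i) m * reg_kern q (d1 - i) k) +
    (\<Sum>j\<le>d2. of_nat (d2 choose j) * nome_kern q (d1 + j) m * reg_kern q (d2 - j) (m - k)) +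
    nome_kern q (d1 + d2) m * (of_int (sgn k + sgn (m - k)) / 2)"
proof -
  \<comment> \<open>Only the last index i = d meets the order 0, where the regularised kernel
    differs from the kernel.\<close>
  have *: "(\<Sum>i\<le>d. of_nat (d choose i) * (nome_kern q (e + i) m * nome_kern q (d - i) l)) =
      (\<Sum>i\<le>d. of_nat (d choose i) * nome_kern q (e + i) m * reg_kern q (d - i) l) +
      nome_kern q (e + d) m * (of_int (sgn l) / 2)" for d e l
    by (cases d) (simp_all add: atMost_Suc reg_kern_def algebra_simps)
  have "q powi k * q powi (m - k) = q powi m"
    using q_nonzero by (simp add: power_int_add[symmetric])
  hence "nome_kern q d1 k * nome_kern q d2 (m - k) =
    (\<Sum>i\<le>d1. of_nat (d1 choose i) * (nome_kern q (d2 + i) m * nome_kern q (d1 - i) k)) +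
    (\<Sum>j\<le>d2. of_nat (d2 choose j) * (nome_kern q (d1 + j) m * nome_kern q (d2 - j) (m - k)))"
    using kern_addition[of "q powi k" "q powi (m - k)" d1 d2] assms
      powi_neq_1[of k] powi_neq_1[of "m - k"] powi_neq_1[of m] q_nonzero
    by (simp add: nome_kern_def)
  thus ?thesis unfolding * by (simp add: algebra_simps add_divide_distrib)
qed

text \<open>Substituting k -> m - k moves the shift into the power, and the binomial theorem expands
  that power in moments.\<close>

lemma has_sum_moment_reflected:
  "((\<lambda>k. of_int k ^ c * reg_kern q d (m - k)) has_sum
     (\<Sum>l\<le>c. of_nat (c choose l) * (- 1) ^ l * of_int m ^ (c - l) * moment q l d)) UNIV"
proof -
  have "((\<lambda>k. \<Sum>l\<le>c. of_nat (c choose l) * (- 1) ^ l * of_int m ^ (c - l) *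
      (of_int k ^ l * reg_kern q d k)) has_sum
     (\<Sum>l\<le>c. of_nat (c choose l) * (- 1) ^ l * of_int m ^ (c - l) * moment q l d)) UNIV"
    by (intro has_sum_finite_sum finite_atMost has_sum_cmult_right has_sum_moment)
  moreover have "(\<Sum>l\<le>c. of_nat (c choose l) * (- 1) ^ l * of_int m ^ (c - l) *
      (of_int k ^ l * reg_kern q d k)) = of_int (m - k) ^ c * reg_kern q d k" for k
  proof -
    have "of_int (m - k) ^ c = (\<Sum>l\<le>c. of_nat (c choose l) * (- of_int k) ^ l * of_int m ^ (c - l) :: complex)"
      using binomial_ring[of "- of_int k :: complex" "of_int m" c] by simp
    also have "\<dots> = (\<Sum>l\<le>c. of_nat (c choose l) * (- 1) ^ l * of_int m ^ (c - l) * of_int k ^ l)"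
    proof (rule sum.cong[OF HOL.refl])
      fix l
      have "(- of_int k) ^ l = (- 1) ^ l * (of_int k ^ l :: complex)" by (rule power_minus)
      thus "of_nat (c choose l) * (- of_int k) ^ l * of_int m ^ (c - l) =
          (of_nat (c choose l) * (- 1) ^ l * of_int m ^ (c - l) * of_int k ^ l :: complex)"
        by (simp only: mult_ac)
    qed
    finally show ?thesis by (simp add: sum_distrib_right mult.assoc)
  qed
  ultimately have "((\<lambda>k. of_int (m - k) ^ c * reg_kern q d k) has_sum
     (\<Sum>l\<le>c. of_nat (c choose l) * (- 1) ^ l * of_int m ^ (c - l) * moment q l d)) UNIV"
    by simp
  moreover have "bij_betw (\<lambda>k. m - k) UNIV UNIV"
    by (rule bij_betwI[where g = "\<lambda>k. m - k"]) auto
  ultimately show ?thesis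
    using has_sum_reindex_bij_betw[of "\<lambda>k. m - k" UNIV UNIV "\<lambda>k. of_int k ^ c * reg_kern q d (m - k)"]
    by simp
qed

text \<open>The right side of the addition formula, summed over all k, gives moments and a power
  sum. The formula fails at k = 0 and k = m, where the left side is 0 by convention, so the right
  side's values there are subtracted: products of two kernels at m, with weight
  \<open>of_int m ^ c\<close> from k = m and \<open>0 ^ c\<close> from k = 0.\<close>

lemma conv_sum_eq:
  assumes m: "m \<noteq> 0" and d: "d1 \<ge> 1" "d2 \<ge> 1"
  shows "conv_sum q c d1 d2 m =
    (\<Sum>i\<le>d1. of_nat (d1 choose i) * nome_kern q (d2 + i) m *
       (moment q c (d1 - i) - of_int m ^ c * nome_kern q (d1 - i) m)) +
    (\<Sum>j\<le>d2. of_nat (d2 choose j) * nome_kern q (d1 + j) m *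
       ((\<Sum>l\<le>c. of_nat (c choose l) * (- 1) ^ l * of_int m ^ (c - l) * moment q l (d2 - j)) -
        0 ^ c * nome_kern q (d2 - j) m)) +
    nome_kern q (d1 + d2) m * (of_int m ^ Suc c / of_nat (Suc c) + poly (power_sum_poly c) (of_int m))"
proof -
  define E1 where "E1 = (\<lambda>k. \<Sum>i\<le>d1. of_nat (d1 choose i) * nome_kern q (d2 + i) m * reg_kern q (d1 - i) k)"
  define E2 where "E2 = (\<lambda>k. \<Sum>j\<le>d2. of_nat (d2 choose j) * nome_kern q (d1 + j) m * reg_kern q (d2 - j) (m - k))"
  define E3 where "E3 = (\<lambda>k. nome_kern q (d1 + d2) m * (of_int (sgn k + sgn (m - k)) / 2) :: complex)"
  define S1 where "S1 = (\<Sum>i\<le>d1. of_nat (d1 choose i) * nome_kern q (d2 + i) m * moment q c (d1 - i))"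
  define S2 where "S2 = (\<Sum>j\<le>d2. of_nat (d2 choose j) * nome_kern q (d1 + j) m *
       (\<Sum>l\<le>c. of_nat (c choose l) * (- 1) ^ l * of_int m ^ (c - l) * moment q l (d2 - j)))"
  define S3 where "S3 = nome_kern q (d1 + d2) m *
       (of_int m ^ Suc c / of_nat (Suc c) + poly (power_sum_poly c) (of_int m))"
  have "((\<lambda>k. \<Sum>i\<le>d1. of_nat (d1 choose i) * nome_kern q (d2 + i) m * (of_int k ^ c * reg_kern q (d1 - i) k))
      has_sum S1) UNIV"
    unfolding S1_def by (intro has_sum_finite_sum finite_atMost has_sum_cmult_right has_sum_moment)
  hence 1: "((\<lambda>k. of_int k ^ c * E1 k) has_sum S1) UNIV"
    by (simp add: E1_def sum_distrib_left mult_ac)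
  have "((\<lambda>k. \<Sum>j\<le>d2. of_nat (d2 choose j) * nome_kern q (d1 + j) m * (of_int k ^ c * reg_kern q (d2 - j) (m - k)))
      has_sum S2) UNIV"
    unfolding S2_def by (intro has_sum_finite_sum finite_atMost has_sum_cmult_right has_sum_moment_reflected)
  hence 2: "((\<lambda>k. of_int k ^ c * E2 k) has_sum S2) UNIV"
    by (simp add: E2_def sum_distrib_left mult_ac)
  have "((\<lambda>k. nome_kern q (d1 + d2) m * (of_int k ^ c * (of_int (sgn k + sgn (m - k)) / 2))) has_sum S3) UNIV"
    unfolding S3_def by (intro has_sum_cmult_right power_sum_poly(3))
  hence 3: "((\<lambda>k. of_int k ^ c * E3 k) has_sum S3) UNIV"
    by (simp add: E3_def mult_ac)
  define E where "E = (\<lambda>k. of_int k ^ c * (E1 k + E2 k + E3 k))"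
  have "(E has_sum (S1 + S2 + S3)) UNIV"
    using has_sum_add[OF has_sum_add[OF 1 2] 3] by (simp add: E_def distrib_left)
  moreover have "(E has_sum (\<Sum>k\<in>{0, m}. E k)) {0, m}"
    by (rule has_sum_finite) simp
  ultimately have "(E has_sum (S1 + S2 + S3 - (\<Sum>k\<in>{0, m}. E k))) (UNIV - {0, m})"
    by (rule has_sum_Diff) simp
  hence "(E has_sum (S1 + S2 + S3 - (E 0 + E m))) (UNIV - {0, m})"
    using m by simp
  moreover have "((\<lambda>k. of_int k ^ c * nome_kern q d1 k * nome_kern q d2 (m - k)) has_sum S) UNIV \<longleftrightarrow>
      (E has_sum S) (UNIV - {0, m})" for S
  proof (rule has_sum_cong_neutral)
    fix k assume "k \<in> UNIV \<inter> (UNIV - {0, m})"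
    hence "nome_kern q d1 k * nome_kern q d2 (m - k) = E1 k + E2 k + E3 k"
      unfolding E1_def E2_def E3_def using nome_kern_addition[of k m d1 d2] m d by auto
    thus "of_int k ^ c * nome_kern q d1 k * nome_kern q d2 (m - k) = E k"
      by (simp add: E_def mult.assoc)
  qed auto
  ultimately have "conv_sum q c d1 d2 m = S1 + S2 + S3 - (E 0 + E m)"
    unfolding conv_sum_def by (intro infsumI) blast
  \<comment> \<open>At an exceptional point one of the two signs is 0, and the other recombines with
    the regularised kernel into the full one.\<close>
  moreover have diag: "(\<Sum>i\<le>d. of_nat (d choose i) * nome_kern q (e + i) m * reg_kern q (d - i) m) +
      nome_kern q (e + d) m * (of_int (sgn m) / 2) =
      (\<Sum>i\<le>d. of_nat (d choose i) * nome_kern q (e + i) m * nome_kern q (d - i) m)" for d e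
    by (cases d) (simp_all add: atMost_Suc reg_kern_def algebra_simps)
  have "E 0 = 0 ^ c * (\<Sum>j\<le>d2. of_nat (d2 choose j) * nome_kern q (d1 + j) m * nome_kern q (d2 - j) m)"
    unfolding diag[symmetric] by (simp add: E_def E1_def E2_def E3_def)
  moreover have "E m = of_int m ^ c * (\<Sum>i\<le>d1. of_nat (d1 choose i) * nome_kern q (d2 + i) m * nome_kern q (d1 - i) m)"
    unfolding diag[symmetric] by (simp add: E_def E1_def E2_def E3_def add.commute)
  ultimately show ?thesis
    unfolding S1_def S2_def S3_def
    by (simp add: right_diff_distrib sum_subtractf sum_distrib_left mult_ac del: power_Suc of_nat_Suc)
qed

end

section \<open>Quasi-modularity of sums of kernels\<close>

lemma QM_cmult: "f \<in> QM \<Longrightarrow> (\<lambda>\<tau>. c * f \<tau>) \<in> QM"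
  by (rule QM.mult[OF QM.const])

lemma QM_diff: "f \<in> QM \<Longrightarrow> g \<in> QM \<Longrightarrow> (\<lambda>\<tau>. f \<tau> - g \<tau>) \<in> QM"
  using QM.add[of f "\<lambda>\<tau>. - 1 * g \<tau>"] QM_cmult[of g "- 1"] by simp

lemma QM_sum: "(\<And>i. i \<in> A \<Longrightarrow> f i \<in> QM) \<Longrightarrow> (\<lambda>\<tau>. \<Sum>i\<in>A. f i \<tau>) \<in> QM"
  by (induction A rule: infinite_finite_induct) (auto intro: QM.const QM.add)

section \<open>The Eisenstein series of weights 2, 4 and 6 as moments\<close>

definition nome_of :: "complex \<Rightarrow> complex" where
  "nome_of \<tau> = qpow \<tau> 1"

lemma nome_nome_of: "Im \<tau> > 0 \<Longrightarrow> nome (nome_of \<tau>)"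
  by (unfold_locales) (auto simp: nome_of_def qpow_def)

lemma qpow_of_nat: "qpow \<tau> (real n) = nome_of \<tau> ^ n"
  by (simp add: nome_of_def qpow_def exp_of_nat_mult[symmetric] mult_ac)

text \<open>\<open>Eis j\<close> determines its Lambert series only if the factor in front is
  invertible; for a Bernoulli number 0 that factor would be 0 by convention.\<close>

lemma bernoulli_nonzero: "bernoulli 2 \<noteq> 0" "bernoulli 4 \<noteq> 0" "bernoulli 6 \<noteq> 0"
proof -
  define b where "b = (\<lambda>n. bernoulli n / fact n)"
  \<comment> \<open>The coefficient of X^n in (exp X - 1) B(X) = X; as a triangular system it fixes
    the values up to index 6.\<close>
  have rec: "(\<Sum>i=0..n. (1 / fact i - (if i = 0 then 1 else 0)) * b (n - i)) = (if n = 1 then 1 else 0)" for n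
    using arg_cong[OF bernoulli_gf, of "\<lambda>f. fps_nth f n"]
    by (simp add: fps_mult_nth b_def fps_X_nth)
  have f: "fact 2 = (2::real)" "fact 3 = (6::real)" "fact 4 = (24::real)" "fact 5 = (120::real)"
    "fact 6 = (720::real)" "fact 7 = (5040::real)"
    by (simp_all add: fact_numeral)
  have e: "{0..2::nat} = {0,1,2}" "{0..3::nat} = {0,1,2,3}" "{0..4::nat} = {0,1,2,3,4}"
    "{0..5::nat} = {0,1,2,3,4,5}" "{0..6::nat} = {0,1,2,3,4,5,6}" "{0..7::nat} = {0,1,2,3,4,5,6,7}"
    by auto
  have "b 0 = 1" using rec[of 1] by simp
  moreover have "b 1 + b 0 / 2 = 0" using rec[of 2] by (simp add: f e)
  moreover have "b 2 + b 1 / 2 + b 0 / 6 = 0" using rec[of 3] by (simp add: f e)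
  moreover have "b 3 + b 2 / 2 + b 1 / 6 + b 0 / 24 = 0" using rec[of 4] by (simp add: f e)
  moreover have "b 4 + b 3 / 2 + b 2 / 6 + b 1 / 24 + b 0 / 120 = 0" using rec[of 5] by (simp add: f e)
  moreover have "b 5 + b 4 / 2 + b 3 / 6 + b 2 / 24 + b 1 / 120 + b 0 / 720 = 0"
    using rec[of 6] by (simp add: f e)
  moreover have "b 6 + b 5 / 2 + b 4 / 6 + b 3 / 24 + b 2 / 120 + b 1 / 720 + b 0 / 5040 = 0"
    using rec[of 7] by (simp add: f e)
  ultimately have "b 2 \<noteq> 0" "b 4 \<noteq> 0" "b 6 \<noteq> 0" by linarith+
  thus "bernoulli 2 \<noteq> 0" "bernoulli 4 \<noteq> 0" "bernoulli 6 \<noteq> 0" by (auto simp: b_def)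
qed

lemma (in nome) half_moment_0:
  "half_moment c 0 = (\<Sum>n. of_nat (Suc n) ^ c * q ^ Suc n / (1 - q ^ Suc n))"
proof -
  have "reg_kern q 0 (int (Suc n)) = q ^ Suc n / (1 - q ^ Suc n)" for n
  proof -
    have "q powi (int (Suc n)) \<noteq> 1" by (rule powi_neq_1) simp
    hence "1 - q ^ Suc n \<noteq> 0" by (simp only: power_int_of_nat) (auto simp del: power_Suc)
    hence "cayley (q ^ Suc n) - 1 / 2 = q ^ Suc n / (1 - q ^ Suc n)"
      unfolding cayley_def by (simp add: divide_simps del: power_Suc)
    moreover have "reg_kern q 0 (int (Suc n)) = cayley (q ^ Suc n) - 1 / 2"
      unfolding reg_kern_def nome_kern_def power_int_of_nat by (simp add: kern_0 del: of_nat_Suc power_Suc)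
    ultimately show ?thesis by simp
  qed
  hence "((\<lambda>n. of_nat (Suc n) ^ c * q ^ Suc n / (1 - q ^ Suc n)) has_sum half_moment c 0) UNIV"
    using has_sum_infsum[OF abs_summable_summable[OF abs_summable_half_moment[of c 0]]]
    unfolding half_moment_def by (simp only: times_divide_eq_right)
  thus ?thesis by (rule sums_unique[OF has_sum_imp_sums])
qed

lemma moment_Eis_in_QM:
  assumes "Eis j \<in> QM" "bernoulli (2 * j) \<noteq> 0" "j \<ge> 1"
  shows "(\<lambda>\<tau>. moment (nome_of \<tau>) (2 * j - 1) 0) \<in> QM"
proof (rule QM.cong)
  define a where "a = complex_of_real (4 * real j / bernoulli (2 * j))"
  have a: "a \<noteq> 0" using assms by (simp add: a_def)
  show "(\<lambda>\<tau>. 2 / a * (1 - Eis j \<tau>)) \<in> QM"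
    by (intro QM_cmult QM_diff QM.const assms)
  fix \<tau> :: complex assume "Im \<tau> > 0"
  then interpret nome "nome_of \<tau>" by (rule nome_nome_of)
  have "1 - Eis j \<tau> = a * half_moment (2 * j - 1) 0"
    by (simp add: Eis_def half_moment_0 a_def qpow_of_nat del: of_nat_Suc power_Suc)
  moreover have "moment (nome_of \<tau>) (2 * j - 1) 0 = 2 * half_moment (2 * j - 1) 0"
    by (rule moment_eq_half_moment) (use assms in simp)
  ultimately show "moment (nome_of \<tau>) (2 * j - 1) 0 = 2 / a * (1 - Eis j \<tau>)" using a by simp
qed

lemma moment_generators_in_QM:
  "(\<lambda>\<tau>. moment (nome_of \<tau>) 1 0) \<in> QM"
  "(\<lambda>\<tau>. moment (nome_of \<tau>) 3 0) \<in> QM"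
  "(\<lambda>\<tau>. moment (nome_of \<tau>) 5 0) \<in> QM"
  using moment_Eis_in_QM[OF QM.E2] moment_Eis_in_QM[OF QM.E4] moment_Eis_in_QM[OF QM.E6]
  by (simp_all add: bernoulli_nonzero)

text \<open>The module over the quasi-modular forms generated by m^s psi_e(q^m), as functions of m.
  The index set I records which moments a summation over m will require. Agreement is asked only for
  m \<noteq> 0 because the diagonal sums have their closed form only there.\<close>

inductive_set kern_span :: "(nat \<times> nat) set \<Rightarrow> (complex \<Rightarrow> int \<Rightarrow> complex) set"
  for I where
  zero: "(\<lambda>_ _. 0) \<in> kern_span I"
| base: "f \<in> QM \<Longrightarrow> (s, e) \<in> I \<Longrightarrow>
    (\<lambda>\<tau> m. f \<tau> * of_int m ^ s * nome_kern (nome_of \<tau>) e m) \<in> kern_span I"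
| add: "F \<in> kern_span I \<Longrightarrow> G \<in> kern_span I \<Longrightarrow> (\<lambda>\<tau> m. F \<tau> m + G \<tau> m) \<in> kern_span I"
| cong: "F \<in> kern_span I \<Longrightarrow> (\<And>\<tau> m. Im \<tau> > 0 \<Longrightarrow> m \<noteq> 0 \<Longrightarrow> G \<tau> m = F \<tau> m) \<Longrightarrow> G \<in> kern_span I"

lemma kern_span_mono:
  assumes "F \<in> kern_span I" "I \<subseteq> J"
  shows "F \<in> kern_span J"
  using assms(1)
proof induction
  case (cong F G)
  show ?case by (rule kern_span.cong[OF cong.IH cong.hyps(2)])
qed (use assms(2) in \<open>auto intro: kern_span.intros(1-3)\<close>)

lemma kern_span_smult:
  assumes "F \<in> kern_span I" "f \<in> QM"
  shows "(\<lambda>\<tau> m. f \<tau> * F \<tau> m) \<in> kern_span I"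
  using assms(1)
proof induction
  case zero
  show ?case using kern_span.zero by simp
next
  case (base g s e)
  have "(\<lambda>\<tau> m. f \<tau> * g \<tau> * of_int m ^ s * nome_kern (nome_of \<tau>) e m) \<in> kern_span I"
    by (rule kern_span.base[OF QM.mult[OF assms(2) base(1)] base(2)])
  thus ?case by (simp only: mult.assoc)
next
  case (add F G)
  show ?case using kern_span.add[OF add.IH] by (simp add: distrib_left)
next
  case (cong F G)
  show ?case by (rule kern_span.cong[OF cong.IH]) (simp add: cong.hyps(2))
qed

lemma kern_span_cmult: "F \<in> kern_span I \<Longrightarrow> (\<lambda>\<tau> m. c * F \<tau> m) \<in> kern_span I"
  by (rule kern_span_smult[OF _ QM.const])

lemma kern_span_diff: "F \<in> kern_span I \<Longrightarrow> G \<in> kern_span I \<Longrightarrow> (\<lambda>\<tau> m. F \<tau> m - G \<tau> m) \<in> kern_span I"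
  using kern_span.add[of F I "\<lambda>\<tau> m. - 1 * G \<tau> m"] kern_span_cmult[of G I "- 1"] by simp

lemma kern_span_sum:
  "(\<And>i. i \<in> A \<Longrightarrow> F i \<in> kern_span I) \<Longrightarrow> (\<lambda>\<tau> m. \<Sum>i\<in>A. F i \<tau> m) \<in> kern_span I"
  by (induction A rule: infinite_finite_induct) (auto intro: kern_span.zero kern_span.add)

lemma kern_span_power_mult:
  assumes "F \<in> kern_span I" "\<And>s e. (s, e) \<in> I \<Longrightarrow> (s + n, e) \<in> J"
  shows "(\<lambda>\<tau> m. of_int m ^ n * F \<tau> m) \<in> kern_span J"
  using assms(1)
proof induction
  case zero
  show ?case using kern_span.zero by simp
next
  case (base g s e)
  have "(\<lambda>\<tau> m. g \<tau> * of_int m ^ (s + n) * nome_kern (nome_of \<tau>) e m) \<in> kern_span J"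
    by (rule kern_span.base[OF base(1) assms(2)[OF base(2)]])
  thus ?case by (simp only: power_add mult_ac)
next
  case (add F G)
  show ?case using kern_span.add[OF add.IH] by (simp add: distrib_left)
next
  case (cong F G)
  show ?case by (rule kern_span.cong[OF cong.IH]) (simp add: cong.hyps(2))
qed

lemma kern_span_kern: "(s, e) \<in> I \<Longrightarrow> (\<lambda>\<tau> m. of_int m ^ s * nome_kern (nome_of \<tau>) e m) \<in> kern_span I"
  using kern_span.base[OF QM.const[of 1], of s e I] by simp

text \<open>Modulo lower orders a product is a multiple of one kernel; that kernel is subtracted
  rather than absorbed, since its moment may still be unknown.\<close>

lemma kern_span_product:
  assumes "d \<ge> 1"
  shows "(\<lambda>\<tau> m. nome_kern (nome_of \<tau>) d m * nome_kern (nome_of \<tau>) e m -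
     fact d * fact e / fact (d + e + 1) * nome_kern (nome_of \<tau>) (d + e + 1) m)
     \<in> kern_span ({0} \<times> {1..d + e})"
proof -
  obtain a where a: "\<And>x. kern d x * kern e x =
      fact d * fact e / fact (d + e + 1) * kern (d + e + 1) x + (\<Sum>i=1..d + e. a i * kern i x)"
    using kern_mult[OF assms] by blast
  have "(\<lambda>\<tau> m. \<Sum>i=1..d + e. a i * (of_int m ^ 0 * nome_kern (nome_of \<tau>) i m))
      \<in> kern_span ({0} \<times> {1..d + e})"
    by (intro kern_span_sum kern_span_cmult kern_span_kern) simp
  thus ?thesis
    by (rule kern_span.cong) (simp add: nome_kern_def a del: fact_Suc)
qed

lemma kern_span_kern_mult:
  assumes "F \<in> kern_span I" "\<And>s e. (s, e) \<in> I \<Longrightarrow> e \<ge> 1"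
    and "\<And>s e i. (s, e) \<in> I \<Longrightarrow> 1 \<le> i \<Longrightarrow> i \<le> e + d + 1 \<Longrightarrow> (s, i) \<in> J"
  shows "(\<lambda>\<tau> m. nome_kern (nome_of \<tau>) d m * F \<tau> m) \<in> kern_span J"
  using assms(1)
proof induction
  case zero
  show ?case using kern_span.zero by simp
next
  case (base g s e)
  define c :: complex where "c = fact e * fact d / fact (e + d + 1)"
  have e: "e \<ge> 1" by (rule assms(2)[OF base(2)])
  have *: "(\<lambda>\<tau> m. nome_kern (nome_of \<tau>) e m * nome_kern (nome_of \<tau>) d m -
     c * nome_kern (nome_of \<tau>) (e + d + 1) m) \<in> kern_span ({0} \<times> {1..e + d})"
    unfolding c_def by (rule kern_span_product[OF e])
  have 1: "(\<lambda>\<tau> m. of_int m ^ s * (nome_kern (nome_of \<tau>) e m * nome_kern (nome_of \<tau>) d m -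
     c * nome_kern (nome_of \<tau>) (e + d + 1) m)) \<in> kern_span J"
    by (rule kern_span_power_mult[OF *]) (use assms(3)[OF base(2)] in auto)
  have 2: "(\<lambda>\<tau> m. c * (of_int m ^ s * nome_kern (nome_of \<tau>) (e + d + 1) m)) \<in> kern_span J"
    by (intro kern_span_cmult kern_span_kern assms(3)[OF base(2)]) auto
  from kern_span_smult[OF kern_span.add[OF 1 2] base(1)]
  show ?case by (rule kern_span.cong) (simp add: algebra_simps)
next
  case (add F G)
  show ?case using kern_span.add[OF add.IH] by (simp add: distrib_left)
next
  case (cong F G)
  show ?case by (rule kern_span.cong[OF cong.IH]) (simp add: cong.hyps(2))
qed

text \<open>Summation over m turns each generator into its moment. Orders at least 1 make the
  kernels decay, so that no regularisation intervenes.\<close>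

lemma kern_span_has_sum:
  assumes "F \<in> kern_span I" "\<And>s e. (s, e) \<in> I \<Longrightarrow> e \<ge> 1"
    and "\<And>s e. (s, e) \<in> I \<Longrightarrow> (\<lambda>\<tau>. moment (nome_of \<tau>) s e) \<in> QM"
  shows "\<exists>g\<in>QM. \<forall>\<tau>. Im \<tau> > 0 \<longrightarrow> (F \<tau> has_sum g \<tau>) (- {0})"
  using assms(1)
proof induction
  case zero
  show ?case by (rule bexI[OF _ QM.const[of 0]]) simp
next
  case (base f s e)
  have "((\<lambda>m. f \<tau> * of_int m ^ s * nome_kern (nome_of \<tau>) e m) has_sum
      (f \<tau> * moment (nome_of \<tau>) s e)) (- {0})" if "Im \<tau> > 0" for \<tau>
  proof -
    interpret nome "nome_of \<tau>" by (rule nome_nome_of[OF that])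
    have "reg_kern (nome_of \<tau>) e = nome_kern (nome_of \<tau>) e"
      using assms(2)[OF base(2)] by (simp add: fun_eq_iff)
    with has_sum_moment[of s e]
    have "((\<lambda>m. of_int m ^ s * nome_kern (nome_of \<tau>) e m) has_sum moment (nome_of \<tau>) s e) UNIV"
      by simp
    moreover have "((\<lambda>m. of_int m ^ s * nome_kern (nome_of \<tau>) e m) has_sum S) UNIV \<longleftrightarrow>
        ((\<lambda>m. of_int m ^ s * nome_kern (nome_of \<tau>) e m) has_sum S) (UNIV - {0})" for S
      by (rule has_sum_cong_neutral) auto
    ultimately have "((\<lambda>m. of_int m ^ s * nome_kern (nome_of \<tau>) e m) has_sum
        moment (nome_of \<tau>) s e) (UNIV - {0})" by (rule iffD1[rotated])
    from has_sum_cmult_right[OF this, of "f \<tau>"] show ?thesis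
      by (simp add: Compl_eq_Diff_UNIV mult.assoc)
  qed
  moreover have "(\<lambda>\<tau>. f \<tau> * moment (nome_of \<tau>) s e) \<in> QM"
    by (rule QM.mult[OF base(1) assms(3)[OF base(2)]])
  ultimately show ?case by (intro bexI[of _ "\<lambda>\<tau>. f \<tau> * moment (nome_of \<tau>) s e"]) auto
next
  case (add F G)
  from add.IH(1) obtain f where f: "f \<in> QM" "\<forall>\<tau>. Im \<tau> > 0 \<longrightarrow> (F \<tau> has_sum f \<tau>) (- {0})" ..
  from add.IH(2) obtain g where g: "g \<in> QM" "\<forall>\<tau>. Im \<tau> > 0 \<longrightarrow> (G \<tau> has_sum g \<tau>) (- {0})" ..
  show ?case
    by (rule bexI[OF _ QM.add[OF f(1) g(1)]]) (use f(2) g(2) in \<open>simp add: has_sum_add\<close>)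
next
  case (cong F G)
  from cong.IH obtain f where f: "f \<in> QM" "\<forall>\<tau>. Im \<tau> > 0 \<longrightarrow> (F \<tau> has_sum f \<tau>) (- {0})" ..
  have "(G \<tau> has_sum f \<tau>) (- {0})" if \<tau>: "Im \<tau> > 0" for \<tau>
  proof -
    have "(G \<tau> has_sum f \<tau>) (- {0}) \<longleftrightarrow> (F \<tau> has_sum f \<tau>) (- {0})"
      by (rule has_sum_cong) (simp add: cong.hyps(2)[OF \<tau>])
    thus ?thesis using f(2) \<tau> by simp
  qed
  thus ?case by (intro bexI[OF _ f(1)]) simp
qed

section \<open>All moments are quasi-modular\<close>

context nome
begin

lemma has_sum_conv_sum:
  assumes "d1 \<ge> 1" "d2 \<ge> 1"
  shows "(conv_sum q c d1 d2 has_sum moment q c d1 * moment q 0 d2) UNIV"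
proof -
  let ?f = "\<lambda>k. of_int k ^ c * nome_kern q d1 k"
  let ?g = "\<lambda>k. of_int k ^ 0 * nome_kern q d2 k"
  have f: "(\<lambda>k. norm (?f k)) summable_on UNIV"
    using abs_summable_moment[of c d1] assms by simp
  have g: "(\<lambda>k. norm (?g k)) summable_on UNIV"
    using abs_summable_moment[of 0 d2] assms by simp
  have hf: "(?f has_sum moment q c d1) UNIV"
    using has_sum_moment[of c d1] assms by simp
  have hg: "(?g has_sum moment q 0 d2) UNIV"
    using has_sum_moment[of 0 d2] assms by simp
  have one: "norm ((\<lambda>_. 1 :: complex) m) \<le> 1" for m :: int by simp
  let ?S = "\<Sum>\<^sub>\<infinity>(k, l). ?f k * ?g l * 1"
  note D = infsum_diagonals[OF f g one]
  have eq: "(\<lambda>(k, l). norm (?f k * ?g l * 1)) = (\<lambda>x. norm (case x of (k, l) \<Rightarrow> ?f k * ?g l * 1))"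
    by auto
  have "(\<lambda>(k, l). ?f k * ?g l * 1) summable_on UNIV"
    by (rule abs_summable_summable) (use D(1) in \<open>simp only: eq\<close>)
  hence "((\<lambda>(k, l). ?f k * ?g l * 1) has_sum ?S) (UNIV \<times> UNIV)"
    by (simp only: UNIV_Times_UNIV has_sum_infsum)
  hence "((\<lambda>k. ?f k * moment q 0 d2) has_sum ?S) UNIV"
    by (rule has_sum_Sigma') (use has_sum_cmult_right[OF hg] in simp)
  moreover have "((\<lambda>k. ?f k * moment q 0 d2) has_sum moment q c d1 * moment q 0 d2) UNIV"
    by (rule has_sum_cmult_left[OF hf])
  ultimately have S: "?S = moment q c d1 * moment q 0 d2"
    by (rule has_sum_unique)
  have "(\<lambda>m. 1 * (\<Sum>\<^sub>\<infinity>k. ?f k * ?g (m - k))) = conv_sum q c d1 d2"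
    by (simp add: conv_sum_def fun_eq_iff)
  with D(2) show ?thesis unfolding S by simp
qed

text \<open>All diagonals together give the product of the moments. The diagonal m = 0 is removed by
  hand: there l = - k, and parity of the second kernel turns its sum into
  \<open>(- 1) ^ Suc d2 * s\<close>.\<close>

lemma has_sum_conv_sum_nonzero:
  assumes "d1 \<ge> 1" "d2 \<ge> 1"
    and "((\<lambda>k. of_int k ^ c * (nome_kern q d1 k * nome_kern q d2 k)) has_sum s) (- {0})"
  shows "(conv_sum q c d1 d2 has_sum (moment q c d1 * moment q 0 d2 + (- 1) ^ d2 * s)) (- {0})"
proof -
  have "((\<lambda>k. of_int k ^ c * (nome_kern q d1 k * nome_kern q d2 k)) has_sum s) (- {0}) \<longleftrightarrow>
      ((\<lambda>k. of_int k ^ c * (nome_kern q d1 k * nome_kern q d2 k)) has_sum s) UNIV"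
    by (rule has_sum_cong_neutral) auto
  with assms(3) have "((\<lambda>k. of_int k ^ c * (nome_kern q d1 k * nome_kern q d2 k)) has_sum s) UNIV"
    by (rule iffD1[rotated])
  from has_sum_cmult_right[OF this, of "(- 1) ^ Suc d2"]
  have "((\<lambda>k. of_int k ^ c * nome_kern q d1 k * nome_kern q d2 (0 - k)) has_sum (- 1) ^ Suc d2 * s) UNIV"
    by (simp add: nome_kern_minus mult_ac)
  hence "conv_sum q c d1 d2 0 = (- 1) ^ Suc d2 * s"
    unfolding conv_sum_def by (rule infsumI)
  moreover have "(conv_sum q c d1 d2 has_sum conv_sum q c d1 d2 0) {0}"
    using has_sum_finite[of "{0}" "conv_sum q c d1 d2"] by simp
  hence "(conv_sum q c d1 d2 has_sum (moment q c d1 * moment q 0 d2 - conv_sum q c d1 d2 0)) (UNIV - {0})"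
    by (intro has_sum_Diff has_sum_conv_sum assms) auto
  ultimately show ?thesis by (simp add: Compl_eq_Diff_UNIV)
qed

end

lemma kern_span_power_kern_product:
  assumes "a \<ge> 1" "\<And>i. 1 \<le> i \<Longrightarrow> (s, i) \<in> I"
  shows "(\<lambda>\<tau> m. of_int m ^ s * (nome_kern (nome_of \<tau>) a m * nome_kern (nome_of \<tau>) b m)) \<in> kern_span I"
proof -
  have "(\<lambda>\<tau> m. of_int m ^ s * nome_kern (nome_of \<tau>) a m) \<in> kern_span ({s} \<times> {1..})"
    by (rule kern_span_kern) (use assms in auto)
  hence "(\<lambda>\<tau> m. nome_kern (nome_of \<tau>) b m * (of_int m ^ s * nome_kern (nome_of \<tau>) a m)) \<in> kern_span I"
    by (rule kern_span_kern_mult) (use assms in auto)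
  thus ?thesis by (simp only: mult_ac)
qed

text \<open>The leading term of the power sum is the only contribution with an exponent of m above
  c, and the only moments entering as coefficients have exponent at most c.\<close>

lemma conv_sum_kern_span:
  assumes d: "d1 \<ge> 1" "d2 \<ge> 1"
    and M: "\<And>c' e. c' \<le> c \<Longrightarrow> (\<lambda>\<tau>. moment (nome_of \<tau>) c' e) \<in> QM"
  shows "(\<lambda>\<tau> m. conv_sum (nome_of \<tau>) c d1 d2 m -
     of_int m ^ Suc c / of_nat (Suc c) * nome_kern (nome_of \<tau>) (d1 + d2) m) \<in> kern_span ({..c} \<times> {1..})"
proof -
  let ?K = "\<lambda>\<tau>. nome_kern (nome_of \<tau>)"
  let ?M = "\<lambda>\<tau>. moment (nome_of \<tau>)"
  let ?I = "{..c} \<times> {1..} :: (nat \<times> nat) set"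
  define p where "p = power_sum_poly c"
  have p: "poly p x = (\<Sum>s\<le>c. coeff p s * x ^ s)" for x
    unfolding poly_altdef using power_sum_poly(1)[of c]
    by (intro sum.mono_neutral_left) (auto simp: p_def coeff_eq_0)
  have 1: "(\<lambda>\<tau> m. \<Sum>i\<le>d1. of_nat (d1 choose i) * (?M \<tau> c (d1 - i) * (of_int m ^ 0 * ?K \<tau> (d2 + i) m) -
      of_int m ^ c * (?K \<tau> (d2 + i) m * ?K \<tau> (d1 - i) m))) \<in> kern_span ?I"
    by (intro kern_span_sum kern_span_cmult kern_span_diff kern_span_smult M kern_span_kern
        kern_span_power_kern_product) (use d in auto)
  have 2: "(\<lambda>\<tau> m. \<Sum>j\<le>d2. of_nat (d2 choose j) * ((\<Sum>l\<le>c. of_nat (c choose l) * ((- 1) ^ l *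
        (?M \<tau> l (d2 - j) * (of_int m ^ (c - l) * ?K \<tau> (d1 + j) m)))) -
      0 ^ c * (of_int m ^ 0 * (?K \<tau> (d1 + j) m * ?K \<tau> (d2 - j) m)))) \<in> kern_span ?I"
    by (intro kern_span_sum kern_span_cmult kern_span_diff kern_span_smult M kern_span_kern
        kern_span_power_kern_product) (use d in auto)
  have 3: "(\<lambda>\<tau> m. \<Sum>s\<le>c. coeff p s * (of_int m ^ s * ?K \<tau> (d1 + d2) m)) \<in> kern_span ?I"
    by (intro kern_span_sum kern_span_cmult kern_span_kern) (use d in auto)
  show ?thesis
  proof (rule kern_span.cong[OF kern_span.add[OF kern_span.add[OF 1 2] 3]])
    fix \<tau> :: complex and m :: int
    assume \<tau>: "Im \<tau> > 0" and m: "m \<noteq> 0"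
    interpret nome "nome_of \<tau>" by (rule nome_nome_of[OF \<tau>])
    have e1: "(\<Sum>i\<le>d1. of_nat (d1 choose i) * (?M \<tau> c (d1 - i) * (of_int m ^ 0 * ?K \<tau> (d2 + i) m) -
        of_int m ^ c * (?K \<tau> (d2 + i) m * ?K \<tau> (d1 - i) m))) =
      (\<Sum>i\<le>d1. of_nat (d1 choose i) * ?K \<tau> (d2 + i) m *
        (?M \<tau> c (d1 - i) - of_int m ^ c * ?K \<tau> (d1 - i) m))"
      by (rule sum.cong[OF HOL.refl]) (simp add: algebra_simps)
    have e2: "(\<Sum>j\<le>d2. of_nat (d2 choose j) * ((\<Sum>l\<le>c. of_nat (c choose l) * ((- 1) ^ l *
        (?M \<tau> l (d2 - j) * (of_int m ^ (c - l) * ?K \<tau> (d1 + j) m)))) -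
      0 ^ c * (of_int m ^ 0 * (?K \<tau> (d1 + j) m * ?K \<tau> (d2 - j) m)))) =
      (\<Sum>j\<le>d2. of_nat (d2 choose j) * ?K \<tau> (d1 + j) m *
       ((\<Sum>l\<le>c. of_nat (c choose l) * (- 1) ^ l * of_int m ^ (c - l) * ?M \<tau> l (d2 - j)) -
        0 ^ c * ?K \<tau> (d2 - j) m))"
      by (rule sum.cong[OF HOL.refl]) (simp add: right_diff_distrib sum_distrib_left mult_ac)
    have e3: "(\<Sum>s\<le>c. coeff p s * (of_int m ^ s * ?K \<tau> (d1 + d2) m)) =
        ?K \<tau> (d1 + d2) m * poly (power_sum_poly c) (of_int m)"
      unfolding p_def[symmetric] p by (simp add: sum_distrib_left mult_ac)
    show "conv_sum (nome_of \<tau>) c d1 d2 m -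
        of_int m ^ Suc c / of_nat (Suc c) * nome_kern (nome_of \<tau>) (d1 + d2) m =
      (\<Sum>i\<le>d1. of_nat (d1 choose i) * (?M \<tau> c (d1 - i) * (of_int m ^ 0 * ?K \<tau> (d2 + i) m) -
        of_int m ^ c * (?K \<tau> (d2 + i) m * ?K \<tau> (d1 - i) m))) +
      (\<Sum>j\<le>d2. of_nat (d2 choose j) * ((\<Sum>l\<le>c. of_nat (c choose l) * ((- 1) ^ l *
        (?M \<tau> l (d2 - j) * (of_int m ^ (c - l) * ?K \<tau> (d1 + j) m)))) -
      0 ^ c * (of_int m ^ 0 * (?K \<tau> (d1 + j) m * ?K \<tau> (d2 - j) m)))) +
      (\<Sum>s\<le>c. coeff p s * (of_int m ^ s * ?K \<tau> (d1 + d2) m))"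
      unfolding e1 e2 e3 conv_sum_eq[OF m d] distrib_left by simp
  qed
qed

text \<open>The total coefficient of the top kernel coming from the subtracted products of two
  kernels. Each summand of the numerator is d! e! binomial(e + i, i), and the hockey-stick identity
  sums these.\<close>

lemma sum_binomial_fact:
  "(\<Sum>i\<le>d. of_nat (d choose i) * (fact (e + i) * fact (d - i) / fact (d + e + 1))) =
     (1 / of_nat (e + 1) :: complex)"
proof -
  have tm: "of_nat (d choose i) * (fact (e + i) * fact (d - i)) =
      (fact d * fact e * of_nat ((e + i) choose i) :: complex)" if "i \<le> d" for i
    using that by (simp add: binomial_fact[OF that] binomial_fact[of i "e + i"])
  have "(\<Sum>i\<le>d. of_nat (d choose i) * (fact (e + i) * fact (d - i))) =
      (fact d * fact e * of_nat (Suc (e + d) choose d) :: complex)"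
    by (simp add: tm sum_distrib_left[symmetric] of_nat_sum[symmetric] sum_choose_lower del: of_nat_sum)
  also have "\<dots> = fact (d + e + 1) / of_nat (e + 1)"
  proof -
    have "Suc (e + d) - d = Suc e" by simp
    hence "(of_nat (Suc (e + d) choose d) :: complex) = fact (Suc (e + d)) / (fact d * fact (Suc e))"
      using binomial_fact[of d "Suc (e + d)", where 'a = complex] by simp
    thus ?thesis by (simp add: field_simps del: of_nat_Suc)
  qed
  finally have "(\<Sum>i\<le>d. of_nat (d choose i) * (fact (e + i) * fact (d - i))) =
      (fact (d + e + 1) / of_nat (e + 1) :: complex)" .
  moreover have "X / F = 1 / E" if "X = F / E" "F \<noteq> 0" for X F E :: complex
    using that by simp
  ultimately have "(\<Sum>i\<le>d. of_nat (d choose i) * (fact (e + i) * fact (d - i))) / fact (d + e + 1) =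
      (1 / of_nat (e + 1) :: complex)" by (meson fact_nonzero)
  thus ?thesis by (simp only: sum_divide_distrib times_divide_eq_right)
qed

text \<open>For c = 0 both exceptional points contribute products, whence the two fractions at the
  top kernel, and the power sum is exactly m. Thus precisely two terms lie outside the known
  orders.\<close>

lemma conv_sum_0_kern_span:
  assumes d: "d1 \<ge> 1" "d2 \<ge> 1"
    and M: "\<And>e. e \<le> d1 + d2 \<Longrightarrow> (\<lambda>\<tau>. moment (nome_of \<tau>) 0 e) \<in> QM"
  shows "(\<lambda>\<tau> m. conv_sum (nome_of \<tau>) 0 d1 d2 m - of_int m * nome_kern (nome_of \<tau>) (d1 + d2) m +
     (1 / of_nat (d1 + 1) + 1 / of_nat (d2 + 1)) * nome_kern (nome_of \<tau>) (d1 + d2 + 1) m)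
     \<in> kern_span ({0} \<times> {1..d1 + d2})"
proof -
  let ?K = "\<lambda>\<tau>. nome_kern (nome_of \<tau>)"
  let ?M = "\<lambda>\<tau>. moment (nome_of \<tau>)"
  let ?I = "{0} \<times> {1..d1 + d2} :: (nat \<times> nat) set"
  let ?w = "d1 + d2 + 1"
  have half: "(\<lambda>\<tau> m. \<Sum>i\<le>d. of_nat (d choose i) * (?M \<tau> 0 (d - i) * (of_int m ^ 0 * ?K \<tau> (e + i) m) -
      (?K \<tau> (e + i) m * ?K \<tau> (d - i) m - fact (e + i) * fact (d - i) / fact ?w * ?K \<tau> ?w m)))
      \<in> kern_span ?I"
    if de: "d + e = d1 + d2" "e \<ge> 1" for d e
  proof (rule kern_span_sum, rule kern_span_cmult, rule kern_span_diff)
    fix i assume "i \<in> {..d}"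
    hence i: "e + i + (d - i) = d1 + d2" "e + i \<ge> 1" using de by auto
    show "(\<lambda>\<tau> m. ?K \<tau> (e + i) m * ?K \<tau> (d - i) m -
        fact (e + i) * fact (d - i) / fact ?w * ?K \<tau> ?w m) \<in> kern_span ?I"
      using kern_span_product[OF i(2), of "d - i"] unfolding i(1) .
    show "(\<lambda>\<tau> m. ?M \<tau> 0 (d - i) * (of_int m ^ 0 * ?K \<tau> (e + i) m)) \<in> kern_span ?I"
      by (rule kern_span_smult[OF kern_span_kern M]) (use i de in auto)
  qed
  have split: "(\<Sum>i\<le>d. of_nat (d choose i) * (?M \<tau> 0 (d - i) * (of_int m ^ 0 * ?K \<tau> (e + i) m) -
      (?K \<tau> (e + i) m * ?K \<tau> (d - i) m - fact (e + i) * fact (d - i) / fact ?w * ?K \<tau> ?w m))) =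
      (\<Sum>i\<le>d. of_nat (d choose i) * ?K \<tau> (e + i) m * (?M \<tau> 0 (d - i) - of_int m ^ 0 * ?K \<tau> (d - i) m)) +
      1 / of_nat (e + 1) * ?K \<tau> ?w m" if de: "d + e = d1 + d2" for d e \<tau> m
  proof -
    have alg: "c * K1 * (M - 1 * K2) + c * t * W = c * (M * (1 * K1) - (K1 * K2 - t * W))"
      for c K1 K2 M t W :: complex by (simp add: algebra_simps)
    have "1 / of_nat (e + 1) * ?K \<tau> ?w m =
        (\<Sum>i\<le>d. of_nat (d choose i) * (fact (e + i) * fact (d - i) / fact ?w) * ?K \<tau> ?w m)"
      unfolding sum_binomial_fact[of d e, symmetric] unfolding de by (rule sum_distrib_right)
    hence "(\<Sum>i\<le>d. of_nat (d choose i) * ?K \<tau> (e + i) m * (?M \<tau> 0 (d - i) - of_int m ^ 0 * ?K \<tau> (d - i) m)) +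
        1 / of_nat (e + 1) * ?K \<tau> ?w m =
        (\<Sum>i\<le>d. of_nat (d choose i) * ?K \<tau> (e + i) m * (?M \<tau> 0 (d - i) - of_int m ^ 0 * ?K \<tau> (d - i) m) +
          of_nat (d choose i) * (fact (e + i) * fact (d - i) / fact ?w) * ?K \<tau> ?w m)"
      by (simp only: sum.distrib)
    also have "\<dots> = (\<Sum>i\<le>d. of_nat (d choose i) * (?M \<tau> 0 (d - i) * (of_int m ^ 0 * ?K \<tau> (e + i) m) -
      (?K \<tau> (e + i) m * ?K \<tau> (d - i) m - fact (e + i) * fact (d - i) / fact ?w * ?K \<tau> ?w m)))"
      by (simp only: power_0 alg)
    finally show ?thesis by (rule sym)
  qed
  show ?thesis
  proof (rule kern_span.cong[OF kern_span.add[OF half[of d1 d2] half[of d2 d1]]])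
    fix \<tau> :: complex and m :: int
    assume \<tau>: "Im \<tau> > 0" and m: "m \<noteq> 0"
    interpret nome "nome_of \<tau>" by (rule nome_nome_of[OF \<tau>])
    have d': "d2 + d1 = d1 + d2" by simp
    show "conv_sum (nome_of \<tau>) 0 d1 d2 m - of_int m * nome_kern (nome_of \<tau>) (d1 + d2) m +
       (1 / of_nat (d1 + 1) + 1 / of_nat (d2 + 1)) * nome_kern (nome_of \<tau>) (d1 + d2 + 1) m =
      (\<Sum>i\<le>d1. of_nat (d1 choose i) * (?M \<tau> 0 (d1 - i) * (of_int m ^ 0 * ?K \<tau> (d2 + i) m) -
        (?K \<tau> (d2 + i) m * ?K \<tau> (d1 - i) m - fact (d2 + i) * fact (d1 - i) / fact ?w * ?K \<tau> ?w m))) +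
      (\<Sum>i\<le>d2. of_nat (d2 choose i) * (?M \<tau> 0 (d2 - i) * (of_int m ^ 0 * ?K \<tau> (d1 + i) m) -
        (?K \<tau> (d1 + i) m * ?K \<tau> (d2 - i) m - fact (d1 + i) * fact (d2 - i) / fact ?w * ?K \<tau> ?w m)))"
      unfolding split[OF HOL.refl] split[OF d'] conv_sum_eq[OF m d]
      by (simp add: power_sum_poly(2) distrib_right)
  qed (use d in auto)
qed

text \<open>
  The product of the moments of orders \<open>d1\<close> and \<open>d2\<close> is the sum of the diagonal sums; the diagonal
  \<open>m = 0\<close> contributes the term with the factorials.
\<close>

lemma moment_relation:
  assumes d: "odd d1" "odd d2"
    and M: "\<And>e. e \<le> d1 + d2 \<Longrightarrow> (\<lambda>\<tau>. moment (nome_of \<tau>) 0 e) \<in> QM"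
  shows "(\<lambda>\<tau>. moment (nome_of \<tau>) 1 (d1 + d2) +
     (fact d1 * fact d2 / fact (d1 + d2 + 1) - (1 / of_nat (d1 + 1) + 1 / of_nat (d2 + 1))) *
       moment (nome_of \<tau>) 0 (d1 + d2 + 1)) \<in> QM"
proof -
  let ?K = "\<lambda>\<tau>. nome_kern (nome_of \<tau>)"
  let ?M = "\<lambda>\<tau>. moment (nome_of \<tau>)"
  let ?w = "d1 + d2 + 1"
  define t :: complex where "t = fact d1 * fact d2 / fact ?w"
  define u :: complex where "u = 1 / of_nat (d1 + 1) + 1 / of_nat (d2 + 1)"
  have d1: "d1 \<ge> 1" and d2: "d2 \<ge> 1" using d by (auto simp: Suc_le_eq odd_pos)
  have "\<exists>g\<in>QM. \<forall>\<tau>. Im \<tau> > 0 \<longrightarrow> ((\<lambda>m. ?K \<tau> d1 m * ?K \<tau> d2 m - t * ?K \<tau> ?w m) has_sum g \<tau>) (- {0})"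
    unfolding t_def by (rule kern_span_has_sum[OF kern_span_product[OF d1]]) (auto intro!: M)
  then obtain g where g: "g \<in> QM" "\<forall>\<tau>. Im \<tau> > 0 \<longrightarrow>
      ((\<lambda>m. ?K \<tau> d1 m * ?K \<tau> d2 m - t * ?K \<tau> ?w m) has_sum g \<tau>) (- {0})" ..
  have "\<exists>h\<in>QM. \<forall>\<tau>. Im \<tau> > 0 \<longrightarrow> ((\<lambda>m. conv_sum (nome_of \<tau>) 0 d1 d2 m -
      of_int m * ?K \<tau> (d1 + d2) m + u * ?K \<tau> ?w m) has_sum h \<tau>) (- {0})"
    unfolding u_def by (rule kern_span_has_sum[OF conv_sum_0_kern_span[OF d1 d2 M]]) (auto intro!: M)
  then obtain h where h: "h \<in> QM" "\<forall>\<tau>. Im \<tau> > 0 \<longrightarrow> ((\<lambda>m. conv_sum (nome_of \<tau>) 0 d1 d2 m -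
      of_int m * ?K \<tau> (d1 + d2) m + u * ?K \<tau> ?w m) has_sum h \<tau>) (- {0})" ..
  have "(\<lambda>\<tau>. ?M \<tau> 0 d1 * ?M \<tau> 0 d2 - g \<tau> - h \<tau>) \<in> QM"
    by (intro QM_diff QM.mult M g(1) h(1)) auto
  thus ?thesis
  proof (rule QM.cong)
    fix \<tau> :: complex assume \<tau>: "Im \<tau> > 0"
    interpret nome "nome_of \<tau>" by (rule nome_nome_of[OF \<tau>])
    have to_nonzero: "((\<lambda>m. of_int m ^ c * ?K \<tau> e m) has_sum ?M \<tau> c e) (- {0})" if "e \<ge> 1" for c e
    proof -
      have "((\<lambda>m. of_int m ^ c * ?K \<tau> e m) has_sum ?M \<tau> c e) UNIV"
        using has_sum_moment[of c e] that by simp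
      moreover have "((\<lambda>m. of_int m ^ c * ?K \<tau> e m) has_sum ?M \<tau> c e) UNIV \<longleftrightarrow>
          ((\<lambda>m. of_int m ^ c * ?K \<tau> e m) has_sum ?M \<tau> c e) (- {0})"
        by (rule has_sum_cong_neutral) auto
      ultimately show ?thesis by (rule iffD1[rotated])
    qed
    have K: "(?K \<tau> ?w has_sum ?M \<tau> 0 ?w) (- {0})"
      using to_nonzero[of ?w 0] by simp
    have K': "((\<lambda>m. of_int m * ?K \<tau> (d1 + d2) m) has_sum ?M \<tau> 1 (d1 + d2)) (- {0})"
      using to_nonzero[of "d1 + d2" 1] d1 by simp
    \<comment> \<open>The sum of \<open>conv_sum\<close> over m \<noteq> 0 is now evaluated twice:
      as the product of moments less the diagonal m = 0, and through the kernels at m. Odd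
      \<open>d2\<close> fixes the sign in the former.\<close>
    have "((\<lambda>m. (?K \<tau> d1 m * ?K \<tau> d2 m - t * ?K \<tau> ?w m) + t * ?K \<tau> ?w m) has_sum
        (g \<tau> + t * ?M \<tau> 0 ?w)) (- {0})"
      by (intro has_sum_add has_sum_cmult_right K) (use g(2) \<tau> in blast)
    hence "((\<lambda>m. of_int m ^ 0 * (?K \<tau> d1 m * ?K \<tau> d2 m)) has_sum (g \<tau> + t * ?M \<tau> 0 ?w)) (- {0})"
      by simp
    from has_sum_conv_sum_nonzero[OF d1 d2 this]
    have "(conv_sum (nome_of \<tau>) 0 d1 d2 has_sum
        (?M \<tau> 0 d1 * ?M \<tau> 0 d2 + (- 1) * (g \<tau> + t * ?M \<tau> 0 ?w))) (- {0})"
      using d(2) by (simp only: uminus_power_if if_False power_one)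
    moreover have "((\<lambda>m. (conv_sum (nome_of \<tau>) 0 d1 d2 m -
      of_int m * ?K \<tau> (d1 + d2) m + u * ?K \<tau> ?w m) + (of_int m * ?K \<tau> (d1 + d2) m + (- u) * ?K \<tau> ?w m)) has_sum
        (h \<tau> + (?M \<tau> 1 (d1 + d2) + (- u) * ?M \<tau> 0 ?w))) (- {0})"
      by (intro has_sum_add has_sum_cmult_right K K') (use h(2) \<tau> in blast)
    hence "(conv_sum (nome_of \<tau>) 0 d1 d2 has_sum
        (h \<tau> + (?M \<tau> 1 (d1 + d2) + (- u) * ?M \<tau> 0 ?w))) (- {0})"
      by simp
    ultimately have "?M \<tau> 0 d1 * ?M \<tau> 0 d2 + (- 1) * (g \<tau> + t * ?M \<tau> 0 ?w) =
        h \<tau> + (?M \<tau> 1 (d1 + d2) + (- u) * ?M \<tau> 0 ?w)"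
      by (rule has_sum_unique)
    thus "?M \<tau> 1 (d1 + d2) + (fact d1 * fact d2 / fact ?w -
        (1 / of_nat (d1 + 1) + 1 / of_nat (d2 + 1))) * ?M \<tau> 0 ?w = ?M \<tau> 0 d1 * ?M \<tau> 0 d2 - g \<tau> - h \<tau>"
      unfolding t_def[symmetric] u_def[symmetric] by (simp add: algebra_simps)
  qed
qed

lemma moment_swap_in_QM:
  assumes "(\<lambda>\<tau>. moment (nome_of \<tau>) c d) \<in> QM"
  shows "(\<lambda>\<tau>. moment (nome_of \<tau>) d c) \<in> QM"
  using assms by (rule QM.cong) (metis nome.moment_swap nome_nome_of)

lemma moment_even_in_QM:
  assumes "even (c + d)"
  shows "(\<lambda>\<tau>. moment (nome_of \<tau>) c d) \<in> QM"
  by (rule QM.cong[OF QM.const[of 0]]) (metis assms nome.moment_even nome_nome_of)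

text \<open>
  The relations for \<open>(1, w - 1)\<close> and \<open>(3, w - 3)\<close> have different coefficients at the moment of order
  \<open>w + 1\<close>, so that it can be eliminated.
\<close>

lemma relation_coefficients_differ:
  assumes "w \<ge> 6"
  shows "fact 1 * fact (w - 1) / fact (w + 1) - (1 / of_nat (1 + 1) + 1 / of_nat (w - 1 + 1)) \<noteq>
    (fact 3 * fact (w - 3) / fact (w + 1) - (1 / of_nat (3 + 1) + 1 / of_nat (w - 3 + 1)) :: complex)"
proof -
  obtain n where w: "w = n + 6" using assms by (metis add.commute le_Suc_ex)
  define x where "x = real n"
  have x: "x \<ge> 0" by (simp add: x_def)
  have ws: "w - 1 = n + 5" "w - 3 = n + 3" "w + 1 = n + 7" by (auto simp: w)
  have Suc5: "n + 5 = Suc (Suc (n + 3))" and Suc7: "n + 7 = Suc (Suc (n + 5))" by simp_all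
  have f5: "fact (n + 5) = (x + 5) * (x + 4) * (fact (n + 3) :: real)"
    unfolding Suc5 fact_Suc by (simp only: of_nat_Suc of_nat_add of_nat_numeral x_def) (simp add: add_ac)
  have f7: "fact (n + 7) = (x + 7) * (x + 6) * ((x + 5) * (x + 4) * (fact (n + 3) :: real))"
    unfolding f5[symmetric] Suc7 fact_Suc
    by (simp only: of_nat_Suc of_nat_add of_nat_numeral x_def) (simp add: add_ac)
  have f3: "fact 3 = (6 :: real)" by (simp add: fact_numeral)
  have nz: "fact (n + 3) \<noteq> (0 :: real)" by simp
  have coeffs: "real (1 + 1) = 2" "real (w - 1 + 1) = x + 6" "real (3 + 1) = 4"
    "real (w - 3 + 1) = x + 4" "fact 1 = (1 :: real)"
    by (simp_all add: w x_def)
  have "1 * fact (w - 1) / fact (w + 1) - (1 / 2 + 1 / (x + 6)) = 1 / ((x + 7) * (x + 6)) - (1 / 2 + 1 / (x + 6))"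
    unfolding ws f5 f7 using x nz by simp
  moreover have "fact 3 * fact (w - 3) / fact (w + 1) - (1 / 4 + 1 / (x + 4)) =
      6 / ((x + 7) * (x + 6) * (x + 5) * (x + 4)) - (1 / 4 + 1 / (x + 4))"
    unfolding ws f7 f3 using x nz by simp
  \<comment> \<open>The left side is at most - 1/2 and the right side exceeds - 1/2. At x = 0, that
    is w = 6, strictness comes only from the factorial term.\<close>
  moreover have "1 / ((x + 7) * (x + 6)) - (1 / 2 + 1 / (x + 6)) <
      6 / ((x + 7) * (x + 6) * (x + 5) * (x + 4)) - (1 / 4 + 1 / (x + 4))"
  proof -
    have "1 / ((x + 7) * (x + 6)) \<le> 1 / (x + 6)" using x by (simp add: divide_simps)
    moreover have "1 / (x + 4) \<le> 1 / 4" using x by (simp add: divide_simps)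
    moreover have "6 / ((x + 7) * (x + 6) * (x + 5) * (x + 4)) > 0" using x by simp
    ultimately show ?thesis by linarith
  qed
  ultimately have "fact 1 * fact (w - 1) / fact (w + 1) - (1 / of_nat (1 + 1) + 1 / of_nat (w - 1 + 1)) \<noteq>
    (fact 3 * fact (w - 3) / fact (w + 1) - (1 / of_nat (3 + 1) + 1 / of_nat (w - 3 + 1)) :: real)"
    unfolding coeffs by linarith
  hence "complex_of_real (fact 1 * fact (w - 1) / fact (w + 1) - (1 / of_nat (1 + 1) + 1 / of_nat (w - 1 + 1))) \<noteq>
    complex_of_real (fact 3 * fact (w - 3) / fact (w + 1) - (1 / of_nat (3 + 1) + 1 / of_nat (w - 3 + 1)))"
    unfolding of_real_eq_iff .
  thus ?thesis
    unfolding of_real_diff of_real_add of_real_divide of_real_mult of_real_fact of_real_of_nat_eq of_real_1 .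
qed

lemma moment_0_in_QM: "(\<lambda>\<tau>. moment (nome_of \<tau>) 0 e) \<in> QM"
proof (induction e rule: less_induct)
  case (less e)
  show ?case
  proof (cases "even e")
    case True
    thus ?thesis by (intro moment_even_in_QM) simp
  next
    case False
    show ?thesis
    proof (cases "e \<le> 5")
      case True
      with False have "e = 1 \<or> e = 3 \<or> e = 5" by presburger
      thus ?thesis using moment_generators_in_QM by (auto intro: moment_swap_in_QM)
    next
      case e: False
      \<comment> \<open>Evenness of w makes the parts odd in both w = 1 + (w - 1) and w = 3 + (w -
        3), and the moments these relations presuppose have order at most w < e.\<close>
      define w where "w = e - 1"
      have "e \<ge> 7" using e False by presburger
      hence w: "e = w + 1" "w \<ge> 6" "even w" using False by (auto simp: w_def)
      define a :: complex where "a = fact 1 * fact (w - 1) / fact (w + 1) - (1 / of_nat (1 + 1) + 1 / of_nat (w - 1 + 1))"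
      define b :: complex where "b = fact 3 * fact (w - 3) / fact (w + 1) - (1 / of_nat (3 + 1) + 1 / of_nat (w - 3 + 1))"
      have ab: "a - b \<noteq> 0" using relation_coefficients_differ[OF w(2)]
        unfolding a_def b_def right_minus_eq .
      have A: "(\<lambda>\<tau>. moment (nome_of \<tau>) 1 w + a * moment (nome_of \<tau>) 0 e) \<in> QM"
      proof -
        have "1 + (w - 1) = w" using w by simp
        thus ?thesis using moment_relation[of 1 "w - 1"] w less.IH by (simp only: a_def) auto
      qed
      have B: "(\<lambda>\<tau>. moment (nome_of \<tau>) 1 w + b * moment (nome_of \<tau>) 0 e) \<in> QM"
      proof -
        have "3 + (w - 3) = w" using w by simp
        thus ?thesis using moment_relation[of 3 "w - 3"] w less.IH by (simp only: b_def) auto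
      qed
      \<comment> \<open>The difference cancels the moment with exponents (1, w), whose membership is
        still open, and leaves a - b times the wanted one.\<close>
      from QM_cmult[OF QM_diff[OF A B], of "1 / (a - b)"]
      show ?thesis
        by (rule QM.cong) (use ab in \<open>simp add: field_simps\<close>)
    qed
  qed
qed

lemma moment_in_QM: "(\<lambda>\<tau>. moment (nome_of \<tau>) c d) \<in> QM"
proof (induction c arbitrary: d rule: less_induct)
  case (less c)
  show ?case
  proof (cases "c = 0")
    case True
    thus ?thesis using moment_0_in_QM by simp
  next
    case False
    then obtain b where c: "c = Suc b" by (cases c) auto
    have IH: "(\<lambda>\<tau>. moment (nome_of \<tau>) c' e) \<in> QM" if "c' \<le> b" for c' e
      using less.IH[of c' e] that c by simp
    \<comment> \<open>The diagonal sum with exponent b yields the wanted moment only if d splits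
      into two positive orders. For d = 0 and d = 1 symmetry exchanges c and d, which lowers the
      exponent except for c = d = 1, where the moment vanishes by parity.\<close>
    consider "d = 0" | "d = 1" "b = 0" | "d = 1" "b \<ge> 1" | "d \<ge> 2" by linarith
    thus ?thesis
    proof cases
      case 1
      thus ?thesis using moment_swap_in_QM[OF moment_0_in_QM] by simp
    next
      case 2
      thus ?thesis using moment_even_in_QM[of c d] c by simp
    next
      case 3
      thus ?thesis using moment_swap_in_QM[OF IH] by simp
    next
      case 4
      define e where "e = d - 1"
      have e: "d = 1 + e" "e \<ge> 1" using 4 by (auto simp: e_def)
      let ?K = "\<lambda>\<tau>. nome_kern (nome_of \<tau>)"
      let ?M = "\<lambda>\<tau>. moment (nome_of \<tau>)"
      have "(\<lambda>\<tau> m. of_int m ^ b * (?K \<tau> 1 m * ?K \<tau> e m)) \<in> kern_span ({b} \<times> {1..})"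
        by (rule kern_span_power_kern_product) auto
      hence "\<exists>g\<in>QM. \<forall>\<tau>. Im \<tau> > 0 \<longrightarrow> ((\<lambda>m. of_int m ^ b * (?K \<tau> 1 m * ?K \<tau> e m)) has_sum g \<tau>) (- {0})"
        by (rule kern_span_has_sum) (auto intro!: IH)
      then obtain g where g: "g \<in> QM"
        "\<forall>\<tau>. Im \<tau> > 0 \<longrightarrow> ((\<lambda>m. of_int m ^ b * (?K \<tau> 1 m * ?K \<tau> e m)) has_sum g \<tau>) (- {0})" ..
      have "\<exists>h\<in>QM. \<forall>\<tau>. Im \<tau> > 0 \<longrightarrow> ((\<lambda>m. conv_sum (nome_of \<tau>) b 1 e m -
          of_int m ^ Suc b / of_nat (Suc b) * ?K \<tau> (1 + e) m) has_sum h \<tau>) (- {0})"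
        by (rule kern_span_has_sum[OF conv_sum_kern_span[OF order.refl e(2) IH]]) (auto intro!: IH)
      then obtain h where h: "h \<in> QM" "\<forall>\<tau>. Im \<tau> > 0 \<longrightarrow> ((\<lambda>m. conv_sum (nome_of \<tau>) b 1 e m -
          of_int m ^ Suc b / of_nat (Suc b) * ?K \<tau> (1 + e) m) has_sum h \<tau>) (- {0})" ..
      \<comment> \<open>The factor b + 1 undoes the leading coefficient 1 / (b + 1) of the power
        sum.\<close>
      have "(\<lambda>\<tau>. of_nat (Suc b) * ((?M \<tau> b 1 * ?M \<tau> 0 e + (- 1) ^ e * g \<tau>) - h \<tau>)) \<in> QM"
        by (intro QM_cmult QM_diff QM.add QM.mult IH g(1) h(1)) auto
      thus ?thesis
      proof (rule QM.cong)
        fix \<tau> :: complex assume \<tau>: "Im \<tau> > 0"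
        interpret nome "nome_of \<tau>" by (rule nome_nome_of[OF \<tau>])
        have "((\<lambda>m. of_int m ^ b * (?K \<tau> 1 m * ?K \<tau> e m)) has_sum g \<tau>) (- {0})"
          using g(2) \<tau> by blast
        from has_sum_conv_sum_nonzero[OF order.refl e(2) this]
        have 1: "(conv_sum (nome_of \<tau>) b 1 e has_sum (?M \<tau> b 1 * ?M \<tau> 0 e + (- 1) ^ e * g \<tau>)) (- {0})" .
        have "((\<lambda>m. of_int m ^ c * ?K \<tau> d m) has_sum ?M \<tau> c d) UNIV"
          using has_sum_moment[of c d] 4 by simp
        moreover have "((\<lambda>m. of_int m ^ c * ?K \<tau> d m) has_sum ?M \<tau> c d) UNIV \<longleftrightarrow>
            ((\<lambda>m. of_int m ^ c * ?K \<tau> d m) has_sum ?M \<tau> c d) (- {0})"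
          by (rule has_sum_cong_neutral) auto
        ultimately have "((\<lambda>m. of_int m ^ c * ?K \<tau> d m) has_sum ?M \<tau> c d) (- {0})"
          by (rule iffD1[rotated])
        from has_sum_cmult_right[OF this, of "1 / of_nat (Suc b)"]
        have 2: "((\<lambda>m. of_int m ^ Suc b / of_nat (Suc b) * ?K \<tau> (1 + e) m) has_sum
            ?M \<tau> c d / of_nat (Suc b)) (- {0})"
          unfolding c e(1) by simp
        have "((\<lambda>m. (conv_sum (nome_of \<tau>) b 1 e m - of_int m ^ Suc b / of_nat (Suc b) * ?K \<tau> (1 + e) m) +
            of_int m ^ Suc b / of_nat (Suc b) * ?K \<tau> (1 + e) m) has_sum
            (h \<tau> + ?M \<tau> c d / of_nat (Suc b))) (- {0})"
          by (intro has_sum_add 2) (use h(2) \<tau> in blast)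
        hence "(conv_sum (nome_of \<tau>) b 1 e has_sum (h \<tau> + ?M \<tau> c d / of_nat (Suc b))) (- {0})"
          by simp
        with 1 have "?M \<tau> b 1 * ?M \<tau> 0 e + (- 1) ^ e * g \<tau> = h \<tau> + ?M \<tau> c d / of_nat (Suc b)"
          by (rule has_sum_unique)
        moreover have "of_nat (Suc b) \<noteq> (0 :: complex)" by (simp only: of_nat_eq_0_iff)
        ultimately show "?M \<tau> c d = of_nat (Suc b) * ((?M \<tau> b 1 * ?M \<tau> 0 e + (- 1) ^ e * g \<tau>) - h \<tau>)"
          by (simp del: of_nat_Suc)
      qed
    qed
  qed
qed

section \<open>Sums over the lattice of triples \<open>k + l = m\<close>\<close>

lemma conv_sum_kern_span_all:
  assumes "d1 \<ge> 1" "d2 \<ge> 1"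
  shows "(\<lambda>\<tau> m. conv_sum (nome_of \<tau>) c d1 d2 m) \<in> kern_span (UNIV \<times> {1..})"
proof -
  have 1: "(\<lambda>\<tau> m. conv_sum (nome_of \<tau>) c d1 d2 m -
     of_int m ^ Suc c / of_nat (Suc c) * nome_kern (nome_of \<tau>) (d1 + d2) m) \<in> kern_span (UNIV \<times> {1..})"
    by (rule kern_span_mono[OF conv_sum_kern_span[OF assms moment_in_QM]]) auto
  have 2: "(\<lambda>\<tau> m. 1 / of_nat (Suc c) * (of_int m ^ Suc c * nome_kern (nome_of \<tau>) (d1 + d2) m))
      \<in> kern_span (UNIV \<times> {1..})"
    by (rule kern_span_cmult[OF kern_span_kern]) (use assms in auto)
  show ?thesis by (rule kern_span.cong[OF kern_span.add[OF 1 2]]) simp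
qed

lemma (in nome) has_sum_conv_sum_row:
  assumes "d1 \<ge> 1" "d2 \<ge> 1"
  shows "((\<lambda>k. of_int k ^ c * nome_kern q d1 k * nome_kern q d2 (m - k)) has_sum conv_sum q c d1 d2 m) UNIV"
proof -
  obtain B where B: "\<And>k. norm (of_int k ^ 0 * reg_kern q d2 k) \<le> B"
    using bounded_moment_terms by blast
  have "(\<lambda>k. norm (of_int k ^ c * reg_kern q d1 k) * B) summable_on UNIV"
    by (rule summable_on_cmult_left[OF abs_summable_moment])
  hence "(\<lambda>k. norm (of_int k ^ c * nome_kern q d1 k * nome_kern q d2 (m - k))) summable_on UNIV"
  proof (rule Infinite_Sum.abs_summable_on_comparison_test')
    fix k :: int
    have "norm (of_int k ^ c * nome_kern q d1 k) * norm (nome_kern q d2 (m - k)) \<le>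
        norm (of_int k ^ c * nome_kern q d1 k) * B"
      by (rule mult_left_mono) (use B[of "m - k"] assms in auto)
    thus "norm (of_int k ^ c * nome_kern q d1 k * nome_kern q d2 (m - k)) \<le>
        norm (of_int k ^ c * reg_kern q d1 k) * B"
      using assms by (simp add: norm_mult)
  qed
  thus ?thesis unfolding conv_sum_def by (rule has_sum_infsum[OF abs_summable_summable])
qed

definition weighted_kern :: "nat \<Rightarrow> nat \<Rightarrow> complex \<Rightarrow> int \<Rightarrow> complex" where
  "weighted_kern c d \<tau> k = of_int k ^ c * nome_kern (nome_of \<tau>) d k"

lemma weighted_kern_0 [simp]: "weighted_kern c d \<tau> 0 = 0"
  by (simp add: weighted_kern_def)

text \<open>\<open>conv_sum\<close> carries a power of k alone; expanding (m - k)^c2 reduces powers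
  of both variables to it.\<close>

lemma infsum_weighted_kern_diagonal:
  assumes "Im \<tau> > 0" and d: "d1 \<ge> 1" "d2 \<ge> 1"
  shows "(\<Sum>\<^sub>\<infinity>k. weighted_kern c1 d1 \<tau> k * weighted_kern c2 d2 \<tau> (m - k)) =
    (\<Sum>l\<le>c2. of_nat (c2 choose l) * ((- 1) ^ l * (of_int m ^ (c2 - l) *
      conv_sum (nome_of \<tau>) (c1 + l) d1 d2 m)))"
proof -
  interpret nome "nome_of \<tau>" by (rule nome_nome_of[OF assms(1)])
  let ?K = "nome_kern (nome_of \<tau>)"
  have "((\<lambda>k. \<Sum>l\<le>c2. of_nat (c2 choose l) * ((- 1) ^ l * (of_int m ^ (c2 - l) *
      (of_int k ^ (c1 + l) * ?K d1 k * ?K d2 (m - k))))) has_sum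
    (\<Sum>l\<le>c2. of_nat (c2 choose l) * ((- 1) ^ l * (of_int m ^ (c2 - l) *
      conv_sum (nome_of \<tau>) (c1 + l) d1 d2 m)))) UNIV"
    by (intro has_sum_finite_sum finite_atMost has_sum_cmult_right has_sum_conv_sum_row d)
  moreover have "(\<Sum>l\<le>c2. of_nat (c2 choose l) * ((- 1) ^ l * (of_int m ^ (c2 - l) *
      (of_int k ^ (c1 + l) * ?K d1 k * ?K d2 (m - k))))) =
      weighted_kern c1 d1 \<tau> k * weighted_kern c2 d2 \<tau> (m - k)" for k
  proof -
    have "of_int (m - k) ^ c2 = (\<Sum>l\<le>c2. of_nat (c2 choose l) * (- of_int k) ^ l * of_int m ^ (c2 - l) :: complex)"
      using binomial_ring[of "- of_int k :: complex" "of_int m" c2] by simp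
    hence "weighted_kern c1 d1 \<tau> k * weighted_kern c2 d2 \<tau> (m - k) =
        (\<Sum>l\<le>c2. of_nat (c2 choose l) * (- of_int k) ^ l * of_int m ^ (c2 - l)) *
        (of_int k ^ c1 * ?K d1 k * ?K d2 (m - k))"
      by (simp only: weighted_kern_def mult_ac)
    also have "\<dots> = (\<Sum>l\<le>c2. of_nat (c2 choose l) * ((- 1) ^ l * (of_int m ^ (c2 - l) *
      (of_int k ^ (c1 + l) * ?K d1 k * ?K d2 (m - k)))))"
      unfolding sum_distrib_right
    proof (rule sum.cong[OF HOL.refl])
      fix l
      have "(- of_int k) ^ l = (- 1) ^ l * (of_int k ^ l :: complex)" by (rule power_minus)
      thus "of_nat (c2 choose l) * (- of_int k) ^ l * of_int m ^ (c2 - l) *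
          (of_int k ^ c1 * ?K d1 k * ?K d2 (m - k)) =
          of_nat (c2 choose l) * ((- 1) ^ l * (of_int m ^ (c2 - l) *
            (of_int k ^ (c1 + l) * ?K d1 k * ?K d2 (m - k))))"
        by (simp only: power_add mult_ac)
    qed
    finally show ?thesis by (rule sym)
  qed
  ultimately show ?thesis by (simp add: infsumI)
qed

lemma weighted_kern_diagonals:
  assumes "Im \<tau> > 0" and d: "d1 \<ge> 1" "d2 \<ge> 1" "d3 \<ge> 1"
  shows "(\<lambda>(k, l). weighted_kern c1 d1 \<tau> k * weighted_kern c2 d2 \<tau> l *
      weighted_kern c3 d3 \<tau> (k + l)) summable_on UNIV" (is ?A)
    and "((\<lambda>m. weighted_kern c3 d3 \<tau> m *
      (\<Sum>\<^sub>\<infinity>k. weighted_kern c1 d1 \<tau> k * weighted_kern c2 d2 \<tau> (m - k))) has_sum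
      (\<Sum>\<^sub>\<infinity>(k, l). weighted_kern c1 d1 \<tau> k * weighted_kern c2 d2 \<tau> l *
        weighted_kern c3 d3 \<tau> (k + l))) UNIV" (is ?B)
proof -
  interpret nome "nome_of \<tau>" by (rule nome_nome_of[OF assms(1)])
  have w: "weighted_kern c e \<tau> = (\<lambda>k. of_int k ^ c * reg_kern (nome_of \<tau>) e k)" if "e \<ge> 1" for c e
    using that by (simp add: weighted_kern_def fun_eq_iff)
  have sm: "(\<lambda>k. norm (weighted_kern c e \<tau> k)) summable_on UNIV" if "e \<ge> 1" for c e
    unfolding w[OF that] by (rule abs_summable_moment)
  obtain B where B: "\<And>k. norm (weighted_kern c3 d3 \<tau> k) \<le> B"
    unfolding w[OF d(3)] using bounded_moment_terms by blast
  note D = infsum_diagonals[OF sm[OF d(1), of c1] sm[OF d(2), of c2], where h = "weighted_kern c3 d3 \<tau>", OF B]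
  show ?B by (rule D(2))
  have eq: "(\<lambda>(k, l). norm (weighted_kern c1 d1 \<tau> k * weighted_kern c2 d2 \<tau> l * weighted_kern c3 d3 \<tau> (k + l))) =
      (\<lambda>x. norm (case x of (k, l) \<Rightarrow> weighted_kern c1 d1 \<tau> k * weighted_kern c2 d2 \<tau> l * weighted_kern c3 d3 \<tau> (k + l)))"
    by auto
  show ?A by (rule abs_summable_summable[OF D(1)[unfolded eq]])
qed

text \<open>The sum over a diagonal is a combination of kernels at m, and multiplying by the third
  kernel keeps it one. The diagonal m = 0 drops out, as the third factor vanishes there.\<close>

lemma triple_sum_in_QM:
  assumes d: "d1 \<ge> 1" "d2 \<ge> 1" "d3 \<ge> 1"
  shows "(\<lambda>\<tau>. \<Sum>\<^sub>\<infinity>(k, l). weighted_kern c1 d1 \<tau> k * weighted_kern c2 d2 \<tau> l *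
     weighted_kern c3 d3 \<tau> (k + l)) \<in> QM"
proof -
  define F where "F = (\<lambda>\<tau> m. nome_kern (nome_of \<tau>) d3 m * (of_int m ^ c3 *
    (\<Sum>l\<le>c2. of_nat (c2 choose l) * ((- 1) ^ l * (of_int m ^ (c2 - l) *
      conv_sum (nome_of \<tau>) (c1 + l) d1 d2 m)))))"
  have "F \<in> kern_span (UNIV \<times> {1..})"
    unfolding F_def
    by (rule kern_span_kern_mult[where I = "UNIV \<times> {1..}"],
        rule kern_span_power_mult[where I = "UNIV \<times> {1..}"], rule kern_span_sum,
        rule kern_span_cmult, rule kern_span_cmult,
        rule kern_span_power_mult[where I = "UNIV \<times> {1..}"], rule conv_sum_kern_span_all[OF d(1,2)])
       auto
  hence "\<exists>g\<in>QM. \<forall>\<tau>. Im \<tau> > 0 \<longrightarrow> (F \<tau> has_sum g \<tau>) (- {0})"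
    by (rule kern_span_has_sum) (auto intro!: moment_in_QM)
  then obtain g where g: "g \<in> QM" "\<forall>\<tau>. Im \<tau> > 0 \<longrightarrow> (F \<tau> has_sum g \<tau>) (- {0})" ..
  from g(1) show ?thesis
  proof (rule QM.cong)
    fix \<tau> :: complex assume \<tau>: "Im \<tau> > 0"
    let ?S = "\<Sum>\<^sub>\<infinity>(k, l). weighted_kern c1 d1 \<tau> k * weighted_kern c2 d2 \<tau> l * weighted_kern c3 d3 \<tau> (k + l)"
    have "F \<tau> = (\<lambda>m. weighted_kern c3 d3 \<tau> m *
        (\<Sum>\<^sub>\<infinity>k. weighted_kern c1 d1 \<tau> k * weighted_kern c2 d2 \<tau> (m - k)))"
      unfolding infsum_weighted_kern_diagonal[OF \<tau> d(1,2)]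
      unfolding F_def weighted_kern_def by (simp only: mult_ac)
    with weighted_kern_diagonals(2)[OF \<tau> d] have "(F \<tau> has_sum ?S) UNIV" by simp
    moreover have "(F \<tau> has_sum ?S) UNIV \<longleftrightarrow> (F \<tau> has_sum ?S) (- {0})"
      by (rule has_sum_cong_neutral) (auto simp: F_def)
    ultimately have "(F \<tau> has_sum ?S) (- {0})" by (rule iffD1[rotated])
    moreover have "(F \<tau> has_sum g \<tau>) (- {0})" using g(2) \<tau> by blast
    ultimately show "?S = g \<tau>" by (rule has_sum_unique)
  qed
qed

text \<open>The contribution of a root whose pairing with the shifted weight is k: c = 0 for the
  zeta functions, while for the characters c is the exponent of the Weyl dimension.\<close>

definition root_factor :: "nat \<Rightarrow> nat \<Rightarrow> complex \<Rightarrow> int \<Rightarrow> complex" where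
  "root_factor c n \<tau> k = of_int k ^ c * nome_kern (nome_of \<tau>) 1 k ^ n"

lemma root_factor_expand:
  assumes "n \<ge> 1"
  shows "\<exists>a. \<forall>\<tau> k. root_factor c n \<tau> k = (\<Sum>e=1..2 * n - 1. a e * weighted_kern c e \<tau> k)"
proof -
  obtain a where a: "\<And>x. kern 1 x ^ n = (\<Sum>i=1..2 * n - 1. a i * kern i x)"
    using kern_1_power[OF assms] by blast
  have "root_factor c n \<tau> k = (\<Sum>e=1..2 * n - 1. a e * weighted_kern c e \<tau> k)" for \<tau> k
  proof (cases "k = 0")
    case True
    thus ?thesis using assms by (simp add: root_factor_def power_0_left)
  next
    case False
    hence "root_factor c n \<tau> k = of_int k ^ c * (\<Sum>i=1..2 * n - 1. a i * kern i (nome_of \<tau> powi k))"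
      by (simp only: root_factor_def nome_kern_def if_False a)
    also have "\<dots> = (\<Sum>e=1..2 * n - 1. a e * weighted_kern c e \<tau> k)"
      unfolding sum_distrib_left weighted_kern_def nome_kern_def using False
      by (simp only: if_False mult.left_commute)
    finally show ?thesis .
  qed
  thus ?thesis by blast
qed

lemma triple_product:
  fixes x y z :: "'a \<Rightarrow> 'b::comm_semiring_0"
  shows "(\<Sum>i\<in>A. x i) * (\<Sum>j\<in>B. y j) * (\<Sum>l\<in>C. z l) = (\<Sum>i\<in>A. \<Sum>j\<in>B. \<Sum>l\<in>C. x i * y j * z l)"
  by (subst sum_product) (simp only: sum_distrib_right, simp only: sum_distrib_left)

lemma root_factor_triple_sum:
  assumes n: "n1 \<ge> 1" "n2 \<ge> 1" "n3 \<ge> 1"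
  shows "(\<lambda>\<tau>. \<Sum>\<^sub>\<infinity>(k, l). root_factor c1 n1 \<tau> k * root_factor c2 n2 \<tau> l * root_factor c3 n3 \<tau> (k + l)) \<in> QM"
      (is ?A)
    and "Im \<tau> > 0 \<Longrightarrow> (\<lambda>(k, l). root_factor c1 n1 \<tau> k * root_factor c2 n2 \<tau> l *
      root_factor c3 n3 \<tau> (k + l)) summable_on UNIV" (is "_ \<Longrightarrow> ?B")
proof -
  obtain a1 where a1: "\<And>\<tau> k. root_factor c1 n1 \<tau> k = (\<Sum>e=1..2 * n1 - 1. a1 e * weighted_kern c1 e \<tau> k)"
    using root_factor_expand[OF n(1)] by blast
  obtain a2 where a2: "\<And>\<tau> k. root_factor c2 n2 \<tau> k = (\<Sum>e=1..2 * n2 - 1. a2 e * weighted_kern c2 e \<tau> k)"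
    using root_factor_expand[OF n(2)] by blast
  obtain a3 where a3: "\<And>\<tau> k. root_factor c3 n3 \<tau> k = (\<Sum>e=1..2 * n3 - 1. a3 e * weighted_kern c3 e \<tau> k)"
    using root_factor_expand[OF n(3)] by blast
  define T where "T = (\<lambda>d1 d2 d3 \<tau> x. case x of (k, l) \<Rightarrow>
      weighted_kern c1 d1 \<tau> k * weighted_kern c2 d2 \<tau> l * weighted_kern c3 d3 \<tau> (k + l))"
  define S where "S = (\<lambda>\<tau>. \<Sum>d1=1..2 * n1 - 1. \<Sum>d2=1..2 * n2 - 1. \<Sum>d3=1..2 * n3 - 1.
      a1 d1 * (a2 d2 * (a3 d3 * infsum (T d1 d2 d3 \<tau>) UNIV)))"
  have expand: "(\<Sum>d1=1..2 * n1 - 1. \<Sum>d2=1..2 * n2 - 1. \<Sum>d3=1..2 * n3 - 1.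
      a1 d1 * (a2 d2 * (a3 d3 * T d1 d2 d3 \<tau> (k, l)))) =
      root_factor c1 n1 \<tau> k * root_factor c2 n2 \<tau> l * root_factor c3 n3 \<tau> (k + l)" for \<tau> k l
    unfolding a1 a2 a3 T_def prod.case triple_product by (simp only: mult_ac)
  have hs: "((\<lambda>(k, l). root_factor c1 n1 \<tau> k * root_factor c2 n2 \<tau> l * root_factor c3 n3 \<tau> (k + l))
      has_sum S \<tau>) UNIV" if "Im \<tau> > 0" for \<tau>
  proof -
    have sm: "(T d1 d2 d3 \<tau> has_sum infsum (T d1 d2 d3 \<tau>) UNIV) UNIV"
      if "d1 \<in> {1..2 * n1 - 1}" "d2 \<in> {1..2 * n2 - 1}" "d3 \<in> {1..2 * n3 - 1}" for d1 d2 d3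
      unfolding T_def by (rule has_sum_infsum[OF weighted_kern_diagonals(1)[OF \<open>Im \<tau> > 0\<close>]]) (use that in auto)
    have "((\<lambda>x. \<Sum>d1=1..2 * n1 - 1. \<Sum>d2=1..2 * n2 - 1. \<Sum>d3=1..2 * n3 - 1.
      a1 d1 * (a2 d2 * (a3 d3 * T d1 d2 d3 \<tau> x))) has_sum S \<tau>) UNIV"
      unfolding S_def by (intro has_sum_finite_sum finite_atLeastAtMost has_sum_cmult_right sm)
    moreover have "(\<lambda>x. \<Sum>d1=1..2 * n1 - 1. \<Sum>d2=1..2 * n2 - 1. \<Sum>d3=1..2 * n3 - 1.
      a1 d1 * (a2 d2 * (a3 d3 * T d1 d2 d3 \<tau> x))) =
      (\<lambda>(k, l). root_factor c1 n1 \<tau> k * root_factor c2 n2 \<tau> l * root_factor c3 n3 \<tau> (k + l))"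
      by (rule ext) (simp only: expand split_paired_all prod.case)
    ultimately show ?thesis by simp
  qed
  show ?B if "Im \<tau> > 0" using hs[OF that] by (rule has_sum_imp_summable)
  have "S \<in> QM"
    unfolding S_def T_def
    by (intro QM_sum QM_cmult triple_sum_in_QM) auto
  thus ?A by (rule QM.cong) (use infsumI[OF hs] in blast)
qed

text \<open>The sum over the dominant chamber; the third function belongs to the highest root, the
  first two to the simple roots.\<close>

definition chamber_sum :: "(int \<Rightarrow> complex) \<Rightarrow> (int \<Rightarrow> complex) \<Rightarrow> (int \<Rightarrow> complex) \<Rightarrow> complex" where
  "chamber_sum f g h = (\<Sum>\<^sub>\<infinity>(a, b)\<in>{1..} \<times> {1..}. f (int a) * g (int b) * h (int a + int b))"

lemma chamber_sum_commute: "chamber_sum f g h = chamber_sum g f h"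
  unfolding chamber_sum_def
  by (rule infsum_reindex_bij_witness[of _ prod.swap prod.swap]) (auto simp: add.commute)

text \<open>
  The lines \<open>k = 0\<close>, \<open>l = 0\<close> and \<open>k + l = 0\<close> cut the plane into the six Weyl chambers.
\<close>

lemma infsum_chambers:
  fixes f g h :: "int \<Rightarrow> complex"
  assumes even: "\<And>k. f (- k) = f k" "\<And>k. g (- k) = g k" "\<And>k. h (- k) = h k"
    and zero: "f 0 = 0" "g 0 = 0" "h 0 = 0"
    and summable: "(\<lambda>(k, l). f k * g l * h (k + l)) summable_on UNIV"
  shows "(\<Sum>\<^sub>\<infinity>(k, l). f k * g l * h (k + l)) =
    2 * (chamber_sum f g h + chamber_sum f h g + chamber_sum g h f)"
proof -
  let ?F = "\<lambda>(k, l). f k * g l * h (k + l)"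
  define C1 where "C1 = {(k::int, l::int). k > 0 \<and> l > 0}"
  define C2 where "C2 = {(k::int, l::int). k < 0 \<and> l < 0}"
  define C3 where "C3 = {(k::int, l::int). l < 0 \<and> k + l > 0}"
  define C4 where "C4 = {(k::int, l::int). l > 0 \<and> k + l < 0}"
  define C5 where "C5 = {(k::int, l::int). k > 0 \<and> k + l < 0}"
  define C6 where "C6 = {(k::int, l::int). k < 0 \<and> k + l > 0}"
  have hs: "(?F has_sum infsum ?F C) C" for C
    by (rule has_sum_infsum[OF summable_on_subset_banach[OF summable]]) simp
  have "- y - x = - (x + y)" "- x - y = - (x + y)" for x y :: int by simp_all
  note neg = this[THEN arg_cong, of f, unfolded even] this[THEN arg_cong, of g, unfolded even]
    this[THEN arg_cong, of h, unfolded even]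
  have S1: "infsum ?F C1 = chamber_sum f g h" unfolding chamber_sum_def C1_def
    by (rule infsum_reindex_bij_witness[of _ "\<lambda>(a, b). (int a, int b)" "\<lambda>(k, l). (nat k, nat l)"]) auto
  have S2: "infsum ?F C2 = chamber_sum f g h" unfolding chamber_sum_def C2_def
    by (rule infsum_reindex_bij_witness[of _ "\<lambda>(a, b). (- int a, - int b)" "\<lambda>(k, l). (nat (- k), nat (- l))"])
       (auto simp: even neg add.commute)
  \<comment> \<open>In each chamber the largest of |k|, |l|, |k + l| is the sum of the other two, so
    its function takes the place of the highest root; here it is k.\<close>
  have S3: "infsum ?F C3 = chamber_sum g h f" unfolding chamber_sum_def C3_def
    by (rule infsum_reindex_bij_witness[of _ "\<lambda>(a, b). (int a + int b, - int a)" "\<lambda>(k, l). (nat (- l), nat (k + l))"])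
       (auto simp: even neg)
  have S4: "infsum ?F C4 = chamber_sum g h f" unfolding chamber_sum_def C4_def
    by (rule infsum_reindex_bij_witness[of _ "\<lambda>(a, b). (- int a - int b, int a)" "\<lambda>(k, l). (nat l, nat (- k - l))"])
       (auto simp: even neg add.commute)
  have S5: "infsum ?F C5 = chamber_sum f h g" unfolding chamber_sum_def C5_def
    by (rule infsum_reindex_bij_witness[of _ "\<lambda>(a, b). (int a, - int a - int b)" "\<lambda>(k, l). (nat k, nat (- k - l))"])
       (auto simp: even neg add.commute)
  have S6: "infsum ?F C6 = chamber_sum f h g" unfolding chamber_sum_def C6_def
    by (rule infsum_reindex_bij_witness[of _ "\<lambda>(a, b). (- int a, int a + int b)" "\<lambda>(k, l). (nat (- k), nat (k + l))"])
       (auto simp: even neg)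
  have "(?F has_sum (chamber_sum f g h + chamber_sum f g h + chamber_sum g h f + chamber_sum g h f +
      chamber_sum f h g + chamber_sum f h g)) (C1 \<union> C2 \<union> C3 \<union> C4 \<union> C5 \<union> C6)"
    using hs[of C1] hs[of C2] hs[of C3] hs[of C4] hs[of C5] hs[of C6] unfolding S1 S2 S3 S4 S5 S6
    by (intro has_sum_Un_disjoint) (auto simp: C1_def C2_def C3_def C4_def C5_def C6_def)
  moreover have "(?F has_sum S) (C1 \<union> C2 \<union> C3 \<union> C4 \<union> C5 \<union> C6) \<longleftrightarrow> (?F has_sum S) UNIV" for S
  proof (rule has_sum_cong_neutral)
    fix x :: "int \<times> int" assume x: "x \<in> UNIV - (C1 \<union> C2 \<union> C3 \<union> C4 \<union> C5 \<union> C6)"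
    obtain k l where kl: "x = (k, l)" by (cases x)
    have "k = 0 \<or> l = 0 \<or> k + l = 0"
      using x unfolding kl C1_def C2_def C3_def C4_def C5_def C6_def by simp linarith
    thus "?F x = 0" using zero by (auto simp: kl)
  qed auto
  ultimately have "(?F has_sum (chamber_sum f g h + chamber_sum f g h + chamber_sum g h f + chamber_sum g h f +
      chamber_sum f h g + chamber_sum f h g)) UNIV" by (rule iffD1[rotated])
  from infsumI[OF this] show ?thesis by simp
qed

text \<open>The kernel of order 1 is even in k, so n is arbitrary, and only the powers k^c have to
  be even for the chambers to be reflected into each other. For the characters this is the evenness
  of the number k of tensor factors.\<close>

lemma chamber_sums_in_QM:
  assumes "n1 \<ge> 1" "n2 \<ge> 1" "n3 \<ge> 1" "even c1" "even c2" "even c3"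
  shows "(\<lambda>\<tau>. 2 * (chamber_sum (root_factor c1 n1 \<tau>) (root_factor c2 n2 \<tau>) (root_factor c3 n3 \<tau>) +
    chamber_sum (root_factor c1 n1 \<tau>) (root_factor c3 n3 \<tau>) (root_factor c2 n2 \<tau>) +
    chamber_sum (root_factor c2 n2 \<tau>) (root_factor c3 n3 \<tau>) (root_factor c1 n1 \<tau>))) \<in> QM"
proof (rule QM.cong[OF root_factor_triple_sum(1)[OF assms(1-3)]])
  fix \<tau> :: complex assume \<tau>: "Im \<tau> > 0"
  interpret nome "nome_of \<tau>" by (rule nome_nome_of[OF \<tau>])
  have even: "root_factor c n \<tau> (- k) = root_factor c n \<tau> k" if "even c" for c n k
    using that by (simp add: root_factor_def nome_kern_minus power_minus_even)
  have zero: "root_factor c n \<tau> 0 = 0" if "n \<ge> 1" for c n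
    using that by (simp add: root_factor_def power_0_left)
  show "2 * (chamber_sum (root_factor c1 n1 \<tau>) (root_factor c2 n2 \<tau>) (root_factor c3 n3 \<tau>) +
    chamber_sum (root_factor c1 n1 \<tau>) (root_factor c3 n3 \<tau>) (root_factor c2 n2 \<tau>) +
    chamber_sum (root_factor c2 n2 \<tau>) (root_factor c3 n3 \<tau>) (root_factor c1 n1 \<tau>)) =
    (\<Sum>\<^sub>\<infinity>(k, l). root_factor c1 n1 \<tau> k * root_factor c2 n2 \<tau> l * root_factor c3 n3 \<tau> (k + l))"
    by (rule infsum_chambers[symmetric])
       (use assms in \<open>simp_all only: even zero root_factor_triple_sum(2)[OF assms(1-3) \<tau>]\<close>)
qed

section \<open>The characters and zeta functions of \<open>sl\<^sub>3\<close>\<close>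

lemma (in nome) root_factor_of_nat:
  assumes "q = nome_of \<tau>" "a \<ge> 1"
  shows "root_factor c n \<tau> (int a) = of_nat a ^ c * (q ^ (n * a) / (1 - q ^ a) ^ (2 * n))"
proof -
  have "q powi int a \<noteq> 1" using assms by (intro powi_neq_1) simp
  hence "kern 1 (q ^ a) = q ^ a / (1 - q ^ a) ^ 2" by (intro kern_1) simp
  thus ?thesis
    using assms by (simp add: root_factor_def nome_kern_def power_divide power_mult[symmetric] mult.commute)
qed

lemma zeta_sl3_eq_chamber_sum:
  assumes "Im \<tau> > 0"
  shows "zeta_sl3 (2 * k1) (2 * k2) (2 * k3) \<tau> =
    chamber_sum (root_factor 0 k1 \<tau>) (root_factor 0 k2 \<tau>) (root_factor 0 k3 \<tau>)"
proof -
  interpret nome "nome_of \<tau>" by (rule nome_nome_of[OF assms])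
  have eq: "qpow \<tau> (1 / 2 * (real (2 * k1) * real m1 + real (2 * k2) * real m2 + real (2 * k3) * (real m1 + real m2))) /
      ((1 - qpow \<tau> (real m1)) ^ (2 * k1) * (1 - qpow \<tau> (real m2)) ^ (2 * k2) *
       (1 - qpow \<tau> (real m1 + real m2)) ^ (2 * k3)) =
      root_factor 0 k1 \<tau> (int m1) * root_factor 0 k2 \<tau> (int m2) * root_factor 0 k3 \<tau> (int m1 + int m2)"
    if m: "m1 \<in> {1..}" "m2 \<in> {1..}" for m1 m2
  proof -
    have e: "1 / 2 * (real (2 * k1) * real m1 + real (2 * k2) * real m2 + real (2 * k3) * (real m1 + real m2)) =
        real (k1 * m1 + k2 * m2 + k3 * (m1 + m2))"
      by (simp add: field_simps)
    have s: "int m1 + int m2 = int (m1 + m2)" "real m1 + real m2 = real (m1 + m2)" by simp_all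
    have m': "m1 \<ge> 1" "m2 \<ge> 1" "m1 + m2 \<ge> 1" using m by auto
    show ?thesis
      unfolding e unfolding s qpow_of_nat
        root_factor_of_nat[OF HOL.refl m'(1)] root_factor_of_nat[OF HOL.refl m'(2)] root_factor_of_nat[OF HOL.refl m'(3)]
      by (simp only: power_add power_0 mult_1_left times_divide_eq_right times_divide_eq_left
          divide_divide_eq_left mult_ac)
  qed
  show ?thesis
    unfolding zeta_sl3_eq chamber_sum_def
  proof (rule infsum_cong)
    fix x :: "nat \<times> nat" assume x: "x \<in> {1..} \<times> {1..}"
    obtain a b where ab: "x = (a, b)" by (cases x)
    have "a \<in> {1..}" "b \<in> {1..}" using x by (auto simp: ab)
    from eq[OF this] show "(case x of (m1, m2) \<Rightarrow>
        qpow \<tau> (1 / 2 * (real (2 * k1) * real m1 + real (2 * k2) * real m2 + real (2 * k3) * (real m1 + real m2))) /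
        ((1 - qpow \<tau> (real m1)) ^ (2 * k1) * (1 - qpow \<tau> (real m2)) ^ (2 * k2) *
         (1 - qpow \<tau> (real m1 + real m2)) ^ (2 * k3))) =
        (case x of (a, b) \<Rightarrow> root_factor 0 k1 \<tau> (int a) * root_factor 0 k2 \<tau> (int b) *
          root_factor 0 k3 \<tau> (int a + int b))"
      unfolding ab prod.case .
  qed
qed

lemma weyl_images:
  fixes \<phi> :: "real ^ 3 \<Rightarrow> real ^ 3 \<Rightarrow> real ^ 3 \<Rightarrow> complex"
  shows "(\<Sum>\<sigma>\<in>weyl_group sl3. \<phi> (\<sigma> \<alpha>\<^sub>1) (\<sigma> \<alpha>\<^sub>2) (\<sigma> \<alpha>\<^sub>3)) =
    \<phi> \<alpha>\<^sub>1 \<alpha>\<^sub>2 \<alpha>\<^sub>3 + \<phi> (- \<alpha>\<^sub>1) \<alpha>\<^sub>3 \<alpha>\<^sub>2 + \<phi> \<alpha>\<^sub>3 (- \<alpha>\<^sub>2) \<alpha>\<^sub>1 + \<phi> (- \<alpha>\<^sub>2) (- \<alpha>\<^sub>1) (- \<alpha>\<^sub>3) +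
    \<phi> (- \<alpha>\<^sub>3) \<alpha>\<^sub>1 (- \<alpha>\<^sub>2) + \<phi> \<alpha>\<^sub>2 (- \<alpha>\<^sub>3) (- \<alpha>\<^sub>1)"
proof -
  define ws :: "(real ^ 3 \<Rightarrow> real ^ 3) list" where "ws =
     [\<lambda>x. vector [x $ 1, x $ 2, x $ 3], \<lambda>x. vector [x $ 2, x $ 1, x $ 3],
      \<lambda>x. vector [x $ 1, x $ 3, x $ 2], \<lambda>x. vector [x $ 3, x $ 2, x $ 1],
      \<lambda>x. vector [x $ 2, x $ 3, x $ 1], \<lambda>x. vector [x $ 3, x $ 1, x $ 2]]"
  have ws: "weyl_group sl3 = set ws"
    unfolding weyl_group_sl3 ws_def by (simp only: list.set)
  \<comment> \<open>The known order 6 of the Weyl group forces the six listed maps to be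
    distinct.\<close>
  have "card (set ws) = length ws"
    unfolding ws[symmetric] card_weyl_group_sl3 by (simp add: ws_def)
  hence "distinct ws" by (rule card_distinct)
  have v: "\<alpha>\<^sub>1 = vector [1, - 1, 0]" "\<alpha>\<^sub>2 = vector [0, 1, - 1]" "\<alpha>\<^sub>3 = vector [1, 0, - 1]"
    "- \<alpha>\<^sub>1 = vector [- 1, 1, 0]" "- \<alpha>\<^sub>2 = vector [0, - 1, 1]" "- \<alpha>\<^sub>3 = vector [- 1, 0, 1]"
    by (simp_all add: vec_eq_iff forall_3 \<alpha>\<^sub>1_def \<alpha>\<^sub>2_def \<alpha>\<^sub>3_def axis_def)
  have "(\<Sum>\<sigma>\<in>weyl_group sl3. \<phi> (\<sigma> \<alpha>\<^sub>1) (\<sigma> \<alpha>\<^sub>2) (\<sigma> \<alpha>\<^sub>3)) =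
      (\<Sum>\<sigma>\<leftarrow>ws. \<phi> (\<sigma> \<alpha>\<^sub>1) (\<sigma> \<alpha>\<^sub>2) (\<sigma> \<alpha>\<^sub>3))"
    unfolding ws by (rule sum.distinct_set_conv_list[OF \<open>distinct ws\<close>])
  also have "\<dots> = \<phi> \<alpha>\<^sub>1 \<alpha>\<^sub>2 \<alpha>\<^sub>3 + \<phi> (- \<alpha>\<^sub>1) \<alpha>\<^sub>3 \<alpha>\<^sub>2 + \<phi> \<alpha>\<^sub>3 (- \<alpha>\<^sub>2) \<alpha>\<^sub>1 + \<phi> (- \<alpha>\<^sub>2) (- \<alpha>\<^sub>1) (- \<alpha>\<^sub>3) +
    \<phi> (- \<alpha>\<^sub>3) \<alpha>\<^sub>1 (- \<alpha>\<^sub>2) + \<phi> \<alpha>\<^sub>2 (- \<alpha>\<^sub>3) (- \<alpha>\<^sub>1)"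
    unfolding ws_def v(1-3) by (simp add: vector_3 add.assoc v(4-6)[unfolded v(1-3)])
  finally show ?thesis .
qed

text \<open>Up to sign the Weyl group permutes the three roots in all six orders. A chamber sum
  depends only on which root is highest, so each of three values occurs twice, which is the factor 2
  of the chamber decomposition.\<close>

lemma weyl_zeta_sum_in_QM:
  fixes k :: "real ^ 3 \<Rightarrow> nat"
  assumes k: "\<And>\<alpha>. \<alpha> \<in> sl3 \<Longrightarrow> k \<alpha> > 0" "\<And>\<alpha>. \<alpha> \<in> sl3 \<Longrightarrow> k (- \<alpha>) = k \<alpha>"
  shows "(\<lambda>\<tau>. \<Sum>\<sigma>\<in>weyl_group sl3. zeta_sl3 (2 * k (\<sigma> \<alpha>\<^sub>1)) (2 * k (\<sigma> \<alpha>\<^sub>2)) (2 * k (\<sigma> \<alpha>\<^sub>3)) \<tau>) \<in> QM"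
proof -
  have in_sl3: "\<alpha>\<^sub>1 \<in> sl3" "\<alpha>\<^sub>2 \<in> sl3" "\<alpha>\<^sub>3 \<in> sl3" by (simp_all add: sl3_def)
  have "k \<alpha>\<^sub>1 \<ge> 1" "k \<alpha>\<^sub>2 \<ge> 1" "k \<alpha>\<^sub>3 \<ge> 1" using k(1) in_sl3 by (simp_all add: Suc_le_eq)
  from chamber_sums_in_QM[OF this even_zero even_zero even_zero]
  show ?thesis
  proof (rule QM.cong)
    fix \<tau> :: complex assume "Im \<tau> > 0"
    note zeta = zeta_sl3_eq_chamber_sum[OF this]
    let ?c = "\<lambda>\<alpha> \<beta> \<gamma>. chamber_sum (root_factor 0 (k \<alpha>) \<tau>) (root_factor 0 (k \<beta>) \<tau>) (root_factor 0 (k \<gamma>) \<tau>)"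
    have "(\<Sum>\<sigma>\<in>weyl_group sl3. zeta_sl3 (2 * k (\<sigma> \<alpha>\<^sub>1)) (2 * k (\<sigma> \<alpha>\<^sub>2)) (2 * k (\<sigma> \<alpha>\<^sub>3)) \<tau>) =
        ?c \<alpha>\<^sub>1 \<alpha>\<^sub>2 \<alpha>\<^sub>3 + ?c \<alpha>\<^sub>1 \<alpha>\<^sub>3 \<alpha>\<^sub>2 + ?c \<alpha>\<^sub>3 \<alpha>\<^sub>2 \<alpha>\<^sub>1 + ?c \<alpha>\<^sub>2 \<alpha>\<^sub>1 \<alpha>\<^sub>3 + ?c \<alpha>\<^sub>3 \<alpha>\<^sub>1 \<alpha>\<^sub>2 + ?c \<alpha>\<^sub>2 \<alpha>\<^sub>3 \<alpha>\<^sub>1"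
      unfolding zeta weyl_images[of ?c] k(2)[OF in_sl3(1)] k(2)[OF in_sl3(2)] k(2)[OF in_sl3(3)] ..
    also have "\<dots> = 2 * (?c \<alpha>\<^sub>1 \<alpha>\<^sub>2 \<alpha>\<^sub>3 + ?c \<alpha>\<^sub>1 \<alpha>\<^sub>3 \<alpha>\<^sub>2 + ?c \<alpha>\<^sub>2 \<alpha>\<^sub>3 \<alpha>\<^sub>1)"
      using chamber_sum_commute[of "root_factor 0 (k \<alpha>\<^sub>1) \<tau>" "root_factor 0 (k \<alpha>\<^sub>2) \<tau>" "root_factor 0 (k \<alpha>\<^sub>3) \<tau>"]
        chamber_sum_commute[of "root_factor 0 (k \<alpha>\<^sub>1) \<tau>" "root_factor 0 (k \<alpha>\<^sub>3) \<tau>" "root_factor 0 (k \<alpha>\<^sub>2) \<tau>"]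
        chamber_sum_commute[of "root_factor 0 (k \<alpha>\<^sub>2) \<tau>" "root_factor 0 (k \<alpha>\<^sub>3) \<tau>" "root_factor 0 (k \<alpha>\<^sub>1) \<tau>"]
      by simp
    finally show "(\<Sum>\<sigma>\<in>weyl_group sl3. zeta_sl3 (2 * k (\<sigma> \<alpha>\<^sub>1)) (2 * k (\<sigma> \<alpha>\<^sub>2)) (2 * k (\<sigma> \<alpha>\<^sub>3)) \<tau>) =
        2 * (?c \<alpha>\<^sub>1 \<alpha>\<^sub>2 \<alpha>\<^sub>3 + ?c \<alpha>\<^sub>1 \<alpha>\<^sub>3 \<alpha>\<^sub>2 + ?c \<alpha>\<^sub>2 \<alpha>\<^sub>3 \<alpha>\<^sub>1)" .
  qed
qed

text \<open>With equal data on all roots the six chambers contribute equally.\<close>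

lemma chamber_sum_diagonal_in_QM:
  assumes "n \<ge> 1" "even c"
  shows "(\<lambda>\<tau>. chamber_sum (root_factor c n \<tau>) (root_factor c n \<tau>) (root_factor c n \<tau>)) \<in> QM"
  by (rule QM.cong[OF QM_cmult[OF chamber_sums_in_QM[OF assms(1,1,1,2,2,2)], of "1 / 6"]]) simp

text \<open>Needed to cancel the power of eta by which \<open>ch_V\<close> divides. An absolutely
  convergent product of nonzero factors does not vanish.\<close>

lemma dedekind_eta_nonzero:
  assumes "Im \<tau> > 0"
  shows "dedekind_eta \<tau> \<noteq> 0"
proof -
  interpret nome "nome_of \<tau>" by (rule nome_nome_of[OF assms])
  let ?q = "nome_of \<tau>"
  have "summable (\<lambda>i. norm ?q * norm ?q ^ i)"
    by (intro summable_mult summable_geometric) (use norm_q_less in simp)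
  hence "summable (\<lambda>i. norm ((1 - ?q ^ Suc i) - 1))"
    by (simp add: norm_mult norm_power)
  hence "convergent_prod (\<lambda>i. 1 - ?q ^ Suc i)"
    by (intro abs_convergent_prod_imp_convergent_prod summable_imp_abs_convergent_prod)
  moreover have "1 - ?q ^ Suc i \<noteq> 0" for i
    using powi_neq_1[of "int (Suc i)"] unfolding power_int_of_nat by (simp del: power_Suc)
  ultimately have "(\<Prod>i. 1 - ?q ^ Suc i) \<noteq> 0" by (rule prodinf_nonzero)
  thus ?thesis unfolding dedekind_eta_def qpow_of_nat by (simp add: qpow_def del: power_Suc)
qed

lemma rank_sl3: "rank_g sl3 = 2"
proof -
  have "\<alpha>\<^sub>3 \<in> span {\<alpha>\<^sub>1, \<alpha>\<^sub>2}"
    unfolding \<alpha>\<^sub>3_def by (intro span_add span_base) auto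
  hence span: "span sl3 = span {\<alpha>\<^sub>1, \<alpha>\<^sub>2}"
    unfolding sl3_def using span_redundant[of "\<alpha>\<^sub>3" "{\<alpha>\<^sub>1, \<alpha>\<^sub>2}"]
    by (simp add: insert_commute)
  have "\<alpha>\<^sub>1 \<notin> span {\<alpha>\<^sub>2}"
  proof
    assume "\<alpha>\<^sub>1 \<in> span {\<alpha>\<^sub>2}"
    then obtain c where c: "\<alpha>\<^sub>1 = c *\<^sub>R \<alpha>\<^sub>2" unfolding span_singleton by blast
    \<comment> \<open>Pairing with the two roots gives 2 = - c and - 1 = 2 c.\<close>
    show False
      using arg_cong[OF c, of "\<lambda>x. x \<bullet> \<alpha>\<^sub>1"] arg_cong[OF c, of "\<lambda>x. x \<bullet> \<alpha>\<^sub>2"] by simp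
  qed
  moreover have "\<alpha>\<^sub>2 \<noteq> 0" using inner_roots(2) by force
  ultimately have "independent {\<alpha>\<^sub>1, \<alpha>\<^sub>2}"
    by (simp add: independent_insert)
  hence "dim {\<alpha>\<^sub>1, \<alpha>\<^sub>2} = card {\<alpha>\<^sub>1, \<alpha>\<^sub>2}" by (rule dim_eq_card_independent)
  thus ?thesis unfolding rank_g_def span dim_span by simp
qed

lemma m_exponent_sl3: "m_exponent sl3 k = 8 * k - 2 * (k - 2)"
proof -
  have "card sl3 = 3" by (simp add: sl3_def)
  thus ?thesis by (simp add: m_exponent_def dim_g_def rank_sl3)
qed

lemma ch_V_sl3_eq_chamber_sum:
  assumes "Im \<tau> > 0"
  shows "dedekind_eta \<tau> ^ m_exponent sl3 (2 * n + 2) * ch_V sl3 (2 * n + 2) \<tau> =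
    (1 / 2) ^ (2 * n + 2) * chamber_sum (root_factor (2 * n + 2) n \<tau>) (root_factor (2 * n + 2) n \<tau>)
      (root_factor (2 * n + 2) n \<tau>)"
proof -
  interpret nome "nome_of \<tau>" by (rule nome_nome_of[OF assms])
  let ?k = "2 * n + 2"
  let ?w = "root_factor ?k n \<tau>"
  let ?f = "\<lambda>\<mu>. of_real (dim_V sl3 \<mu>) ^ ?k * qpow \<tau> (real (?k - 2) * ((\<mu> + rho sl3) \<bullet> rho sl3)) /
    (\<Prod>\<alpha>\<in>sl3. (1 - qpow \<tau> ((\<mu> + rho sl3) \<bullet> \<alpha>)) ^ (?k - 2))"
  have "?f (sl3_weight (m1, m2)) = (1 / 2) ^ ?k * (?w (int m1) * ?w (int m2) * ?w (int m1 + int m2))"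
    if m: "m1 \<ge> 1" "m2 \<ge> 1" for m1 m2
  proof -
    have k: "?k - 2 = 2 * n" by simp
    have s: "int m1 + int m2 = int (m1 + m2)" "real m1 + real m2 = real (m1 + m2)" by simp_all
    \<comment> \<open>Since rho is half the sum of the positive roots, the exponent distributes over
      the three roots with equal weight n.\<close>
    have e: "real (2 * n) * real (m1 + m2) = real (n * m1 + n * m2 + n * (m1 + m2))"
      by (simp add: algebra_simps)
    have p: "(\<Prod>\<alpha>\<in>sl3. f \<alpha>) = f \<alpha>\<^sub>1 * (f \<alpha>\<^sub>2 * f \<alpha>\<^sub>3)" for f :: "real ^ 3 \<Rightarrow> complex"
      by (simp add: sl3_def)
    have d: "complex_of_real (1 / 2 * real m1 * real m2 * real (m1 + m2)) ^ ?k =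
        (1 / 2) ^ ?k * (of_nat m1 ^ ?k * (of_nat m2 ^ ?k * of_nat (m1 + m2) ^ ?k))"
      by (simp only: of_real_mult of_real_of_nat_eq of_real_divide of_real_1 of_real_numeral
          power_mult_distrib mult.assoc)
    have w: "?w (int a) = of_nat a ^ ?k * (nome_of \<tau> ^ (n * a) / (1 - nome_of \<tau> ^ a) ^ (2 * n))"
      if "a \<ge> 1" for a
      by (rule root_factor_of_nat[OF HOL.refl that])
    have m3: "m1 + m2 \<ge> 1" using m by simp
    show ?thesis
      unfolding p dim_V_sl3 rho_sl3[symmetric] inner_sl3_weight
      unfolding rho_sl3 inner_sl3_weight[unfolded rho_sl3] k s
      unfolding e d
      unfolding qpow_of_nat w[OF m(1)] w[OF m(2)] w[OF m3]
      unfolding power_add[of "nome_of \<tau>"]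
      by (simp only: times_divide_eq_right times_divide_eq_left divide_divide_eq_left mult_ac)
  qed
  hence "(\<Sum>\<^sub>\<infinity>\<mu>\<in>dominant_weights sl3. ?f \<mu>) =
      (\<Sum>\<^sub>\<infinity>(m1, m2)\<in>{1..} \<times> {1..}. (1 / 2) ^ ?k * (?w (int m1) * ?w (int m2) * ?w (int m1 + int m2)))"
    unfolding infsum_reindex_bij_betw[OF dominant_weights_sl3, symmetric]
    by (intro infsum_cong) auto
  also have "\<dots> = (1 / 2) ^ ?k * chamber_sum ?w ?w ?w"
    unfolding chamber_sum_def case_prod_unfold by (rule infsum_cmult_right')
  finally show ?thesis
    unfolding ch_V_def using dedekind_eta_nonzero[OF assms] by simp
qed

theorem corollary1p7:
  shows
    "(\<forall>k :: real ^ 3 \<Rightarrow> nat. (\<forall>\<alpha>\<in>sl3. k \<alpha> > 0 \<and> k (- \<alpha>) = k \<alpha>) \<longrightarrow>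
        (\<lambda>\<tau>. \<Sum>\<sigma>\<in>weyl_group sl3. zeta_sl3 (2 * k (\<sigma> \<alpha>\<^sub>1)) (2 * k (\<sigma> \<alpha>\<^sub>2)) (2 * k (\<sigma> \<alpha>\<^sub>3)) \<tau>) \<in> QM)
   \<and> (\<forall>k :: nat. k \<ge> 1 \<longrightarrow> zeta_sl3 (2 * k) (2 * k) (2 * k) \<in> QM)
   \<and> (\<forall>k :: nat. even k \<and> k > 3 \<longrightarrow>
        m_exponent sl3 k = 8 * k - 2 * (k - 2) \<and> m_exponent sl3 k = 6 * k + 4 \<and>
        (\<lambda>\<tau>. dedekind_eta \<tau> ^ m_exponent sl3 k * ch_V sl3 k \<tau>) \<in> QM)"
proof (intro conjI allI impI)
  fix k :: "real ^ 3 \<Rightarrow> nat" assume "\<forall>\<alpha>\<in>sl3. k \<alpha> > 0 \<and> k (- \<alpha>) = k \<alpha>"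
  thus "(\<lambda>\<tau>. \<Sum>\<sigma>\<in>weyl_group sl3. zeta_sl3 (2 * k (\<sigma> \<alpha>\<^sub>1)) (2 * k (\<sigma> \<alpha>\<^sub>2)) (2 * k (\<sigma> \<alpha>\<^sub>3)) \<tau>) \<in> QM"
    by (intro weyl_zeta_sum_in_QM) auto
next
  fix k :: nat assume "k \<ge> 1"
  from chamber_sum_diagonal_in_QM[OF this even_zero]
  show "zeta_sl3 (2 * k) (2 * k) (2 * k) \<in> QM"
    by (rule QM.cong) (rule zeta_sl3_eq_chamber_sum)
next
  fix k :: nat assume k: "even k \<and> k > 3"
  show "m_exponent sl3 k = 8 * k - 2 * (k - 2)" by (rule m_exponent_sl3)
  \<comment> \<open>The bound k > 3 makes the truncated subtraction k - 2 exact.\<close>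
  show "m_exponent sl3 k = 6 * k + 4" using k unfolding m_exponent_sl3 by arith
  from k obtain j where "k = 2 * j" by (auto elim: evenE)
  \<comment> \<open>The exponent k - 2 of each root is 2 n, and k > 3 gives n \<ge> 1, so that every
    root factor decays.\<close>
  with k obtain n where n: "k = 2 * n + 2" "n \<ge> 1"
    by (intro that[of "j - 1"]) auto
  have "even (2 * n + 2)" by simp
  from QM_cmult[OF chamber_sum_diagonal_in_QM[OF n(2) this], of "(1 / 2) ^ (2 * n + 2)"]
  show "(\<lambda>\<tau>. dedekind_eta \<tau> ^ m_exponent sl3 k * ch_V sl3 k \<tau>) \<in> QM"
    unfolding n(1) by (rule QM.cong) (rule ch_V_sl3_eq_chamber_sum)
qed

end
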